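(* Let $N\ge 2$ be an integer, let $k\ge 1$ be a real number, and let $\epsilon>0$ satisfy $$\sqrt{\frac{1+\ln N}{2k}}\;\le\;\epsilon\;\le\;\frac{1}{2\sqrt N}.$$ Let $X_{k,N}$ be a random vector distributed as the Hermite ensemble with parameters $k,N$, and let $\mathbf z_N\in\mathbb R^N$ be the vector of the decreasingly ordered zeros of the Hermite polynomial $H_N$. Then $$P\Bigl(\Bigl\|\frac{X_{k,N}}{\sqrt{2k}}-\mathbf z_N\Bigr\|_2>\epsilon\Bigr)\;\le\;\frac{32}{3}\,\epsilon^4kN^3-\frac{N-1}{26\,k}+E\cdot\frac{\sqrt e\,\sqrt N}{2}\,(2k\epsilon^2+1)\,e^{-k\epsilon^2},$$ where $$E:=\exp\Bigl(\frac1k\Bigl(\frac{N-1}{26}-\frac{32}{3}\,\epsilon^4k^2N^3\Bigr)\Bigr).$$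
   Context: Let $C_N^A:=\{x\in\mathbb R^N: x_1\ge x_2\ge\dots\ge x_N\}$. For real $k>0$ and an integer $N\ge2$, the ($\beta$-)Hermite ensemble with parameters $k,N$ (where $\beta=2k$) is a random vector $X_{k,N}$ with values in $C_N^A$ whose distribution has the Lebesgue density $$c_k^A\, e^{-\|x\|_2^2/2}\prod_{1\le i<j\le N}(x_i-x_j)^{2k}\qquad (x\in C_N^A),$$ with normalization constant $$c_k^A=\Bigl(\int_{C_N^A}e^{-\|y\|_2^2/2}\prod_{i<j}(y_i-y_j)^{2k}\,dy\Bigr)^{-1}=\frac{N!}{(2\pi)^{N/2}}\prod_{j=1}^N\frac{\Gamma(1+k)}{\Gamma(1+jk)}.$$ $(H_N)_{N\ge0}$ denotes the Hermite polynomials orthogonal with respect to the density $e^{-x^2}$ on $\mathbb R$ (physicists' convention), and $\mathbf z_N=(z_{1,N},\dots,z_{N,N})\in C_N^A$ is the vector of the $N$ zeros of $H_N$ in decreasing order. $\|\cdot\|_2$ is the Euclidean norm on $\mathbb R^N$, and $\ln$ is the natural logarithm. *)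

theory Defs
  imports
    "HOL-Probability.Probability"
    "HOL-Computational_Algebra.Polynomial"
    "HOL-Real_Asymp.Real_Asymp"
begin

section \<open>Hermite polynomials\<close>

definition hermite_inner :: "real poly \<Rightarrow> real poly \<Rightarrow> real" where
  "hermite_inner p q = (\<integral>x. poly p x * poly q x * exp (- x\<^sup>2) \<partial>lborel)"

text \<open>Orthogonality and degree fix each member of the family up to a scalar; the leading
  coefficient \<open>2 ^ n\<close> is the physicists' normalization.\<close>

definition hermite_family :: "(nat \<Rightarrow> real poly) \<Rightarrow> bool" where
  "hermite_family H \<longleftrightarrow>
     (\<forall>n. degree (H n) = n \<and> lead_coeff (H n) = 2 ^ n) \<and>
     (\<forall>m n. m \<noteq> n \<longrightarrow> hermite_inner (H m) (H n) = 0)"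

definition hermite_poly :: "nat \<Rightarrow> real poly" where
  "hermite_poly = (THE H. hermite_family H)"

lemma integrable_poly_gauss: "integrable lborel (\<lambda>x::real. poly p x * exp (- x\<^sup>2))"
proof -
  have mono: "integrable lborel (\<lambda>x::real. x ^ i * exp (- x\<^sup>2))" for i
  proof -
    have "integrable lborel (\<lambda>x. normal_density 0 (1 / sqrt 2) x * (x - 0) ^ i)"
      by (rule integrable_normal_moment) simp
    then have "integrable lborel (\<lambda>x. sqrt pi * (normal_density 0 (1 / sqrt 2) x * (x - 0) ^ i))"
      by (rule integrable_mult_right)
    then show ?thesis
      by (simp add: normal_density_def field_simps power_divide real_sqrt_divide)
  qed
  have "(\<lambda>x. poly p x * exp (- x\<^sup>2)) = (\<lambda>x. \<Sum>i\<le>degree p. coeff p i * (x ^ i * exp (- x\<^sup>2)))"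
    by (simp add: poly_altdef sum_distrib_right mult.assoc)
  then show ?thesis
    using mono by (simp del: mult_cancel_right)
qed

lemma poly_gauss_tendsto:
  "((\<lambda>x::real. poly p x * exp (- x\<^sup>2)) \<longlongrightarrow> 0) at_top"
  "((\<lambda>x::real. poly p x * exp (- x\<^sup>2)) \<longlongrightarrow> 0) at_bot"
proof -
  have eq: "(\<lambda>x. poly p x * exp (- x\<^sup>2)) = (\<lambda>x. \<Sum>i\<le>degree p. coeff p i * (x ^ i * exp (- x\<^sup>2)))"
    by (simp add: poly_altdef sum_distrib_right mult.assoc)
  have top: "((\<lambda>x::real. x ^ i * exp (- x\<^sup>2)) \<longlongrightarrow> 0) at_top" for i
    by real_asymp
  have bot: "((\<lambda>x::real. x ^ i * exp (- x\<^sup>2)) \<longlongrightarrow> 0) at_bot" for i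
  proof -
    have "((\<lambda>x::real. (-1) ^ i * (x ^ i * exp (- x\<^sup>2))) \<longlongrightarrow> (-1) ^ i * 0) at_top"
      by (intro tendsto_intros top)
    moreover have "(-1) ^ i * (x ^ i * exp (- x\<^sup>2)) = (- x) ^ i * exp (- (- x)\<^sup>2)" for x :: real
      by (simp add: power_minus[of x])
    ultimately show ?thesis
      by (simp add: filterlim_at_bot_mirror)
  qed
  show "((\<lambda>x::real. poly p x * exp (- x\<^sup>2)) \<longlongrightarrow> 0) at_top"
    unfolding eq by (rule tendsto_null_sum) (use tendsto_mult_right_zero[OF top] in simp)
  show "((\<lambda>x::real. poly p x * exp (- x\<^sup>2)) \<longlongrightarrow> 0) at_bot"
    unfolding eq by (rule tendsto_null_sum) (use tendsto_mult_right_zero[OF bot] in simp)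
qed

lemma integral_poly_gauss_deriv:
  fixes p :: "real poly"
  shows "(\<integral>x. poly (pderiv p - [:0, 2:] * p) x * exp (- x\<^sup>2) \<partial>lborel) = 0"
proof -
  let ?f = "\<lambda>x. poly (pderiv p - [:0, 2:] * p) x * exp (- x\<^sup>2)"
  let ?F = "\<lambda>x. poly p x * exp (- x\<^sup>2)"
  have "(LBINT x=-\<infinity>..\<infinity>. ?f x) = 0 - 0"
  proof (rule interval_integral_FTC_integrable[where F="?F"])
    show "(?F has_vector_derivative ?f x) (at x)" for x
      unfolding has_real_derivative_iff_has_vector_derivative[symmetric]
      by (auto intro!: derivative_eq_intros simp: algebra_simps)
    show "isCont ?f x" for x
      by (intro continuous_intros)
    show "set_integrable lborel (einterval (-\<infinity>) \<infinity>) ?f"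
      using integrable_poly_gauss[of "pderiv p - [:0, 2:] * p"]
      by (simp add: set_integrable_def del: poly_diff poly_mult)
    show "((?F \<circ> real_of_ereal) \<longlongrightarrow> 0) (at_right (-\<infinity>))"
      unfolding at_left_PInf at_right_MInf comp_def filterlim_filtermap
      using poly_gauss_tendsto(2)[of p] by simp
    show "((?F \<circ> real_of_ereal) \<longlongrightarrow> 0) (at_left \<infinity>)"
      unfolding at_left_PInf at_right_MInf comp_def filterlim_filtermap
      using poly_gauss_tendsto(1)[of p] by simp
  qed simp_all
  then show ?thesis
    by (simp add: interval_lebesgue_integral_def set_lebesgue_integral_def)
qed

lemma hermite_inner_commute: "hermite_inner p q = hermite_inner q p"
  by (simp add: hermite_inner_def mult.commute)

lemma integrable_hermite_inner:
  fixes p q :: "real poly"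
  shows "integrable lborel (\<lambda>x. poly p x * poly q x * exp (- x\<^sup>2))"
  using integrable_poly_gauss[of "p * q"] by simp

lemma hermite_inner_add: "hermite_inner (p + p') q = hermite_inner p q + hermite_inner p' q"
  unfolding hermite_inner_def
  by (subst Bochner_Integration.integral_add[symmetric])
     (use integrable_hermite_inner in \<open>simp_all add: algebra_simps\<close>)

lemma hermite_inner_smult: "hermite_inner (smult c p) q = c * hermite_inner p q"
  unfolding hermite_inner_def by (simp add: mult.assoc)

lemma hermite_inner_diff: "hermite_inner (p - p') q = hermite_inner p q - hermite_inner p' q"
  using hermite_inner_add[of p "smult (-1) p'" q] hermite_inner_smult[of "-1" p' q] by simp

lemma hermite_inner_self_eq_0:
  fixes p q :: "real poly"
  assumes "\<And>x. poly (p * q) x \<ge> 0" "hermite_inner p q = 0"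
  shows "p * q = 0"
proof -
  have "AE x in lborel. poly p x * poly q x * exp (- x\<^sup>2) = 0"
    using assms integrable_hermite_inner[of p q] unfolding hermite_inner_def
    by (subst integral_nonneg_eq_0_iff_AE[symmetric]) auto
  then have ae: "AE x in lborel. poly (p * q) x = 0"
    by simp
  have "poly (p * q) x = 0" for x
  proof (rule ccontr)
    assume *: "poly (p * q) x \<noteq> 0"
    have "finite {x. poly (p * q) x = 0}"
      using * by (intro poly_roots_finite) auto
    then have "AE x in lborel. x \<notin> {x. poly (p * q) x = 0}"
      by (intro AE_not_in finite_imp_null_set_lborel)
    with ae have "AE x::real in lborel. False"
      by eventually_elim auto
    then show False
      by (simp add: AE_iff_measurable[of UNIV])
  qed
  then show ?thesis
    by (intro poly_all_0_iff_0[THEN iffD1]) auto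
qed

fun hermite_rec :: "nat \<Rightarrow> real poly" where
  "hermite_rec 0 = 1"
| "hermite_rec (Suc n) = [:0, 2:] * hermite_rec n - pderiv (hermite_rec n)"

lemma hermite_rec_degree:
  "degree (hermite_rec n) = n \<and> lead_coeff (hermite_rec n) = 2 ^ n"
proof (induction n)
  case (Suc n)
  let ?h = "hermite_rec n"
  have nz: "?h \<noteq> 0"
    using Suc by (metis leading_coeff_0_iff power_not_zero zero_neq_numeral)
  have d: "degree ([:0, 2:] * ?h) = Suc n"
    using nz Suc by (subst degree_mult_eq) auto
  have lt: "degree (- pderiv ?h) < degree ([:0, 2:] * ?h)"
    using d Suc by (simp add: degree_pderiv)
  have "degree (hermite_rec (Suc n)) = Suc n"
    using degree_add_eq_left[OF lt] d by simp
  moreover have "lead_coeff (hermite_rec (Suc n)) = 2 ^ Suc n"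
  proof -
    have "coeff (pderiv ?h) (Suc n) = 0"
      using Suc by (intro coeff_eq_0) (simp add: degree_pderiv)
    moreover have "coeff ([:0, 2:] * ?h) (Suc n) = 2 * 2 ^ n"
    proof -
      have "coeff ?h n = 2 ^ n" using Suc by metis
      then show ?thesis by simp
    qed
    ultimately show ?thesis
      unfolding \<open>degree (hermite_rec (Suc n)) = Suc n\<close> by (simp del: mult_pCons_left)
  qed
  ultimately show ?case by blast
qed simp

lemma hermite_rec_step: "hermite_inner q (hermite_rec (Suc n)) = hermite_inner (pderiv q) (hermite_rec n)"
proof -
  let ?h = "hermite_rec n"
  have "hermite_inner (pderiv q) ?h - hermite_inner q (hermite_rec (Suc n))
      = (\<integral>x. poly (pderiv (q * ?h) - [:0, 2:] * (q * ?h)) x * exp (- x\<^sup>2) \<partial>lborel)"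
    unfolding hermite_inner_def
    by (subst Bochner_Integration.integral_diff[symmetric, OF integrable_hermite_inner integrable_hermite_inner])
       (simp add: pderiv_mult algebra_simps)
  then show ?thesis
    using integral_poly_gauss_deriv[of "q * ?h"] by simp
qed

lemma hermite_rec_orthogonal_lower: "degree q < n \<Longrightarrow> hermite_inner q (hermite_rec n) = 0"
proof (induction n arbitrary: q)
  case (Suc n)
  show ?case
  proof (cases "degree q")
    case 0
    then have "pderiv q = 0" by (simp add: pderiv_eq_0_iff)
    then show ?thesis
      unfolding hermite_rec_step by (simp add: hermite_inner_def)
  next
    case (Suc d)
    then show ?thesis
      unfolding hermite_rec_step using Suc.prems by (intro Suc.IH) (simp add: degree_pderiv)
  qed
qed simp

lemma hermite_family_rec: "hermite_family hermite_rec"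
  unfolding hermite_family_def
proof (intro conjI allI impI)
  fix m n :: nat assume "m \<noteq> n"
  then show "hermite_inner (hermite_rec m) (hermite_rec n) = 0"
    using hermite_rec_degree hermite_rec_orthogonal_lower[of "hermite_rec m" n]
      hermite_rec_orthogonal_lower[of "hermite_rec n" m] hermite_inner_commute
    by (metis linorder_neqE_nat)
next
  fix n
  show "degree (hermite_rec n) = n" "lead_coeff (hermite_rec n) = 2 ^ n"
    using hermite_rec_degree[of n] by blast+
qed

lemma hermite_family_orthogonal_lower:
  assumes "hermite_family H" "degree q < n"
  shows "hermite_inner q (H n) = 0"
  using assms(2)
proof (induction "degree q" arbitrary: q rule: less_induct)
  case less
  let ?c = "lead_coeff q / 2 ^ degree q"
  let ?r = "q - smult ?c (H (degree q))"
  have H: "degree (H m) = m" "coeff (H m) m = 2 ^ m" "m \<noteq> n \<Longrightarrow> hermite_inner (H m) (H n) = 0" for m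
    using assms(1) unfolding hermite_family_def by metis+
  have q: "hermite_inner q (H n) = hermite_inner ?r (H n)"
    using less.prems by (simp add: hermite_inner_diff hermite_inner_smult H(3))
  show ?case
  proof (cases "?r = 0")
    case True
    then show ?thesis using q by (simp add: hermite_inner_def)
  next
    case False
    have "degree ?r \<le> degree q"
      by (intro degree_diff_le) (use H(1) degree_smult_le[of ?c "H (degree q)"] in auto)
    moreover have "coeff ?r (degree q) = 0"
      by (simp add: H(2))
    ultimately have "degree ?r < degree q"
      using False by (metis leading_coeff_0_iff order_le_less)
    then show ?thesis
      using q less by (metis order.strict_trans)
  qed
qed

lemma hermite_family_unique:
  assumes "hermite_family H" "hermite_family G"
  shows "H = G"
proof
  fix n
  have H: "degree (H n) = n" "coeff (H n) n = 2 ^ n" and G: "degree (G n) = n" "coeff (G n) n = 2 ^ n"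
    using assms unfolding hermite_family_def by metis+
  show "H n = G n"
  proof (rule ccontr)
    let ?r = "H n - G n"
    assume "H n \<noteq> G n"
    then have nz: "?r \<noteq> 0" by simp
    have "degree ?r \<le> n"
      by (intro degree_diff_le) (use H(1) G(1) in auto)
    moreover have "coeff ?r n = 0"
      by (simp add: H(2) G(2))
    ultimately have "degree ?r < n"
      using nz by (metis leading_coeff_0_iff order_le_less)
    then have "hermite_inner ?r (H n) = 0" "hermite_inner ?r (G n) = 0"
      using assms hermite_family_orthogonal_lower by blast+
    then have "hermite_inner ?r ?r = 0"
      using hermite_inner_diff hermite_inner_commute by (metis diff_self)
    then have "?r * ?r = 0"
      by (intro hermite_inner_self_eq_0) simp_all
    then show False using nz by simp
  qed
qed

lemma hermite_poly_eq_rec: "hermite_poly = hermite_rec"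
  unfolding hermite_poly_def
  using hermite_family_rec hermite_family_unique by (intro the_equality) blast+

lemma hermite_family_hermite_poly: "hermite_family hermite_poly"
  by (simp add: hermite_poly_eq_rec hermite_family_rec)

lemma poly_even_order_sign:
  fixes p :: "real poly"
  assumes "p \<noteq> 0" "\<And>a. even (order a p)"
  shows "(\<forall>x. poly p x \<ge> 0) \<or> (\<forall>x. poly p x \<le> 0)"
  using assms
proof (induction "degree p" arbitrary: p rule: less_induct)
  case less
  show ?case
  proof (cases "\<exists>a. poly p a = 0")
    case True
    then obtain a where a: "poly p a = 0" by blast
    then have "order a p \<noteq> 0" using less.prems(1) order_root by blast
    then have "order a p \<ge> 2" using less.prems(2)[of a] by presburger
    then have "[:-a, 1:] ^ 2 dvd p"
      using order_1[of a p] dvd_trans le_imp_power_dvd by blast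
    then obtain q where q: "p = [:-a, 1:] ^ 2 * q" by blast
    have q0: "q \<noteq> 0" using q less.prems(1) by auto
    have deg: "degree q < degree p"
      using q0 unfolding q by (subst degree_mult_eq) (auto simp: degree_power_eq)
    have "even (order b q)" for b
    proof -
      have "order b p = order b ([:-a, 1:] ^ 2) + order b q"
        using less.prems(1) unfolding q by (rule order_mult)
      moreover have "order b ([:-a, 1:] ^ 2) = 2 * order b [:-a, 1:]"
        using order_mult[of "[:-a,1:]" "[:-a,1:]" b] by (simp add: power2_eq_square)
      ultimately show ?thesis using less.prems(2)[of b] by simp
    qed
    then have "(\<forall>x. poly q x \<ge> 0) \<or> (\<forall>x. poly q x \<le> 0)"
      using less.hyps deg q0 by blast
    then show ?thesis
      unfolding q by (auto simp: mult_nonneg_nonpos)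
  next
    case False
    show ?thesis
    proof (rule ccontr)
      assume "\<not> ?thesis"
      then obtain x y where xy: "poly p x < 0" "poly p y > 0" by (auto simp: not_le)
      then have "x \<noteq> y" by auto
      then show False
        using False xy poly_IVT_pos[of x y p] poly_IVT_neg[of y x p] by (metis linorder_neqE)
    qed
  qed
qed

text \<open>\<open>H\<^sub>N\<close> has \<open>N\<close> distinct real zeros, so that sorting the set of its real zeros loses nothing.\<close>

lemma card_hermite_roots: "card {x. poly (hermite_poly n) x = 0} = n"
proof -
  let ?H = "hermite_poly n"
  let ?S = "{a. odd (order a ?H)}"
  define q where "q = (\<Prod>a\<in>?S. [:-a, 1:])"
  have deg: "degree ?H = n" and lc: "coeff ?H n = 2 ^ n"
    using hermite_family_hermite_poly unfolding hermite_family_def by metis+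
  have nz: "?H \<noteq> 0" using lc by auto
  have fin: "finite {x. poly ?H x = 0}" by (rule poly_roots_finite[OF nz])
  have sub: "?S \<subseteq> {x. poly ?H x = 0}"
    using nz by (auto simp: order_root elim: oddE)
  have finS: "finite ?S" using sub fin finite_subset by blast
  have q0: "q \<noteq> 0" unfolding q_def using finS by simp
  have ordS: "order b (\<Prod>a\<in>T. [:-a, 1:]) = (if b \<in> T then 1 else 0)" if "finite T" for T and b :: real
    using that
  proof (induction T rule: finite_induct)
    case (insert c T)
    have lin: "order b [:-c, 1:] = (if b = c then 1 else 0)"
      using order_power_n_n[of c 1] by (auto intro: order_0I)
    have "[:-c, 1:] * (\<Prod>a\<in>T. [:-a, 1:]) \<noteq> 0"
      using insert.hyps(1) by (simp only: mult_eq_0_iff prod_zero_iff pCons_eq_0_iff) simp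
    from order_mult[OF this, of b] show ?case
      using insert lin by auto
  qed simp
  have ordq: "order b q = (if b \<in> ?S then 1 else 0)" for b
    unfolding q_def using ordS[OF finS] .
  have "even (order b (q * ?H))" for b
    using order_mult[of q ?H b] q0 nz ordq[of b] by auto
  then have sign: "(\<forall>x. poly (q * ?H) x \<ge> 0) \<or> (\<forall>x. poly (q * ?H) x \<le> 0)"
    using poly_even_order_sign[of "q * ?H"] q0 nz by auto
  have degq: "degree q = card ?S"
    unfolding q_def by (subst degree_prod_eq_sum_degree) auto
  have "\<not> card ?S < n"
  proof
    assume "card ?S < n"
    then have 0: "hermite_inner q ?H = 0"
      using hermite_family_orthogonal_lower[OF hermite_family_hermite_poly] degq by simp
    from sign show False
    proof
      assume "\<forall>x. poly (q * ?H) x \<ge> 0"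
      then have "q * ?H = 0" using 0 by (intro hermite_inner_self_eq_0) auto
      then show False using q0 nz by simp
    next
      assume "\<forall>x. poly (q * ?H) x \<le> 0"
      then have "smult (-1) q * ?H = 0"
        using 0 hermite_inner_smult[of "-1" q ?H] by (intro hermite_inner_self_eq_0) auto
      then show False using q0 nz by simp
    qed
  qed
  moreover have "card ?S \<le> card {x. poly ?H x = 0}"
    using sub fin by (rule card_mono[rotated])
  moreover have "card {x. poly ?H x = 0} \<le> n"
    using card_poly_roots_bound[OF nz] deg by simp
  ultimately show ?thesis by simp
qed

text \<open>\<open>hermite_zeros N i\<close> is \<open>z\<^bsub>i,N\<^esub>\<close> for \<open>1 \<le> i \<le> N\<close>, in decreasing order;
  other indices are irrelevant.\<close>

definition hermite_zeros :: "nat \<Rightarrow> nat \<Rightarrow> real" where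
  "hermite_zeros N i = rev (sorted_list_of_set {x. poly (hermite_poly N) x = 0}) ! (i - 1)"

section \<open>The Hermite ensemble\<close>

text \<open>\<open>\<real>\<^sup>N\<close> is the product space of \<open>N\<close> copies of the real line, indexed by \<open>{1..N}\<close>,
  with its Lebesgue measure.\<close>

abbreviation lebesgue_RN :: "nat \<Rightarrow> (nat \<Rightarrow> real) measure" where
  "lebesgue_RN N \<equiv> (\<Pi>\<^sub>M i\<in>{1..N}. lborel)"

definition weyl_chamber_A :: "nat \<Rightarrow> (nat \<Rightarrow> real) set" where
  "weyl_chamber_A N = {x \<in> extensional {1..N}. antimono_on {1..N} x}"

text \<open>Only used on the chamber, where the bases of the powers are nonnegative.\<close>

definition hermite_weight :: "real \<Rightarrow> nat \<Rightarrow> (nat \<Rightarrow> real) \<Rightarrow> real" where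
  "hermite_weight k N x =
     exp (- (L2_set x {1..N})\<^sup>2 / 2) * (\<Prod>j\<in>{1..N}. \<Prod>i\<in>{1..<j}. (x i - x j) powr (2 * k))"

definition hermite_const :: "real \<Rightarrow> nat \<Rightarrow> real" where
  "hermite_const k N = inverse (set_lebesgue_integral (lebesgue_RN N) (weyl_chamber_A N) (hermite_weight k N))"

text \<open>On all of \<open>\<real>\<^sup>N\<close>, by zero outside the chamber.\<close>

definition hermite_density :: "real \<Rightarrow> nat \<Rightarrow> (nat \<Rightarrow> real) \<Rightarrow> real" where
  "hermite_density k N x = indicator (weyl_chamber_A N) x * (hermite_const k N * hermite_weight k N x)"

definition hermite_ensemble ::
  "'a measure \<Rightarrow> ('a \<Rightarrow> nat \<Rightarrow> real) \<Rightarrow> real \<Rightarrow> nat \<Rightarrow> bool" where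
  "hermite_ensemble M X k N \<longleftrightarrow>
     distributed M (lebesgue_RN N) X (\<lambda>x. ennreal (hermite_density k N x))"

end

theory Submission
  imports Defs "Jordan_Normal_Form.Determinant"
begin

text \<open>Write \<open>x = sqrt (2 k) (z + y)\<close>, \<open>s = 2 k \<epsilon>\<^sup>2\<close> and \<open>u\<^sub>i\<^sub>j = (y\<^sub>i - y\<^sub>j) / (z\<^sub>i - z\<^sub>j)\<close>. The Stieltjes relations
  \<open>z\<^sub>i = \<Sum> 1 / (z\<^sub>i - z\<^sub>j)\<close> turn the density of \<open>y\<close> into a multiple of
  \<open>exp (- k |y|\<^sup>2 - 2 k \<Sum> (u\<^sub>i\<^sub>j - ln (1 + u\<^sub>i\<^sub>j)))\<close>, a perturbation of the Gaussian
  \<open>exp (- k (|y|\<^sup>2 + \<Sum> u\<^sub>i\<^sub>j\<^sup>2))\<close> whose quadratic form has eigenvalues \<open>1, \<dots>, N\<close>. The claimed bound has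
  the form \<open>\<delta> + exp (- \<delta>) T\<close> with \<open>\<delta> \<ge> 0\<close>. It exceeds 1 if \<open>\<delta> \<ge> 1\<close> or \<open>T \<ge> 1\<close>, and it exceeds \<open>T\<close> if
  \<open>\<delta>, T < 1\<close>; in that last case \<open>s > 3\<close> and \<open>k \<ge> 23 N\<^sup>3\<close>, so it is enough to prove the tail bound \<open>T\<close>
  when the perturbation is small. Chernoff's inequality with \<open>exp ((1 - 1 / s) k |y|\<^sup>2)\<close> reduces this to
  comparing two integrals of the perturbed density with Gaussian ones: where \<open>\<Sum> u\<^sub>i\<^sub>j\<^sup>2\<close> is small one uses
  Taylor bounds (symmetrized under \<open>y \<mapsto> - y\<close> for the lower bound, which removes the cubic term), and
  elsewhere convexity of the potential along rays. For the Gaussian alone this Chernoff bound is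
  \<open>sqrt (e N s) exp (- s / 2)\<close>, smaller than \<open>T\<close> by enough to absorb the comparison constant \<open>4 / 3\<close>.\<close>

section \<open>Lebesgue integrals of functions of a quadratic form\<close>

lemma nn_integral_lebesgue_RN_Suc:
  assumes "h \<in> borel_measurable (lebesgue_RN (Suc n))"
  shows "(\<integral>\<^sup>+x. h x \<partial>lebesgue_RN (Suc n)) =
    (\<integral>\<^sup>+x. (\<integral>\<^sup>+y. h (x(Suc n := y)) \<partial>lborel) \<partial>lebesgue_RN n)"
proof -
  interpret product_sigma_finite "\<lambda>_::nat. lborel :: real measure" by standard
  have eq: "{1..Suc n} = insert (Suc n) {1..n}" by auto
  show ?thesis
    using assms unfolding eq by (intro product_nn_integral_insert) auto
qed

text \<open>Change of variables for an affine, lower triangular map with constant diagonal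
  \<open>c\<close>. The last image coordinate is affine in the last variable with slope
  \<open>c\<close>, so Tonelli and the one-dimensional rule give one factor
  \<open>\<bar>c\<bar>\<close> per dimension. Three cases serve below: shears with
  \<open>c = 1\<close>, the reflection \<open>c = -1\<close>, and dilations with a shift.\<close>

lemma nn_integral_triangular:
  fixes h :: "(nat \<Rightarrow> real) \<Rightarrow> ennreal" and c :: real and b :: "nat \<Rightarrow> real" and L :: "nat \<Rightarrow> nat \<Rightarrow> real"
  assumes "h \<in> borel_measurable (lebesgue_RN n)" "c \<noteq> 0"
  shows "ennreal (\<bar>c\<bar> ^ n) *
      (\<integral>\<^sup>+x. h (\<lambda>i\<in>{1..n}. b i + c * x i + (\<Sum>j\<in>{1..<i}. L i j * x j)) \<partial>lebesgue_RN n)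
    = (\<integral>\<^sup>+x. h x \<partial>lebesgue_RN n)"
  using assms(1)
proof (induction n arbitrary: h)
  case 0
  \<comment> \<open>The product over the empty index set has the single point
    \<open>\<lambda>_. undefined\<close>.\<close>
  have "(\<lambda>i\<in>{1..0::nat}. b i + c * x i + (\<Sum>j\<in>{1..<i}. L i j * x j)) = (\<lambda>i. undefined)" for x
    by (auto simp: restrict_def)
  then show ?case by (simp add: PiM_empty nn_integral_count_space_finite)
next
  case (Suc n)
  define T where "T = (\<lambda>n x. \<lambda>i\<in>{1..n::nat}. b i + c * x i + (\<Sum>j\<in>{1..<i}. L i j * x j))"
  define \<beta> where "\<beta> = (\<lambda>x::nat\<Rightarrow>real. b (Suc n) + (\<Sum>j\<in>{1..<Suc n}. L (Suc n) j * x j))"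
  have upd: "(\<lambda>(x, y). x(Suc n := y)) \<in> measurable (lebesgue_RN n \<Otimes>\<^sub>M lborel) (lebesgue_RN (Suc n))"
  proof -
    have "{1..Suc n} = insert (Suc n) {1..n}" by auto
    then show ?thesis using measurable_add_dim[of "Suc n" "{1..n}" "\<lambda>_. lborel :: real measure"] by simp
  qed
  have Tm: "T m \<in> measurable (lebesgue_RN m) (lebesgue_RN m)" for m
    unfolding T_def by (rule measurable_restrict) measurable
  have hm2: "(\<lambda>(x, y). h (x(Suc n := y))) \<in> borel_measurable (lebesgue_RN n \<Otimes>\<^sub>M lborel)"
    using measurable_compose[OF upd Suc.prems] by (simp add: case_prod_unfold del: fun_upd_apply)
  have m1: "(\<lambda>y. h (x(Suc n := y))) \<in> borel_measurable borel" if "x \<in> space (lebesgue_RN n)" for x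
    using measurable_compose[OF measurable_Pair1'[OF that] hm2] by simp
  have hm: "(\<lambda>x. \<integral>\<^sup>+y. h (x(Suc n := y)) \<partial>lborel) \<in> borel_measurable (lebesgue_RN n)"
    by (rule lborel.borel_measurable_nn_integral[OF hm2])
  \<comment> \<open>Triangularity: changing coordinate \<open>Suc n\<close> of the argument changes
    only coordinate \<open>Suc n\<close> of the image.\<close>
  have step: "T (Suc n) (x(Suc n := y)) = (T n x)(Suc n := \<beta> x + c * y)" for x :: "nat \<Rightarrow> real" and y
    unfolding T_def \<beta>_def by (rule ext) (auto simp: restrict_def intro!: sum.cong)
  have inner: "ennreal \<bar>c\<bar> * (\<integral>\<^sup>+y. h (T (Suc n) (x(Suc n := y))) \<partial>lborel)
      = (\<integral>\<^sup>+y. h ((T n x)(Suc n := y)) \<partial>lborel)" if "x \<in> space (lebesgue_RN n)" for x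
    unfolding step using nn_integral_real_affine[OF m1[OF measurable_space[OF Tm that]] assms(2), of "\<beta> x"]
    by (simp del: fun_upd_apply)
  have hT: "(\<lambda>x. h (T (Suc n) x)) \<in> borel_measurable (lebesgue_RN (Suc n))"
    by (rule measurable_compose[OF Tm Suc.prems])
  have "(\<lambda>(x, y). h (T (Suc n) (x(Suc n := y)))) \<in> borel_measurable (lebesgue_RN n \<Otimes>\<^sub>M lborel)"
    using measurable_compose[OF upd hT] by (simp add: case_prod_unfold del: fun_upd_apply)
  then have hT2: "(\<lambda>x. \<integral>\<^sup>+y. h (T (Suc n) (x(Suc n := y))) \<partial>lborel) \<in> borel_measurable (lebesgue_RN n)"
    by (rule lborel.borel_measurable_nn_integral)
  have "ennreal (\<bar>c\<bar> ^ Suc n) * (\<integral>\<^sup>+x. h (T (Suc n) x) \<partial>lebesgue_RN (Suc n))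
      = ennreal (\<bar>c\<bar> ^ n) * (ennreal \<bar>c\<bar> * (\<integral>\<^sup>+x. (\<integral>\<^sup>+y. h (T (Suc n) (x(Suc n := y))) \<partial>lborel) \<partial>lebesgue_RN n))"
    unfolding nn_integral_lebesgue_RN_Suc[OF hT] by (simp add: ennreal_mult mult_ac)
  also have "\<dots> = ennreal (\<bar>c\<bar> ^ n) * (\<integral>\<^sup>+x. ennreal \<bar>c\<bar> * (\<integral>\<^sup>+y. h (T (Suc n) (x(Suc n := y))) \<partial>lborel) \<partial>lebesgue_RN n)"
    using nn_integral_cmult[OF hT2] by simp
  also have "\<dots> = ennreal (\<bar>c\<bar> ^ n) * (\<integral>\<^sup>+x. (\<integral>\<^sup>+y. h ((T n x)(Suc n := y)) \<partial>lborel) \<partial>lebesgue_RN n)"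
    by (intro arg_cong[where f="(*) (ennreal (\<bar>c\<bar> ^ n))"] nn_integral_cong inner)
  also have "\<dots> = (\<integral>\<^sup>+x. (\<integral>\<^sup>+y. h (x(Suc n := y)) \<partial>lborel) \<partial>lebesgue_RN n)"
    using Suc.IH[OF hm] unfolding T_def .
  also have "\<dots> = (\<integral>\<^sup>+x. h x \<partial>lebesgue_RN (Suc n))"
    by (rule nn_integral_lebesgue_RN_Suc[symmetric]) (rule Suc.prems)
  finally show ?case unfolding T_def .
qed

section \<open>One-dimensional integrals and products of them\<close>

lemma nn_integral_exp_gauss:
  assumes "(0::real) < d"
  shows "(\<integral>\<^sup>+t. ennreal (exp (- (d * t\<^sup>2))) \<partial>lborel) = ennreal (sqrt (pi / d))"
proof -
  let ?\<sigma> = "sqrt (1 / (2 * d))"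
  have s: "0 < ?\<sigma>" "?\<sigma>\<^sup>2 = 1 / (2 * d)" using assms by auto
  interpret prob_space "density lborel (normal_density 0 ?\<sigma>)"
    by (rule prob_space_normal_density) fact
  have e: "exp (- (d * t\<^sup>2)) = sqrt (pi / d) * normal_density 0 ?\<sigma> t" for t
    using assms by (simp add: normal_density_def s(2) del: real_sqrt_divide real_sqrt_mult)
  have "(\<integral>\<^sup>+t. ennreal (normal_density 0 ?\<sigma> t) \<partial>lborel) = 1"
    using emeasure_space_1 by (simp add: emeasure_density)
  then show ?thesis
    unfolding e using assms by (simp add: ennreal_mult nn_integral_cmult)
qed

lemma nn_integral_exp_abs:
  assumes "(0::real) < d"
  shows "(\<integral>\<^sup>+t. ennreal (exp (- (d * \<bar>t\<bar>))) \<partial>lborel) = ennreal (2 / d)"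
proof -
  have half: "(\<integral>\<^sup>+t. ennreal (exp (- (d * t))) * indicator {0..} t \<partial>lborel) = ennreal (1 / d)"
  proof -
    have lim: "((\<lambda>t. - (1 / d) * exp (- (d * t))) \<longlongrightarrow> 0) at_top"
      using assms by real_asymp
    have "(\<integral>\<^sup>+t. ennreal (exp (- (d * t))) * indicator {0..} t \<partial>lborel)
        = ennreal (0 - (- (1 / d) * exp (- (d * 0))))"
      by (rule nn_integral_FTC_atLeast[OF _ _ _ lim]) (use assms in \<open>auto intro!: derivative_eq_intros\<close>)
    then show ?thesis by simp
  qed
  have neg: "(\<integral>\<^sup>+t. ennreal (exp (- (d * \<bar>t\<bar>))) * indicator {..<0} t \<partial>lborel) = 
     (\<integral>\<^sup>+t. ennreal (exp (- (d * t))) * indicator {0..} t \<partial>lborel)"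
  proof -
    have "(\<integral>\<^sup>+t. ennreal (exp (- (d * \<bar>t\<bar>))) * indicator {..<0} t \<partial>lborel)
       = ennreal \<bar>-1\<bar> * (\<integral>\<^sup>+t. ennreal (exp (- (d * \<bar>0 + (-1) * t\<bar>))) * indicator {..<0} (0 + (-1) * t) \<partial>lborel)"
      by (rule nn_integral_real_affine) auto
    \<comment> \<open>The reflected half line is open at 0; the missing point is a null set.\<close>
    also have "\<dots> = (\<integral>\<^sup>+t. ennreal (exp (- (d * t))) * indicator {0..} t \<partial>lborel)"
      using AE_lborel_singleton[of "0::real"]
      by (auto intro!: nn_integral_cong_AE simp: indicator_def elim!: eventually_mono)
    finally show ?thesis .
  qed
  have "(\<integral>\<^sup>+t. ennreal (exp (- (d * \<bar>t\<bar>))) \<partial>lborel) =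
     (\<integral>\<^sup>+t. ennreal (exp (- (d * \<bar>t\<bar>))) * indicator {..<0} t + ennreal (exp (- (d * t))) * indicator {0..} t \<partial>lborel)"
    by (auto intro!: nn_integral_cong simp: indicator_def)
  also have "\<dots> = ennreal (1 / d) + ennreal (1 / d)"
    by (subst nn_integral_add) (simp_all add: neg half)
  also have "\<dots> = ennreal (2 / d)"
    using assms by (simp flip: ennreal_plus)
  finally show ?thesis .
qed

lemma nn_integral_lebesgue_RN_prod:
  assumes "\<And>i. f i \<in> borel_measurable borel"
  shows "(\<integral>\<^sup>+x. (\<Prod>i\<in>{1..n}. f i (x i)) \<partial>lebesgue_RN n) = (\<Prod>i\<in>{1..n}. \<integral>\<^sup>+t. f i t \<partial>lborel)"
proof -
  interpret product_sigma_finite "\<lambda>_::nat. lborel :: real measure" by standard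
  show ?thesis
    by (rule product_nn_integral_prod) (use assms in auto)
qed

section \<open>Positive definite forms: diagonalization, determinants and integrals\<close>

definition qform :: "nat \<Rightarrow> (nat \<Rightarrow> nat \<Rightarrow> real) \<Rightarrow> (nat \<Rightarrow> real) \<Rightarrow> real" where
  "qform n M x = (\<Sum>i\<in>{1..n}. \<Sum>j\<in>{1..n}. M i j * x i * x j)"

definition pos_def_form :: "nat \<Rightarrow> (nat \<Rightarrow> nat \<Rightarrow> real) \<Rightarrow> bool" where
  "pos_def_form n M \<longleftrightarrow>
     (\<forall>i\<in>{1..n}. \<forall>j\<in>{1..n}. M i j = M j i) \<and> (\<forall>x. (\<exists>i\<in>{1..n}. x i \<noteq> 0) \<longrightarrow> qform n M x > 0)"

text \<open>Matrix entries are counted from 0 and the coordinates of the form from 1, hence the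
  \<open>Suc\<close>.\<close>

abbreviation form_mat :: "nat \<Rightarrow> (nat \<Rightarrow> nat \<Rightarrow> real) \<Rightarrow> real mat" where
  "form_mat n M \<equiv> mat n n (\<lambda>(i, j). M (Suc i) (Suc j))"

lemma qform_Suc:
  assumes "\<And>i. i \<in> {1..n} \<Longrightarrow> M i (Suc n) = M (Suc n) i"
  shows "qform (Suc n) M x =
    qform n M x + 2 * x (Suc n) * (\<Sum>j\<in>{1..n}. M (Suc n) j * x j) + M (Suc n) (Suc n) * (x (Suc n))\<^sup>2"
proof -
  have "(\<Sum>i\<in>{1..n}. M i (Suc n) * x i * x (Suc n)) = x (Suc n) * (\<Sum>j\<in>{1..n}. M (Suc n) j * x j)"
    unfolding sum_distrib_left using assms by (intro sum.cong) auto
  moreover have "(\<Sum>j\<in>{1..n}. M (Suc n) j * x (Suc n) * x j) = x (Suc n) * (\<Sum>j\<in>{1..n}. M (Suc n) j * x j)"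
    unfolding sum_distrib_left by (intro sum.cong) auto
  ultimately show ?thesis
    unfolding qform_def by (simp add: sum.distrib power2_eq_square algebra_simps)
qed

text \<open>This is \<open>M = L^T D L\<close>. Eliminating the last variable first, by its Schur
  complement, makes row \<open>l\<close> of \<open>L\<close> involve only coordinates up to
  \<open>l\<close>, which is the shape that \<open>nn_integral_triangular\<close> handles.\<close>

lemma pos_def_form_LDL:
  assumes "pos_def_form n M"
  shows "\<exists>d L. (\<forall>i\<in>{1..n}. d i > 0) \<and> (\<forall>i. L i i = 1) \<and> (\<forall>i j. i < j \<longrightarrow> L i j = 0) \<and>
    (\<forall>i\<in>{1..n}. \<forall>j\<in>{1..n}. M i j = (\<Sum>l\<in>{1..n}. d l * L l i * L l j))"
  using assms
proof (induction n arbitrary: M)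
  case 0
  show ?case by (rule exI[of _ "\<lambda>_. 1"], rule exI[of _ "\<lambda>i j. if i = j then 1 else 0"]) auto
next
  case (Suc n)
  define p where "p = M (Suc n) (Suc n)"
  define M' where "M' = (\<lambda>i j. M i j - M (Suc n) i * M (Suc n) j / p)"
  have sym: "M i j = M j i" if "i \<in> {1..Suc n}" "j \<in> {1..Suc n}" for i j
    using Suc.prems that unfolding pos_def_form_def by blast
  have pos: "qform (Suc n) M x > 0" if "\<exists>i\<in>{1..Suc n}. x i \<noteq> 0" for x
    using Suc.prems that unfolding pos_def_form_def by blast
  have qS: "qform (Suc n) M x = qform n M x + 2 * x (Suc n) * (\<Sum>j\<in>{1..n}. M (Suc n) j * x j) + p * (x (Suc n))\<^sup>2" for x
    unfolding p_def by (rule qform_Suc) (use sym in auto)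
  \<comment> \<open>The value on the last unit vector is the pivot \<open>p\<close>, which is
    therefore positive.\<close>
  have "qform (Suc n) M (\<lambda>i. if i = Suc n then 1 else 0) > 0"
    by (rule pos) auto
  moreover have "qform n M (\<lambda>i. if i = Suc n then 1 else 0) = 0"
    unfolding qform_def by (intro sum.neutral ballI) auto
  ultimately have p: "p > 0"
    unfolding qS by simp
  have "pos_def_form n M'"
    unfolding pos_def_form_def
  proof (intro conjI ballI allI impI)
    fix i j assume "i \<in> {1..n}" "j \<in> {1..n}"
    then show "M' i j = M' j i" unfolding M'_def using sym[of i j] by simp
  next
    fix x :: "nat \<Rightarrow> real" assume x: "\<exists>i\<in>{1..n}. x i \<noteq> 0"
    define s where "s = (\<Sum>j\<in>{1..n}. M (Suc n) j * x j)"
    \<comment> \<open>The last coordinate that minimizes the form for given \<open>x\<close>; the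
      minimum is the value of the Schur complement \<open>M'\<close> at \<open>x\<close>.\<close>
    define y where "y = x(Suc n := - s / p)"
    have s': "(\<Sum>j\<in>{1..n}. M (Suc n) j * y j) = s"
      unfolding s_def y_def by (intro sum.cong) auto
    have q': "qform n M y = qform n M x"
      unfolding qform_def y_def by (intro sum.cong) auto
    have "qform n M' x = qform n M x - (\<Sum>i\<in>{1..n}. \<Sum>j\<in>{1..n}. (M (Suc n) i * x i) * (M (Suc n) j * x j) / p)"
      unfolding qform_def M'_def
      by (simp add: sum_subtractf[symmetric] algebra_simps)
    also have "(\<Sum>i\<in>{1..n}. \<Sum>j\<in>{1..n}. (M (Suc n) i * x i) * (M (Suc n) j * x j) / p) = s * s / p"
      unfolding s_def by (simp add: sum_product sum_divide_distrib)
    also have "qform n M x - s * s / p = qform (Suc n) M y"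
      unfolding qS s' q' using p by (simp add: y_def power2_eq_square field_simps)
    also have "\<dots> > 0"
    proof (rule pos)
      from x obtain i where "i \<in> {1..n}" "x i \<noteq> 0" by blast
      then show "\<exists>i\<in>{1..Suc n}. y i \<noteq> 0" by (intro bexI[of _ i]) (auto simp: y_def)
    qed
    finally show "qform n M' x > 0" .
  qed
  from Suc.IH[OF this] obtain d L where *: "\<forall>i\<in>{1..n}. d i > 0" "\<forall>i. L i i = 1" "\<forall>i j. i < j \<longrightarrow> L i j = 0"
    "\<forall>i\<in>{1..n}. \<forall>j\<in>{1..n}. M' i j = (\<Sum>l\<in>{1..n}. d l * L l i * L l j)"
    by (elim exE conjE)
  then have dL: "\<And>i. i \<in> {1..n} \<Longrightarrow> d i > 0" "\<And>i. L i i = 1" "\<And>i j. i < j \<Longrightarrow> L i j = 0"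
    "\<And>i j. i \<in> {1..n} \<Longrightarrow> j \<in> {1..n} \<Longrightarrow> M' i j = (\<Sum>l\<in>{1..n}. d l * L l i * L l j)"
    by blast+
  define d' where "d' = d(Suc n := p)"
  define L' where "L' = (\<lambda>l i. if l = Suc n then (if i = Suc n then 1 else if i > Suc n then 0 else M (Suc n) i / p) else L l i)"
  have "M i j = (\<Sum>l\<in>{1..Suc n}. d' l * L' l i * L' l j)" if ij: "i \<in> {1..Suc n}" "j \<in> {1..Suc n}" for i j
  proof -
    have eq: "(\<Sum>l\<in>{1..Suc n}. d' l * L' l i * L' l j) = (\<Sum>l\<in>{1..n}. d l * L l i * L l j) + p * L' (Suc n) i * L' (Suc n) j"
    proof -
      have "(\<Sum>l\<in>{1..n}. d' l * L' l i * L' l j) = (\<Sum>l\<in>{1..n}. d l * L l i * L l j)"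
        by (intro sum.cong) (auto simp: d'_def L'_def)
      then show ?thesis by (simp add: d'_def)
    qed
    \<comment> \<open>The rows up to \<open>n\<close> vanish in column \<open>Suc n\<close>, so in
      the last row and column of \<open>M\<close> only the pivot term survives.\<close>
    have last: "(\<Sum>l\<in>{1..n}. d l * L l i * L l j) = 0" if "i = Suc n \<or> j = Suc n"
      by (intro sum.neutral ballI) (use that dL(3) in auto)
    consider "i \<in> {1..n}" "j \<in> {1..n}" | "i = Suc n" | "j = Suc n" using ij by force
    then show ?thesis
    proof cases
      case 1
      then show ?thesis unfolding eq using dL(4)[of i j] p by (auto simp: M'_def L'_def)
    next
      case 2
      then show ?thesis unfolding eq using last p ij by (auto simp: L'_def p_def)
    next
      case 3
      then show ?thesis unfolding eq using last p ij sym[of i j] by (auto simp: L'_def p_def)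
    qed
  qed
  moreover have "\<forall>i\<in>{1..Suc n}. d' i > 0" using dL(1) p by (auto simp: d'_def)
  moreover have "\<forall>i. L' i i = 1" "\<forall>i j. i < j \<longrightarrow> L' i j = 0" using dL(2,3) by (auto simp: L'_def)
  ultimately show ?case by blast
qed

text \<open>Completing squares turns the form into \<open>\<Sum> d\<^sub>i \<xi>\<^sub>i\<^sup>2\<close> with \<open>\<xi>\<close> unit lower triangular in \<open>x\<close>.\<close>

lemma nn_integral_qform:
  assumes "pos_def_form n M"
  obtains d where "\<And>i. i \<in> {1..n} \<Longrightarrow> d i > 0" "Determinant.det (form_mat n M) = (\<Prod>i\<in>{1..n}. d i)"
    "\<And>f. f \<in> borel_measurable borel \<Longrightarrow> (\<integral>\<^sup>+x. f (qform n M x) \<partial>lebesgue_RN n)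
      = (\<integral>\<^sup>+x. f (\<Sum>i\<in>{1..n}. d i * (x i)\<^sup>2) \<partial>lebesgue_RN n)"
proof -
  from pos_def_form_LDL[OF assms] obtain d L where *: "\<forall>i\<in>{1..n}. d i > 0" "\<forall>i. L i i = 1" "\<forall>i j. i < j \<longrightarrow> L i j = 0"
    "\<forall>i\<in>{1..n}. \<forall>j\<in>{1..n}. M i j = (\<Sum>l\<in>{1..n}. d l * L l i * L l j)"
    by (elim exE conjE)
  then have dL: "\<And>i. i \<in> {1..n} \<Longrightarrow> d i > 0" "\<And>i. L i i = 1" "\<And>i j. i < j \<Longrightarrow> L i j = 0"
    "\<And>i j. i \<in> {1..n} \<Longrightarrow> j \<in> {1..n} \<Longrightarrow> M i j = (\<Sum>l\<in>{1..n}. d l * L l i * L l j)"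
    by blast+
  \<comment> \<open>\<open>E\<close> is \<open>L^T D\<close>, upper triangular with diagonal
    \<open>d\<close>; the other factor \<open>L\<close> has determinant 1.\<close>
  define E where "E = mat n n (\<lambda>(i, l). d (Suc l) * L (Suc l) (Suc i))"
  have "form_mat n M = E * form_mat n L"
  proof (rule eq_matI)
    fix i j assume ij: "i < dim_row (E * form_mat n L)" "j < dim_col (E * form_mat n L)"
    then have "form_mat n M $$ (i, j) = (\<Sum>l\<in>{1..n}. d l * L l (Suc i) * L l (Suc j))"
      by (simp add: E_def dL(4))
    also have "{1..n} = Suc ` {0..<n}" by auto
    also have "(\<Sum>l\<in>Suc ` {0..<n}. d l * L l (Suc i) * L l (Suc j)) = (E * form_mat n L) $$ (i, j)"
      using ij by (subst sum.reindex) (auto simp: E_def scalar_prod_def)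
    finally show "form_mat n M $$ (i, j) = (E * form_mat n L) $$ (i, j)" .
  qed (auto simp: E_def)
  then have "Determinant.det (form_mat n M) = Determinant.det E * Determinant.det (form_mat n L)"
    by (simp add: Determinant.det_mult[of _ n] E_def)
  also have "Determinant.det E = prod_list (diag_mat E)"
    by (rule det_upper_triangular) (use dL(3) in \<open>auto simp: E_def\<close>)
  also have "\<dots> = (\<Prod>i\<in>{0..<n}. d (Suc i))"
    by (simp add: prod_list_diag_prod E_def dL(2))
  also have "Determinant.det (form_mat n L) = prod_list (diag_mat (form_mat n L))"
    by (rule det_lower_triangular[of n]) (use dL(3) in auto)
  also have "\<dots> = 1"
    by (simp add: prod_list_diag_prod dL(2))
  also have "(\<Prod>i\<in>{0..<n}. d (Suc i)) * 1 = (\<Prod>i\<in>{1..n}. d i)"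
    by (simp add: prod.shift_bounds_Suc_ivl[symmetric] atLeastLessThanSuc_atLeastAtMost)
  finally have det: "Determinant.det (form_mat n M) = (\<Prod>i\<in>{1..n}. d i)" .
  have q: "qform n M x = (\<Sum>l\<in>{1..n}. d l * ((\<lambda>i\<in>{1..n}. 0 + 1 * x i + (\<Sum>j\<in>{1..<i}. L i j * x j)) l)\<^sup>2)" for x
  proof -
    have lin: "0 + 1 * x l + (\<Sum>j\<in>{1..<l}. L l j * x j) = (\<Sum>j\<in>{1..n}. L l j * x j)" if "l \<in> {1..n}" for l
    proof -
      have "(\<Sum>j\<in>{1..n}. L l j * x j) = (\<Sum>j\<in>{1..l}. L l j * x j)"
        by (rule sum.mono_neutral_right) (use that dL(3) in auto)
      also have "{1..l} = insert l {1..<l}" using that by auto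
      finally show ?thesis by (simp add: dL(2))
    qed
    have "qform n M x = (\<Sum>i\<in>{1..n}. \<Sum>j\<in>{1..n}. \<Sum>l\<in>{1..n}. d l * ((L l i * x i) * (L l j * x j)))"
      unfolding qform_def by (intro sum.cong) (auto simp: dL(4) sum_distrib_left sum_distrib_right algebra_simps)
    also have "\<dots> = (\<Sum>i\<in>{1..n}. \<Sum>l\<in>{1..n}. \<Sum>j\<in>{1..n}. d l * ((L l i * x i) * (L l j * x j)))"
      by (rule sum.cong[OF refl], rule sum.swap)
    also have "\<dots> = (\<Sum>l\<in>{1..n}. \<Sum>i\<in>{1..n}. \<Sum>j\<in>{1..n}. d l * ((L l i * x i) * (L l j * x j)))"
      by (rule sum.swap)
    also have "\<dots> = (\<Sum>l\<in>{1..n}. d l * (\<Sum>j\<in>{1..n}. L l j * x j)\<^sup>2)"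
      unfolding power2_eq_square sum_product by (simp add: sum_distrib_left)
    also have "\<dots> = (\<Sum>l\<in>{1..n}. d l * ((\<lambda>i\<in>{1..n}. 0 + 1 * x i + (\<Sum>j\<in>{1..<i}. L i j * x j)) l)\<^sup>2)"
      by (intro sum.cong refl) (simp only: restrict_apply' lin)
    finally show ?thesis .
  qed
  show ?thesis
  proof (rule that[OF dL(1) det])
    fix f :: "real \<Rightarrow> ennreal" assume [measurable]: "f \<in> borel_measurable borel"
    have "(\<lambda>x. f (\<Sum>i\<in>{1..n}. d i * (x i)\<^sup>2)) \<in> borel_measurable (lebesgue_RN n)"
      by measurable
    from nn_integral_triangular[OF this, of 1 "\<lambda>_. 0" L]
    show "(\<integral>\<^sup>+x. f (qform n M x) \<partial>lebesgue_RN n) = (\<integral>\<^sup>+x. f (\<Sum>i\<in>{1..n}. d i * (x i)\<^sup>2) \<partial>lebesgue_RN n)"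
      unfolding q by simp
  qed
qed

lemma nn_integral_qform_gauss:
  assumes "pos_def_form n M" "k > 0"
  shows "(\<integral>\<^sup>+x. ennreal (exp (- (k * qform n M x))) \<partial>lebesgue_RN n)
    = ennreal (sqrt (pi / k) ^ n / sqrt (Determinant.det (form_mat n M)))"
proof -
  obtain d where d: "\<And>i. i \<in> {1..n} \<Longrightarrow> d i > 0" "Determinant.det (form_mat n M) = (\<Prod>i\<in>{1..n}. d i)"
    "\<And>f. f \<in> borel_measurable borel \<Longrightarrow> (\<integral>\<^sup>+x. f (qform n M x) \<partial>lebesgue_RN n)
      = (\<integral>\<^sup>+x. f (\<Sum>i\<in>{1..n}. d i * (x i)\<^sup>2) \<partial>lebesgue_RN n)"
    by (rule nn_integral_qform[OF assms(1)], rule that)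
  have "(\<integral>\<^sup>+x. ennreal (exp (- (k * qform n M x))) \<partial>lebesgue_RN n)
     = (\<integral>\<^sup>+x. ennreal (exp (- (k * (\<Sum>i\<in>{1..n}. d i * (x i)\<^sup>2)))) \<partial>lebesgue_RN n)"
    by (rule d(3)) measurable
  also have "\<dots> = (\<integral>\<^sup>+x. (\<Prod>i\<in>{1..n}. ennreal (exp (- ((k * d i) * (x i)\<^sup>2)))) \<partial>lebesgue_RN n)"
    by (simp add: prod_ennreal exp_sum[symmetric] sum_distrib_left sum_negf mult.assoc)
  also have "\<dots> = (\<Prod>i\<in>{1..n}. \<integral>\<^sup>+t. ennreal (exp (- ((k * d i) * t\<^sup>2))) \<partial>lborel)"
    by (rule nn_integral_lebesgue_RN_prod) measurable
  also have "\<dots> = (\<Prod>i\<in>{1..n}. ennreal (sqrt (pi / (k * d i))))"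
    by (intro prod.cong refl nn_integral_exp_gauss) (use d(1) assms(2) in auto)
  also have "\<dots> = ennreal (\<Prod>i\<in>{1..n}. sqrt (pi / (k * d i)))"
    using d(1) assms(2) by (intro prod_ennreal) (auto intro!: less_imp_le simp: field_simps)
  also have "(\<Prod>i\<in>{1..n}. sqrt (pi / (k * d i))) = sqrt (pi / k) ^ n / sqrt (\<Prod>i\<in>{1..n}. d i)"
  proof -
    have "(\<Prod>i\<in>{1..n}. sqrt (pi / (k * d i))) = (\<Prod>i\<in>{1..n}. sqrt (pi / k) / sqrt (d i))"
      by (intro prod.cong refl) (simp add: real_sqrt_divide real_sqrt_mult)
    moreover have "sqrt (\<Prod>i\<in>{1..n}. d i) = (\<Prod>i\<in>{1..n}. sqrt (d i))"
      by (induction n) (auto simp: real_sqrt_mult)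
    ultimately show ?thesis by (simp add: prod_dividef)
  qed
  finally show ?thesis unfolding d(2) .
qed

text \<open>Cauchy-Schwarz bounds the root of the diagonalized form below by a weighted sum of the
  \<open>\<bar>x i\<bar>\<close>, and the exponential then factorizes. The loss is acceptable: this
  integral is used only with an exponentially small prefactor, away from the equilibrium.\<close>

lemma nn_integral_qform_exp_sqrt_le:
  assumes "pos_def_form n M" "c > 0" "n > 0"
  shows "(\<integral>\<^sup>+x. ennreal (exp (- (c * sqrt (qform n M x)))) \<partial>lebesgue_RN n)
    \<le> ennreal ((2 * sqrt n / c) ^ n / sqrt (Determinant.det (form_mat n M)))"
proof -
  obtain d where d: "\<And>i. i \<in> {1..n} \<Longrightarrow> d i > 0" "Determinant.det (form_mat n M) = (\<Prod>i\<in>{1..n}. d i)"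
    "\<And>f. f \<in> borel_measurable borel \<Longrightarrow> (\<integral>\<^sup>+x. f (qform n M x) \<partial>lebesgue_RN n)
      = (\<integral>\<^sup>+x. f (\<Sum>i\<in>{1..n}. d i * (x i)\<^sup>2) \<partial>lebesgue_RN n)"
    by (rule nn_integral_qform[OF assms(1)], rule that)
  have cs: "(\<Sum>i\<in>{1..n}. sqrt (d i) * \<bar>x i\<bar>) / sqrt n \<le> sqrt (\<Sum>i\<in>{1..n}. d i * (x i)\<^sup>2)" for x :: "nat \<Rightarrow> real"
  proof -
    have "(\<Sum>i\<in>{1..n}. \<bar>1\<bar> * \<bar>sqrt (d i) * \<bar>x i\<bar>\<bar>) \<le> L2_set (\<lambda>_. 1) {1..n} * L2_set (\<lambda>i. sqrt (d i) * \<bar>x i\<bar>) {1..n}"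
      by (rule L2_set_mult_ineq)
    moreover have "(\<Sum>i\<in>{1..n}. \<bar>1\<bar> * \<bar>sqrt (d i) * \<bar>x i\<bar>\<bar>) = (\<Sum>i\<in>{1..n}. sqrt (d i) * \<bar>x i\<bar>)"
      using d(1) by (intro sum.cong) (auto simp: abs_mult less_imp_le)
    moreover have "L2_set (\<lambda>i. sqrt (d i) * \<bar>x i\<bar>) {1..n} = sqrt (\<Sum>i\<in>{1..n}. d i * (x i)\<^sup>2)"
      unfolding L2_set_def using d(1)
      by (intro arg_cong[where f=sqrt] sum.cong) (auto simp: power_mult_distrib less_imp_le)
    ultimately show ?thesis
      using assms(3) by (simp add: L2_set_def divide_le_eq mult.commute)
  qed
  have "(\<integral>\<^sup>+x. ennreal (exp (- (c * sqrt (qform n M x)))) \<partial>lebesgue_RN n)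
     = (\<integral>\<^sup>+x. ennreal (exp (- (c * sqrt (\<Sum>i\<in>{1..n}. d i * (x i)\<^sup>2)))) \<partial>lebesgue_RN n)"
    by (rule d(3)) measurable
  also have "\<dots> \<le> (\<integral>\<^sup>+x. (\<Prod>i\<in>{1..n}. ennreal (exp (- ((c * sqrt (d i) / sqrt n) * \<bar>x i\<bar>)))) \<partial>lebesgue_RN n)"
  proof (intro nn_integral_mono)
    fix x :: "nat \<Rightarrow> real"
    have "(\<Prod>i\<in>{1..n}. ennreal (exp (- ((c * sqrt (d i) / sqrt n) * \<bar>x i\<bar>)))) =
      ennreal (exp (- (c * ((\<Sum>i\<in>{1..n}. sqrt (d i) * \<bar>x i\<bar>) / sqrt n))))"
      by (simp add: prod_ennreal exp_sum[symmetric] sum_distrib_left sum_negf sum_divide_distrib mult.assoc)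
    moreover have "c * ((\<Sum>i\<in>{1..n}. sqrt (d i) * \<bar>x i\<bar>) / sqrt n) \<le> c * sqrt (\<Sum>i\<in>{1..n}. d i * (x i)\<^sup>2)"
      using cs assms(2) by (intro mult_left_mono) auto
    ultimately show "ennreal (exp (- (c * sqrt (\<Sum>i\<in>{1..n}. d i * (x i)\<^sup>2))))
       \<le> (\<Prod>i\<in>{1..n}. ennreal (exp (- ((c * sqrt (d i) / sqrt n) * \<bar>x i\<bar>))))"
      by (simp add: ennreal_leI)
  qed
  also have "\<dots> = (\<Prod>i\<in>{1..n}. \<integral>\<^sup>+t. ennreal (exp (- ((c * sqrt (d i) / sqrt n) * \<bar>t\<bar>))) \<partial>lborel)"
    by (rule nn_integral_lebesgue_RN_prod) measurable
  also have "\<dots> = (\<Prod>i\<in>{1..n}. ennreal (2 / (c * sqrt (d i) / sqrt n)))"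
    by (intro prod.cong refl nn_integral_exp_abs) (use d(1) assms(2,3) in auto)
  also have "\<dots> = ennreal (\<Prod>i\<in>{1..n}. 2 / (c * sqrt (d i) / sqrt n))"
    using d(1) assms(2) by (intro prod_ennreal) (auto intro!: less_imp_le simp: field_simps)
  also have "(\<Prod>i\<in>{1..n}. 2 / (c * sqrt (d i) / sqrt n)) = (2 * sqrt n / c) ^ n / sqrt (\<Prod>i\<in>{1..n}. d i)"
  proof -
    have "(\<Prod>i\<in>{1..n}. 2 / (c * sqrt (d i) / sqrt n)) = (\<Prod>i\<in>{1..n}. (2 * sqrt n / c) / sqrt (d i))"
      by (intro prod.cong refl) simp
    moreover have "sqrt (\<Prod>i\<in>{1..n}. d i) = (\<Prod>i\<in>{1..n}. sqrt (d i))"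
      by (induction n) (auto simp: real_sqrt_mult)
    moreover have "(\<Prod>i\<in>{1..n}. a / sqrt (d i)) = a ^ n / (\<Prod>i\<in>{1..n}. sqrt (d i))" for a
      by (simp add: prod_dividef)
    ultimately show ?thesis by metis
  qed
  finally show ?thesis unfolding d(2) .
qed

section \<open>The Hessian of the logarithmic gas at its equilibrium\<close>

lemma sum_symmetric_off_diag:
  fixes g :: "nat \<Rightarrow> nat \<Rightarrow> real"
  assumes "\<And>i j. g i j = g j i" "\<And>i. g i i = 0"
  shows "(\<Sum>i\<in>{1..n}. \<Sum>j\<in>{1..n}. g i j) = 2 * (\<Sum>j\<in>{1..n}. \<Sum>i\<in>{1..<j}. g i j)"
proof (induction n)
  case (Suc n)
  have "(\<Sum>i\<in>{1..Suc n}. \<Sum>j\<in>{1..Suc n}. g i j)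
      = (\<Sum>i\<in>{1..n}. \<Sum>j\<in>{1..n}. g i j) + 2 * (\<Sum>i\<in>{1..n}. g i (Suc n))"
    using assms(1)[of "Suc n"] assms(2) by (simp add: sum.distrib)
  moreover have "{1..<Suc n} = {1..n}" by auto
  ultimately show ?case using Suc by (simp add: algebra_simps)
qed simp

text \<open>\<open>1 + pair_ratio z y i j\<close> is the factor by which the gap
  \<open>z i - z j\<close> changes under the displacement \<open>y\<close>. On the diagonal the
  value is \<open>0 / 0 = 0\<close>.\<close>

definition pair_ratio :: "(nat \<Rightarrow> real) \<Rightarrow> (nat \<Rightarrow> real) \<Rightarrow> nat \<Rightarrow> nat \<Rightarrow> real" where
  "pair_ratio z y i j = (y i - y j) / (z i - z j)"

text \<open>Twice the quadratic Taylor term of \<open>log_gas_potential\<close> at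
  \<open>y = 0\<close>.\<close>

definition pair_energy :: "nat \<Rightarrow> (nat \<Rightarrow> real) \<Rightarrow> (nat \<Rightarrow> real) \<Rightarrow> real" where
  "pair_energy N z y = (\<Sum>j\<in>{1..N}. \<Sum>i\<in>{1..<j}. (pair_ratio z y i j)\<^sup>2)"

text \<open>The diagonal terms \<open>1 / (z i - z i)\<^sup>2\<close> vanish because \<open>1 / 0 = 0\<close>.\<close>

definition energy_matrix :: "nat \<Rightarrow> (nat \<Rightarrow> real) \<Rightarrow> nat \<Rightarrow> nat \<Rightarrow> real" where
  "energy_matrix N z i j = (if i = j then \<Sum>l\<in>{1..N}. 1 / (z i - z l)\<^sup>2 else 0) - 1 / (z i - z j)\<^sup>2"

text \<open>Two parameters, because the exponential tilt changes the coefficient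
  \<open>\<eta>\<close> of the squared norm, while the Taylor bounds change the coefficient
  \<open>a\<close> of the pair energy.\<close>

definition energy_form :: "nat \<Rightarrow> (nat \<Rightarrow> real) \<Rightarrow> real \<Rightarrow> real \<Rightarrow> nat \<Rightarrow> nat \<Rightarrow> real" where
  "energy_form N z \<eta> a i j = (if i = j then \<eta> else 0) + a * energy_matrix N z i j"

lemma energy_matrix_mult:
  assumes "i \<in> {1..N}"
  shows "(\<Sum>j\<in>{1..N}. energy_matrix N z i j * v j) = (\<Sum>j\<in>{1..N}. (v i - v j) / (z i - z j)\<^sup>2)"
proof -
  have "(\<Sum>j\<in>{1..N}. energy_matrix N z i j * v j)
      = (\<Sum>j\<in>{1..N}. (if i = j then (\<Sum>l\<in>{1..N}. 1 / (z i - z l)\<^sup>2) * v j else 0)) - (\<Sum>j\<in>{1..N}. v j / (z i - z j)\<^sup>2)"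
    unfolding energy_matrix_def sum_subtractf[symmetric]
    by (intro sum.cong refl) (auto simp: algebra_simps)
  also have "\<dots> = (\<Sum>l\<in>{1..N}. 1 / (z i - z l)\<^sup>2) * v i - (\<Sum>j\<in>{1..N}. v j / (z i - z j)\<^sup>2)"
    using assms by (subst sum.delta') auto
  also have "\<dots> = (\<Sum>j\<in>{1..N}. (v i - v j) / (z i - z j)\<^sup>2)"
    unfolding sum_distrib_right sum_subtractf[symmetric] by (intro sum.cong refl) (simp add: diff_divide_distrib)
  finally show ?thesis .
qed

text \<open>The energy matrix is a graph Laplacian with weights
  \<open>1 / (z i - z j)\<^sup>2\<close>. Adding the terms \<open>y i * (y i - y j)\<close> and
  \<open>y j * (y j - y i)\<close> of a pair completes the square.\<close>

lemma qform_energy_form: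
  "qform N (energy_form N z \<eta> a) y = \<eta> * (\<Sum>i\<in>{1..N}. (y i)\<^sup>2) + a * pair_energy N z y"
proof -
  let ?w = "\<lambda>i j. 1 / (z i - z j)\<^sup>2"
  have "qform N (energy_form N z \<eta> a) y
      = (\<Sum>i\<in>{1..N}. \<Sum>j\<in>{1..N}. (if i = j then \<eta> * y i * y j else 0) + a * (y i * (energy_matrix N z i j * y j)))"
    unfolding qform_def energy_form_def by (intro sum.cong refl) (auto simp: algebra_simps)
  also have "\<dots> = (\<Sum>i\<in>{1..N}. \<Sum>j\<in>{1..N}. (if i = j then \<eta> * y i * y j else 0))
      + a * (\<Sum>i\<in>{1..N}. y i * (\<Sum>j\<in>{1..N}. energy_matrix N z i j * y j))"
    by (simp add: sum.distrib sum_distrib_left)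
  also have "(\<Sum>i\<in>{1..N}. \<Sum>j\<in>{1..N}. (if i = j then \<eta> * y i * y j else 0)) = \<eta> * (\<Sum>i\<in>{1..N}. (y i)\<^sup>2)"
    unfolding sum_distrib_left by (intro sum.cong refl) (simp add: power2_eq_square)
  also have "(\<Sum>i\<in>{1..N}. y i * (\<Sum>j\<in>{1..N}. energy_matrix N z i j * y j))
      = (\<Sum>i\<in>{1..N}. \<Sum>j\<in>{1..N}. ?w i j * (y i * (y i - y j)))"
  proof (intro sum.cong refl)
    fix i assume i: "i \<in> {1..N}"
    show "y i * (\<Sum>j\<in>{1..N}. energy_matrix N z i j * y j) = (\<Sum>j\<in>{1..N}. ?w i j * (y i * (y i - y j)))"
      unfolding energy_matrix_mult[OF i] sum_distrib_left by (intro sum.cong refl) simp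
  qed
  also have "\<dots> = pair_energy N z y"
  proof -
    let ?S = "\<Sum>i\<in>{1..N}. \<Sum>j\<in>{1..N}. ?w i j * (y i * (y i - y j))"
    have sw: "?S = (\<Sum>i\<in>{1..N}. \<Sum>j\<in>{1..N}. ?w i j * (y j * (y j - y i)))"
      by (subst sum.swap) (simp add: power2_commute)
    have "2 * ?S = ?S + (\<Sum>i\<in>{1..N}. \<Sum>j\<in>{1..N}. ?w i j * (y j * (y j - y i)))"
      using sw by simp
    also have "\<dots> = (\<Sum>i\<in>{1..N}. \<Sum>j\<in>{1..N}. (pair_ratio z y i j)\<^sup>2)"
      unfolding sum.distrib[symmetric] pair_ratio_def
      by (intro sum.cong refl) (simp add: power_divide add_divide_distrib[symmetric] power2_eq_square algebra_simps)
    also have "\<dots> = 2 * pair_energy N z y"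
      unfolding pair_energy_def
      by (rule sum_symmetric_off_diag) (auto simp: pair_ratio_def power_divide power2_commute)
    finally show ?thesis by simp
  qed
  finally show ?thesis .
qed

lemma pair_energy_nonneg: "pair_energy N z y \<ge> 0"
  unfolding pair_energy_def by (intro sum_nonneg) auto

lemma pos_def_energy_form:
  assumes "\<eta> > 0" "a \<ge> 0"
  shows "pos_def_form N (energy_form N z \<eta> a)"
  unfolding pos_def_form_def
proof (intro conjI ballI allI impI)
  fix i j show "energy_form N z \<eta> a i j = energy_form N z \<eta> a j i"
    by (auto simp: energy_form_def energy_matrix_def power2_commute)
next
  fix x :: "nat \<Rightarrow> real" assume "\<exists>i\<in>{1..N}. x i \<noteq> 0"
  then obtain i where "i \<in> {1..N}" "x i \<noteq> 0" by blast
  then have "(\<Sum>i\<in>{1..N}. (x i)\<^sup>2) > 0"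
    by (intro sum_pos2[of _ i]) auto
  then show "qform N (energy_form N z \<eta> a) x > 0"
    unfolding qform_energy_form using assms pair_energy_nonneg by (intro add_pos_nonneg) auto
qed

text \<open>The term \<open>j = i\<close> is \<open>1 / 0 = 0\<close>.\<close>

definition stieltjes_eq :: "nat \<Rightarrow> (nat \<Rightarrow> real) \<Rightarrow> bool" where
  "stieltjes_eq N z \<longleftrightarrow> (\<forall>i\<in>{1..N}. (\<Sum>j\<in>{1..N}. 1 / (z i - z j)) = z i)"

text \<open>Hence the energy matrix is triangular in the Vandermonde basis, with eigenvalues \<open>0, \<dots>, N - 1\<close>.\<close>

lemma energy_matrix_power:
  assumes st: "stieltjes_eq N z" and inj: "inj_on z {1..N}"
  shows "\<exists>c. \<forall>i\<in>{1..N}. (\<Sum>j\<in>{1..N}. energy_matrix N z i j * z j ^ m) = real m * z i ^ m + (\<Sum>l<m. c l * z i ^ l)"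
proof -
  \<comment> \<open>The power sums \<open>P\<close> arise when the divided differences below are
    summed over all nodes. In \<open>p\<close> the truncated exponents are harmless:
    \<open>q < r < m\<close> forces \<open>q + 2 \<le> m\<close>, and for \<open>m < 2\<close> the
    double sum is empty.\<close>
  define P where "P = (\<lambda>q. \<Sum>j\<in>{1..N}. z j ^ q)"
  define p :: "real poly" where
    "p = (\<Sum>r<m. \<Sum>q<r. monom 1 (m - 2) - monom (P q) (m - 2 - q))"
  have dp: "coeff p l = 0" if "l \<ge> m" for l
    unfolding p_def coeff_sum using that by (intro sum.neutral ballI) auto
  have pp: "poly p x = (\<Sum>l<m. coeff p l * x ^ l)" for x
  proof -
    have "poly p x = (\<Sum>l\<le>degree p. coeff p l * x ^ l)" by (rule poly_altdef)
    also have "\<dots> = (\<Sum>l\<in>{..degree p} \<inter> {..<m}. coeff p l * x ^ l)"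
      by (rule sum.mono_neutral_right) (use dp in \<open>auto simp: not_less\<close>)
    also have "\<dots> = (\<Sum>l<m. coeff p l * x ^ l)"
      by (rule sum.mono_neutral_left) (auto simp: coeff_eq_0)
    finally show ?thesis .
  qed
  have "(\<Sum>j\<in>{1..N}. energy_matrix N z i j * z j ^ m) = real m * z i ^ m + poly p (z i)" if i: "i \<in> {1..N}" for i
  proof -
    define x where "x = z i"
    \<comment> \<open>The divided difference is expanded once more around \<open>x\<close>, which
      isolates the simple pole. At \<open>j = i\<close> both quotients are 0 by convention, so the
      last summand adds back the double sum subtracted there.\<close>
    have summand: "(x ^ m - z j ^ m) / (x - z j)\<^sup>2 = real m * x ^ (m - 1) * (1 / (x - z j))
         - (\<Sum>r<m. \<Sum>q<r. x ^ (m - 2 - q) * z j ^ q) + (if j = i then \<Sum>r<m. \<Sum>q<r. x ^ (m - 2) else 0)"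
      if j: "j \<in> {1..N}" for j
    proof (cases "j = i")
      case True
      have "(\<Sum>r<m. \<Sum>q<r. x ^ (m - 2 - q) * x ^ q) = (\<Sum>r<m. \<Sum>q<r. x ^ (m - 2))"
        by (intro sum.cong refl) (simp flip: power_add)
      then show ?thesis using True by (simp add: x_def)
    next
      case False
      then have ne: "x \<noteq> z j" using inj i j unfolding x_def inj_on_def by blast
      have geo: "y ^ m' - w ^ m' = (y - w) * (\<Sum>r<m'. y ^ (m' - Suc r) * w ^ r)" for y w :: real and m'
      proof -
        have "y ^ m' - w ^ m' = - (w ^ m' - y ^ m')" by simp
        also have "\<dots> = (y - w) * (\<Sum>r<m'. y ^ (m' - Suc r) * w ^ r)"
          by (simp only: power_diff_sumr2 minus_mult_left minus_diff_eq)
        finally show ?thesis .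
      qed
      have "(x ^ m - z j ^ m) / (x - z j)\<^sup>2 = (\<Sum>r<m. x ^ (m - Suc r) * z j ^ r) / (x - z j)"
        unfolding geo using ne by (simp add: power2_eq_square)
      also have "(\<Sum>r<m. x ^ (m - Suc r) * z j ^ r) = (\<Sum>r<m. x ^ (m - 1) - x ^ (m - Suc r) * (x ^ r - z j ^ r))"
        by (intro sum.cong refl) (simp add: algebra_simps flip: power_add)
      also have "\<dots> = real m * x ^ (m - 1) - (\<Sum>r<m. x ^ (m - Suc r) * (x ^ r - z j ^ r))"
        by (simp add: sum_subtractf)
      also have "(\<Sum>r<m. x ^ (m - Suc r) * (x ^ r - z j ^ r)) = (x - z j) * (\<Sum>r<m. \<Sum>q<r. x ^ (m - 2 - q) * z j ^ q)"
        unfolding sum_distrib_left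
      proof (intro sum.cong refl)
        fix r assume r: "r \<in> {..<m}"
        have "x ^ (m - Suc r) * (x ^ r - z j ^ r) = (x - z j) * (\<Sum>q<r. x ^ (m - Suc r) * (x ^ (r - Suc q) * z j ^ q))"
          unfolding geo[of x r] by (simp add: sum_distrib_left mult_ac)
        also have "(\<Sum>q<r. x ^ (m - Suc r) * (x ^ (r - Suc q) * z j ^ q)) = (\<Sum>q<r. x ^ (m - 2 - q) * z j ^ q)"
        proof (intro sum.cong refl)
          fix q assume "q \<in> {..<r}"
          then have "(m - Suc r) + (r - Suc q) = m - 2 - q" using r by auto
          then have "x ^ (m - Suc r) * x ^ (r - Suc q) = x ^ (m - 2 - q)" by (metis power_add)
          then show "x ^ (m - Suc r) * (x ^ (r - Suc q) * z j ^ q) = x ^ (m - 2 - q) * z j ^ q"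
            by (simp add: mult.assoc[symmetric])
        qed
        finally show "x ^ (m - Suc r) * (x ^ r - z j ^ r) = (\<Sum>q<r. (x - z j) * (x ^ (m - 2 - q) * z j ^ q))"
          by (simp add: sum_distrib_left)
      qed
      finally show ?thesis using False ne by (simp add: diff_divide_distrib)
    qed
    have "(\<Sum>j\<in>{1..N}. energy_matrix N z i j * z j ^ m) = (\<Sum>j\<in>{1..N}. (x ^ m - z j ^ m) / (x - z j)\<^sup>2)"
      unfolding x_def by (rule energy_matrix_mult[OF i])
    also have "\<dots> = (\<Sum>j\<in>{1..N}. real m * x ^ (m - 1) * (1 / (x - z j))
         - (\<Sum>r<m. \<Sum>q<r. x ^ (m - 2 - q) * z j ^ q) + (if j = i then \<Sum>r<m. \<Sum>q<r. x ^ (m - 2) else 0))"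
      by (intro sum.cong refl summand)
    also have "\<dots> = real m * x ^ (m - 1) * (\<Sum>j\<in>{1..N}. 1 / (x - z j))
         - (\<Sum>j\<in>{1..N}. \<Sum>r<m. \<Sum>q<r. x ^ (m - 2 - q) * z j ^ q) + (\<Sum>r<m. \<Sum>q<r. x ^ (m - 2))"
      using i by (simp add: sum.distrib sum_subtractf sum_distrib_left)
    \<comment> \<open>The Stieltjes relation turns the sum of the simple poles into one more factor
      \<open>x\<close>; this yields the eigenvalue \<open>m\<close>.\<close>
    also have "(\<Sum>j\<in>{1..N}. 1 / (x - z j)) = x"
      using st i unfolding stieltjes_eq_def x_def by blast
    also have "real m * x ^ (m - 1) * x = real m * x ^ m"
      by (cases m) auto
    also have "(\<Sum>j\<in>{1..N}. \<Sum>r<m. \<Sum>q<r. x ^ (m - 2 - q) * z j ^ q) = (\<Sum>r<m. \<Sum>j\<in>{1..N}. \<Sum>q<r. x ^ (m - 2 - q) * z j ^ q)"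
      by (rule sum.swap)
    also have "\<dots> = (\<Sum>r<m. \<Sum>q<r. \<Sum>j\<in>{1..N}. x ^ (m - 2 - q) * z j ^ q)"
      by (intro sum.cong refl sum.swap)
    also have "\<dots> = (\<Sum>r<m. \<Sum>q<r. P q * x ^ (m - 2 - q))"
      by (simp add: P_def sum_distrib_left mult.commute)
    also have "real m * x ^ m - (\<Sum>r<m. \<Sum>q<r. P q * x ^ (m - 2 - q)) + (\<Sum>r<m. \<Sum>q<r. x ^ (m - 2)) = real m * x ^ m + poly p x"
      by (simp add: p_def poly_sum poly_monom sum_subtractf)
    finally show ?thesis unfolding x_def .
  qed
  then show ?thesis unfolding pp by blast
qed

text \<open>With the Vandermonde matrix \<open>V\<close> of the nodes,
  \<open>energy_matrix_power\<close> says that \<open>M V = V U\<close> with \<open>U\<close> upper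
  triangular and diagonal entries \<open>\<eta> + a * real m\<close>. Cancelling the determinant of
  \<open>V\<close> gives the product.\<close>

lemma det_energy_form:
  assumes st: "stieltjes_eq N z" and inj: "inj_on z {1..N}"
  shows "Determinant.det (form_mat N (energy_form N z \<eta> a)) = (\<Prod>m<N. \<eta> + a * real m)"
proof -
  obtain c where c: "\<And>m i. i \<in> {1..N} \<Longrightarrow>
      (\<Sum>j\<in>{1..N}. energy_matrix N z i j * z j ^ m) = real m * z i ^ m + (\<Sum>l<m. c m l * z i ^ l)"
    using energy_matrix_power[OF assms] by metis
  define V where "V = mat N N (\<lambda>(i, m). z (Suc i) ^ m)"
  define U where "U = mat N N (\<lambda>(l, m). if l = m then \<eta> + a * real m else if l < m then a * c m l else 0)"
  let ?M = "form_mat N (energy_form N z \<eta> a)"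
  have carr: "V \<in> carrier_mat N N" "U \<in> carrier_mat N N" "?M \<in> carrier_mat N N"
    by (auto simp: V_def U_def)
  have MV: "?M * V = V * U"
  proof (rule eq_matI)
    fix i m assume "i < dim_row (V * U)" "m < dim_col (V * U)"
    then have im: "i < N" "m < N" by (auto simp: V_def U_def)
    let ?x = "z (Suc i)"
    have "(?M * V) $$ (i, m) = (\<Sum>j\<in>{0..<N}. energy_form N z \<eta> a (Suc i) (Suc j) * z (Suc j) ^ m)"
      using im by (simp add: V_def scalar_prod_def)
    also have "\<dots> = (\<Sum>j\<in>{1..N}. energy_form N z \<eta> a (Suc i) j * z j ^ m)"
      by (simp add: sum.shift_bounds_Suc_ivl[symmetric, of "\<lambda>j. energy_form N z \<eta> a (Suc i) j * z j ^ m"] atLeastLessThanSuc_atLeastAtMost)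
    also have "\<dots> = (\<Sum>j\<in>{1..N}. (if Suc i = j then \<eta> * z j ^ m else 0)) + a * (\<Sum>j\<in>{1..N}. energy_matrix N z (Suc i) j * z j ^ m)"
      unfolding energy_form_def sum_distrib_left sum.distrib[symmetric] by (intro sum.cong refl) (auto simp: algebra_simps)
    also have "\<dots> = \<eta> * ?x ^ m + a * (real m * ?x ^ m + (\<Sum>l<m. c m l * ?x ^ l))"
      using im c[of "Suc i" m] by simp
    also have "\<dots> = (\<eta> + a * real m) * ?x ^ m + (\<Sum>l<m. ?x ^ l * (a * c m l))"
      by (simp add: algebra_simps sum_distrib_left)
    also have "\<dots> = (\<Sum>l\<in>{..<Suc m}. ?x ^ l * (if l = m then \<eta> + a * real m else if l < m then a * c m l else 0))"
      by (simp add: lessThan_Suc)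
    also have "\<dots> = (\<Sum>l\<in>{0..<N}. ?x ^ l * (if l = m then \<eta> + a * real m else if l < m then a * c m l else 0))"
      by (rule sum.mono_neutral_left) (use im in auto)
    also have "\<dots> = (V * U) $$ (i, m)"
      using im by (simp add: V_def U_def scalar_prod_def)
    finally show "(?M * V) $$ (i, m) = (V * U) $$ (i, m)" .
  qed (auto simp: V_def U_def)
  \<comment> \<open>A kernel vector of \<open>V\<close> would be the coefficient list of a nonzero
    polynomial of degree below \<open>N\<close> that vanishes at the \<open>N\<close> distinct
    nodes.\<close>
  have detV: "Determinant.det V \<noteq> 0"
  proof
    assume "Determinant.det V = 0"
    then obtain v where v: "v \<in> carrier_vec N" "v \<noteq> 0\<^sub>v N" "V *\<^sub>v v = 0\<^sub>v N"
      using det_0_iff_vec_prod_zero[OF carr(1)] by blast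
    define p where "p = (\<Sum>m<N. monom (vec_index v m) m)"
    have cp: "coeff p m = (if m < N then vec_index v m else 0)" for m
      by (simp add: p_def coeff_sum)
    have p0: "p \<noteq> 0"
    proof
      assume "p = 0"
      then have "\<forall>m<N. vec_index v m = 0" using cp by (metis coeff_0)
      then have "v = 0\<^sub>v N" using v(1) by (intro eq_vecI) auto
      then show False using v(2) by simp
    qed
    have "poly p (z i) = 0" if i: "i \<in> {1..N}" for i
    proof -
      have "poly p (z i) = (\<Sum>m\<in>{0..<N}. z i ^ m * vec_index v m)"
        by (simp add: p_def poly_sum poly_monom mult.commute lessThan_atLeast0)
      also have "\<dots> = vec_index (V *\<^sub>v v) (i - 1)"
        using i v(1) by (auto simp: V_def scalar_prod_def)
      finally show ?thesis using i v(3) by auto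
    qed
    then have "z ` {1..N} \<subseteq> {x. poly p x = 0}" by blast
    then have "card (z ` {1..N}) \<le> card {x. poly p x = 0}"
      by (intro card_mono poly_roots_finite p0)
    also have "\<dots> \<le> degree p" by (rule card_poly_roots_bound[OF p0])
    also have "degree p < N"
    proof -
      have "N > 0" using p0 by (cases N) (auto simp: p_def)
      moreover have "degree p \<le> N - 1" by (rule degree_le) (use cp in auto)
      ultimately show ?thesis by simp
    qed
    finally show False using inj by (simp add: card_image)
  qed
  have "Determinant.det ?M * Determinant.det V = Determinant.det V * Determinant.det U"
    using Determinant.det_mult[OF carr(3,1)] Determinant.det_mult[OF carr(1,2)] unfolding MV by metis
  moreover have "Determinant.det U = prod_list (diag_mat U)"
    by (rule det_upper_triangular) (auto simp: U_def)
  moreover have "\<dots> = (\<Prod>m<N. \<eta> + a * real m)"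
    by (simp add: prod_list_diag_prod U_def lessThan_atLeast0)
  ultimately show ?thesis using detV by simp
qed

section \<open>Hermite's differential equation and the Stieltjes relations for the zeros\<close>

lemma hermite_rec_deriv:
  assumes "pderiv (pderiv (hermite_rec n)) = [:0, 2:] * pderiv (hermite_rec n) - Polynomial.smult (2 * real n) (hermite_rec n)"
  shows "pderiv (hermite_rec (Suc n)) = Polynomial.smult (2 * real (Suc n)) (hermite_rec n)"
proof -
  have "pderiv (hermite_rec (Suc n)) = Polynomial.smult 2 (hermite_rec n) + [:0, 2:] * pderiv (hermite_rec n) - pderiv (pderiv (hermite_rec n))"
    by (simp add: pderiv_diff pderiv_mult pderiv_pCons pderiv_smult)
  also have "\<dots> = Polynomial.smult 2 (hermite_rec n) + Polynomial.smult (2 * real n) (hermite_rec n)"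
    unfolding assms by simp
  also have "\<dots> = Polynomial.smult (2 * real (Suc n)) (hermite_rec n)"
    by (simp add: smult_add_left[symmetric] algebra_simps)
  finally show ?thesis .
qed

text \<open>Interleaved induction: the equation for \<open>n\<close> gives the derivative rule
  \<open>H' = 2 (n + 1) H\<close> from index \<open>n + 1\<close> to index \<open>n\<close> in
  \<open>hermite_rec_deriv\<close>. Differentiating that rule and using the recursion gives the
  equation for \<open>n + 1\<close>.\<close>

lemma hermite_ode:
  "pderiv (pderiv (hermite_poly n)) = [:0, 2:] * pderiv (hermite_poly n) - Polynomial.smult (2 * real n) (hermite_poly n)"
  unfolding hermite_poly_eq_rec
proof (induction n)
  case (Suc n)
  have "pderiv (pderiv (hermite_rec (Suc n))) = Polynomial.smult (2 * real (Suc n)) (pderiv (hermite_rec n))"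
    unfolding hermite_rec_deriv[OF Suc] by (rule pderiv_smult)
  also have "\<dots> = [:0, 2:] * Polynomial.smult (2 * real (Suc n)) (hermite_rec n) - Polynomial.smult (2 * real (Suc n)) (hermite_rec (Suc n))"
    by (simp add: smult_diff_right)
  finally show ?case unfolding hermite_rec_deriv[OF Suc] .
qed simp

lemma hermite_zeros_props:
  shows "\<And>i. i \<in> {1..N} \<Longrightarrow> poly (hermite_poly N) (hermite_zeros N i) = 0"
    and "\<And>i j. 1 \<le> i \<Longrightarrow> i < j \<Longrightarrow> j \<le> N \<Longrightarrow> hermite_zeros N j < hermite_zeros N i"
proof -
  let ?R = "{x. poly (hermite_poly N) x = 0}"
  let ?xs = "sorted_list_of_set ?R"
  have "coeff (hermite_poly N) N = 2 ^ N"
    using hermite_family_hermite_poly unfolding hermite_family_def by metis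
  then have "hermite_poly N \<noteq> 0" by auto
  then have fin: "finite ?R" by (rule poly_roots_finite)
  have len: "length ?xs = N" using card_hermite_roots[of N] by simp
  have nth: "hermite_zeros N i = ?xs ! (N - i)" if "1 \<le> i" "i \<le> N" for i
    unfolding hermite_zeros_def using that len by (subst rev_nth) (auto simp: Suc_diff_le)
  show "poly (hermite_poly N) (hermite_zeros N i) = 0" if "i \<in> {1..N}" for i
  proof -
    have "?xs ! (N - i) \<in> set ?xs" using that len by (intro nth_mem) auto
    then show ?thesis using fin nth[of i] that by simp
  qed
  show "hermite_zeros N j < hermite_zeros N i" if "1 \<le> i" "i < j" "j \<le> N" for i j
    using that len nth[of i] nth[of j] strict_sorted_list_of_set[of ?R]
    by (auto simp: sorted_wrt_iff_nth_less)
qed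


text \<open>Write the product as \<open>(X - z i) q\<close>. At \<open>z i\<close> its first
  derivative is \<open>q\<close> and its second is \<open>2 q'\<close>, and the logarithmic
  derivative of \<open>q\<close> is the sum of the \<open>1 / (z i - z j)\<close>, where
  \<open>j = i\<close> contributes \<open>1 / 0 = 0\<close>.\<close>

lemma deriv_prod_linear_at_root:
  fixes z :: "'b \<Rightarrow> real"
  assumes "finite S" "inj_on z S" "i \<in> S"
  shows "poly (pderiv (pderiv (\<Prod>j\<in>S. [:- z j, 1:]))) (z i)
    = 2 * (\<Sum>j\<in>S. 1 / (z i - z j)) * poly (pderiv (\<Prod>j\<in>S. [:- z j, 1:])) (z i)"
    and "poly (pderiv (\<Prod>j\<in>S. [:- z j, 1:])) (z i) \<noteq> 0"
proof -
  define q where "q = (\<Prod>j\<in>S - {i}. [:- z j, 1:])"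
  have P: "(\<Prod>j\<in>S. [:- z j, 1:]) = [:- z i, 1:] * q"
    unfolding q_def using assms(1,3) by (rule prod.remove)
  have ne: "z i - z j \<noteq> 0" if "j \<in> S - {i}" for j
    using that assms(2,3) unfolding inj_on_def by auto
  have q: "poly q (z i) \<noteq> 0"
    unfolding q_def poly_prod using assms(1) ne by auto
  have "poly (pderiv q) (z i) = (\<Sum>j\<in>S - {i}. \<Prod>l\<in>S - {i} - {j}. z i - z l)"
    unfolding q_def pderiv_prod by (simp add: poly_sum poly_prod pderiv_pCons)
  also have "\<dots> = (\<Sum>j\<in>S - {i}. poly q (z i) * (1 / (z i - z j)))"
  proof (intro sum.cong refl)
    fix j assume j: "j \<in> S - {i}"
    have "poly q (z i) = (z i - z j) * (\<Prod>l\<in>S - {i} - {j}. z i - z l)"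
      unfolding q_def poly_prod using assms(1) j by (subst prod.remove[of _ j]) auto
    then show "(\<Prod>l\<in>S - {i} - {j}. z i - z l) = poly q (z i) * (1 / (z i - z j))"
      using ne[OF j] by simp
  qed
  also have "\<dots> = poly q (z i) * (\<Sum>j\<in>S. 1 / (z i - z j))"
    unfolding sum_distrib_left[symmetric] using assms(1,3) by (subst (2) sum.remove[of _ i]) auto
  finally have q': "poly (pderiv q) (z i) = poly q (z i) * (\<Sum>j\<in>S. 1 / (z i - z j))" .
  show "poly (pderiv (pderiv (\<Prod>j\<in>S. [:- z j, 1:]))) (z i)
    = 2 * (\<Sum>j\<in>S. 1 / (z i - z j)) * poly (pderiv (\<Prod>j\<in>S. [:- z j, 1:])) (z i)"
  proof -
    have 1: "pderiv ([:- z i, 1:] * q) = q + [:- z i, 1:] * pderiv q"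
      by (simp add: pderiv_mult pderiv_pCons del: mult_pCons_left)
    have 2: "pderiv (q + [:- z i, 1:] * pderiv q) = Polynomial.smult 2 (pderiv q) + [:- z i, 1:] * pderiv (pderiv q)"
      using smult_add_left[of 1 1 "pderiv q"]
      by (simp add: pderiv_mult pderiv_add pderiv_pCons del: mult_pCons_left)
    show ?thesis
      unfolding P 1 2 by (simp add: q')
  qed
  show "poly (pderiv (\<Prod>j\<in>S. [:- z j, 1:])) (z i) \<noteq> 0"
    unfolding P using q by (simp add: pderiv_mult pderiv_pCons del: mult_pCons_left)
qed

lemma inj_on_hermite_zeros: "inj_on (hermite_zeros N) {1..N}"
proof (rule linorder_inj_onI)
  fix i j assume "i < j" "i \<in> {1..N}" "j \<in> {1..N}"
  then show "hermite_zeros N i \<noteq> hermite_zeros N j"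
    using hermite_zeros_props(2)[of i j N] by auto
qed auto

text \<open>At a zero the Hermite equation reads \<open>P'' = 2 z P'\<close>, while
  \<open>deriv_prod_linear_at_root\<close> gives \<open>P'' = 2 S P'\<close> with \<open>S\<close>
  the Stieltjes sum. The zeros are simple, so \<open>P'\<close> cancels.\<close>

lemma stieltjes_eq_hermite_zeros: "stieltjes_eq N (hermite_zeros N)"
  unfolding stieltjes_eq_def
proof
  fix i assume i: "i \<in> {1..N}"
  let ?z = "hermite_zeros N" and ?H = "hermite_poly N"
  define P where "P = (\<Prod>j\<in>{1..N}. [:- ?z j, 1:])"
  have deg: "degree ?H = N" and lc: "coeff ?H N = 2 ^ N"
    using hermite_family_hermite_poly unfolding hermite_family_def by metis+
  have degP: "degree P = N" unfolding P_def by (subst degree_prod_eq_sum_degree) auto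
  have lcP: "coeff P N = 1"
    using degP lead_coeff_prod[of "\<lambda>j. [:- ?z j, 1:]" "{1..N}"] by (simp add: P_def)
  \<comment> \<open>Equal leading coefficients make the difference have degree below
    \<open>N\<close>, but it vanishes at \<open>N\<close> distinct points.\<close>
  have "?H = Polynomial.smult (2 ^ N) P"
  proof (rule ccontr)
    define R where "R = ?H - Polynomial.smult (2 ^ N) P"
    assume "?H \<noteq> Polynomial.smult (2 ^ N) P"
    then have R0: "R \<noteq> 0" by (simp add: R_def)
    have "degree R \<le> N"
      unfolding R_def by (intro degree_diff_le) (use deg degP degree_smult_le[of "2 ^ N" P] in auto)
    moreover have "coeff R N = 0" by (simp add: R_def lc lcP)
    ultimately have dR: "degree R < N" using R0 by (metis leading_coeff_0_iff order_le_less)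
    have "poly P (?z i) = 0" if "i \<in> {1..N}" for i
      unfolding P_def poly_prod using that by (intro prod_zero bexI[of _ i]) auto
    then have "?z ` {1..N} \<subseteq> {x. poly R x = 0}"
      using hermite_zeros_props(1) by (auto simp: R_def)
    then have "card (?z ` {1..N}) \<le> card {x. poly R x = 0}"
      by (intro card_mono poly_roots_finite R0)
    also have "\<dots> \<le> degree R" by (rule card_poly_roots_bound[OF R0])
    finally show False using dR inj_on_hermite_zeros[of N] by (simp add: card_image)
  qed
  then have H: "P = Polynomial.smult (1 / 2 ^ N) ?H" by simp
  note d = deriv_prod_linear_at_root[OF _ inj_on_hermite_zeros i, folded P_def]
  have "poly (pderiv (pderiv P)) (?z i) = 2 * ?z i * poly (pderiv P) (?z i)"
    unfolding H pderiv_smult hermite_ode using hermite_zeros_props(1)[OF i] by simp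
  then show "(\<Sum>j\<in>{1..N}. 1 / (?z i - ?z j)) = ?z i"
    using d by simp
qed

section \<open>Comparison of the logarithmic gas with a Gaussian\<close>

text \<open>The third-order Taylor remainder \<open>g\<close> has derivative
  \<open>x ^ 3 / (1 + x)\<close>, so on \<open>x > -1\<close> its minimum is \<open>g 0 = 0\<close>.
  The cubic term is then absorbed by \<open>u ^ 3 \<le> B * u\<^sup>2\<close>, which uses only an
  upper bound on \<open>u\<close>.\<close>

lemma log_taylor_lower:
  fixes u B :: real
  assumes "-1 < u" "u \<le> B"
  shows "(1 - 2 * B / 3) * u\<^sup>2 / 2 \<le> u - ln (1 + u)"
proof -
  define g where "g = (\<lambda>u::real. u - u\<^sup>2 / 2 + u ^ 3 / 3 - ln (1 + u))"
  have der: "(g has_real_derivative x ^ 3 / (1 + x)) (at x)" if "-1 < x" for x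
    unfolding g_def using that
    by (auto intro!: derivative_eq_intros simp: field_simps power2_eq_square power3_eq_cube)
  have "g u \<ge> g 0"
  proof (cases "u \<ge> 0")
    case True
    have "\<exists>y. DERIV g x :> y \<and> y \<ge> 0" if "0 \<le> x" for x
      using der[of x] that by (intro exI[of _ "x ^ 3 / (1 + x)"]) auto
    then show ?thesis
      using True by (intro DERIV_nonneg_imp_nondecreasing[of 0 u g]) auto
  next
    case False
    have "\<exists>y. DERIV g x :> y \<and> y \<le> 0" if "u \<le> x" "x \<le> 0" for x
    proof (intro exI conjI)
      show "DERIV g x :> x ^ 3 / (1 + x)" using that assms by (intro der) auto
      show "x ^ 3 / (1 + x) \<le> 0"
        using that assms by (intro divide_nonpos_pos) (auto simp: power3_eq_cube mult_nonneg_nonpos)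
    qed
    then show ?thesis
      using False by (intro DERIV_nonpos_imp_nonincreasing[of u 0 g]) auto
  qed
  then have "u\<^sup>2 / 2 - u ^ 3 / 3 \<le> u - ln (1 + u)" by (simp add: g_def)
  moreover have "u * u\<^sup>2 \<le> B * u\<^sup>2" using assms by (intro mult_right_mono) auto
  moreover have "u ^ 3 = u * u\<^sup>2" by (simp add: power3_eq_cube power2_eq_square)
  moreover have "(1 - 2 * B / 3) * u\<^sup>2 / 2 = u\<^sup>2 / 2 - B * u\<^sup>2 / 3" by (simp add: left_diff_distrib)
  ultimately show ?thesis by linarith
qed

text \<open>The function \<open>u - ln (1 + u)\<close> is convex and vanishes at 0, hence grows at
  least linearly along rays.\<close>

lemma log_scaled_ge:
  fixes u r :: real
  assumes "-1 < u" "1 \<le> r"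
  shows "r * (u / r - ln (1 + u / r)) \<le> u - ln (1 + u)"
proof -
  have "(1 - 1 / r) * ln 1 + (1 / r) * ln (1 + u) \<le> ln ((1 - 1 / r) *\<^sub>R 1 + (1 / r) *\<^sub>R (1 + u))"
    using assms by (intro concave_onD[OF ln_concave]) auto
  also have "(1 - 1 / r) *\<^sub>R 1 + (1 / r) *\<^sub>R (1 + u) = 1 + u / r"
    using assms by (simp add: field_simps)
  finally have "ln (1 + u) \<le> r * ln (1 + u / r)"
    using assms by (simp add: field_simps)
  then show ?thesis using assms by (simp add: right_diff_distrib)
qed

text \<open>The linear terms cancel and the logarithms combine to
  \<open>- ln (1 - u\<^sup>2)\<close>, which is at most
  \<open>u\<^sup>2 / (1 - u\<^sup>2)\<close>.\<close>

lemma log_symmetrized_upper: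
  fixes u B :: real
  assumes "\<bar>u\<bar> \<le> B" "B < 1"
  shows "(u - ln (1 + u)) + (- u - ln (1 + - u)) \<le> u\<^sup>2 / (1 - B\<^sup>2)"
proof -
  have u: "u\<^sup>2 \<le> B\<^sup>2" using assms(1) by (metis abs_ge_zero power2_abs power_mono)
  have B: "B\<^sup>2 < 1" using assms by (simp add: power_less_one_iff abs_square_less_1)
  have "ln (1 + u) + ln (1 + - u) = ln (1 - u\<^sup>2)"
  proof -
    have "ln (1 - u\<^sup>2) = ln ((1 + u) * (1 + - u))" by (simp add: power2_eq_square algebra_simps)
    also have "\<dots> = ln (1 + u) + ln (1 + - u)" using assms by (intro ln_mult_pos) auto
    finally show ?thesis by simp
  qed
  moreover have "1 - 1 / (1 - u\<^sup>2) \<le> ln (1 - u\<^sup>2)"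
    using ln_le_minus_one[of "1 / (1 - u\<^sup>2)"] u B by (simp add: ln_div)
  moreover have "1 - 1 / (1 - u\<^sup>2) = - (u\<^sup>2 / (1 - u\<^sup>2))"
    using u B by (simp add: field_simps)
  moreover have "u\<^sup>2 / (1 - u\<^sup>2) \<le> u\<^sup>2 / (1 - B\<^sup>2)"
    using u B by (intro divide_left_mono mult_pos_pos) auto
  ultimately show ?thesis by linarith
qed

section \<open>Pointwise bounds for the log-gas weight\<close>

definition log_gas_potential :: "nat \<Rightarrow> (nat \<Rightarrow> real) \<Rightarrow> (nat \<Rightarrow> real) \<Rightarrow> real" where
  "log_gas_potential N z y =
     (\<Sum>j\<in>{1..N}. \<Sum>i\<in>{1..<j}. pair_ratio z y i j - ln (1 + pair_ratio z y i j))"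

text \<open>For strictly decreasing \<open>z\<close> this says that \<open>z + y\<close> is strictly
  decreasing as well, so the logarithms of the potential have positive arguments.\<close>

definition log_gas_domain :: "nat \<Rightarrow> (nat \<Rightarrow> real) \<Rightarrow> (nat \<Rightarrow> real) \<Rightarrow> bool" where
  "log_gas_domain N z y \<longleftrightarrow> (\<forall>j\<in>{1..N}. \<forall>i\<in>{1..<j}. - 1 < pair_ratio z y i j)"

text \<open>The Hermite weight in the coordinate \<open>y = x / sqrt (2 k) - z\<close>, up to a constant
  (lemma \<open>hermite_weight_log_gas\<close>).\<close>

definition log_gas_weight :: "real \<Rightarrow> nat \<Rightarrow> (nat \<Rightarrow> real) \<Rightarrow> (nat \<Rightarrow> real) \<Rightarrow> real" where
  "log_gas_weight k N z y = (if log_gas_domain N z y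
     then exp (- (k * (\<Sum>i\<in>{1..N}. (y i)\<^sup>2) + 2 * k * log_gas_potential N z y)) else 0)"

lemma pair_ratio_sq_le_energy:
  assumes "j \<in> {1..N}" "i \<in> {1..<j}"
  shows "(pair_ratio z y i j)\<^sup>2 \<le> pair_energy N z y"
proof -
  have "(pair_ratio z y i j)\<^sup>2 \<le> (\<Sum>i\<in>{1..<j}. (pair_ratio z y i j)\<^sup>2)"
    using assms by (intro member_le_sum) auto
  also have "\<dots> \<le> pair_energy N z y"
    unfolding pair_energy_def using assms
    by (intro member_le_sum[of j _ "\<lambda>j. \<Sum>i\<in>{1..<j}. (pair_ratio z y i j)\<^sup>2"]) (auto intro: sum_nonneg)
  finally show ?thesis .
qed

lemma abs_pair_ratio_le:
  assumes "j \<in> {1..N}" "i \<in> {1..<j}" "pair_energy N z y \<le> B\<^sup>2" "0 \<le> B"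
  shows "\<bar>pair_ratio z y i j\<bar> \<le> B"
  using order_trans[OF pair_ratio_sq_le_energy[OF assms(1,2)] assms(3)] assms(4)
  by (intro power2_le_imp_le[OF _ assms(4)]) simp

lemma log_gas_potential_ge_quadratic:
  assumes "log_gas_domain N z y" "pair_energy N z y \<le> B\<^sup>2" "0 \<le> B"
  shows "(1 - 2 * B / 3) / 2 * pair_energy N z y \<le> log_gas_potential N z y"
proof -
  have "(1 - 2 * B / 3) / 2 * (pair_ratio z y i j)\<^sup>2 \<le> pair_ratio z y i j - ln (1 + pair_ratio z y i j)"
    if "j \<in> {1..N}" "i \<in> {1..<j}" for i j
  proof -
    have "- 1 < pair_ratio z y i j" using assms(1) that unfolding log_gas_domain_def by blast
    moreover have "pair_ratio z y i j \<le> B" using abs_pair_ratio_le[OF that assms(2,3)] by simp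
    ultimately show ?thesis using log_taylor_lower[of "pair_ratio z y i j" B] by simp
  qed
  then show ?thesis
    unfolding pair_energy_def log_gas_potential_def sum_distrib_left by (intro sum_mono)
qed

text \<open>Shrink \<open>y\<close> by \<open>r\<close> until its pair energy is exactly
  \<open>B\<^sup>2\<close>, apply the quadratic bound there, and return along the ray by
  \<open>log_scaled_ge\<close>. The gain is linear in the root of the energy.\<close>

lemma log_gas_potential_ge_linear:
  assumes "log_gas_domain N z y" "B\<^sup>2 \<le> pair_energy N z y" "0 < B"
  shows "(1 - 2 * B / 3) / 2 * (B * sqrt (pair_energy N z y)) \<le> log_gas_potential N z y"
proof -
  define Q where "Q = pair_energy N z y"
  define r where "r = sqrt Q / B"
  have "B \<le> sqrt Q" using assms(2,3) by (simp add: Q_def real_le_rsqrt)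
  then have r: "1 \<le> r" using assms(3) by (simp add: r_def)
  define y' where "y' = (\<lambda>i. y i / r)"
  have pr: "pair_ratio z y' i j = pair_ratio z y i j / r" for i j
    by (simp add: pair_ratio_def y'_def diff_divide_distrib mult.commute)
  have Q': "pair_energy N z y' = Q / r\<^sup>2"
    unfolding Q_def pair_energy_def pr by (simp add: power_divide sum_divide_distrib)
  have "0 < B\<^sup>2" using assms(3) by simp
  then have Q: "0 < Q" using assms(2) unfolding Q_def by linarith
  then have "r\<^sup>2 = Q / B\<^sup>2" by (simp add: r_def power_divide)
  then have rQ: "Q / r\<^sup>2 = B\<^sup>2" using Q by simp
  have "pair_ratio z y i j / r > -1" if "pair_ratio z y i j > -1" for i j
    using that r by (auto simp: less_divide_eq)
  then have dom: "log_gas_domain N z y'"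
    using assms(1) unfolding log_gas_domain_def pr by blast
  have "(1 - 2 * B / 3) / 2 * B\<^sup>2 \<le> log_gas_potential N z y'"
    using log_gas_potential_ge_quadratic[OF dom, of B] assms(3) unfolding Q' rQ by simp
  then have "r * ((1 - 2 * B / 3) / 2 * B\<^sup>2) \<le> r * log_gas_potential N z y'"
    using r by (intro mult_left_mono) auto
  also have "r * log_gas_potential N z y' \<le> log_gas_potential N z y"
    unfolding log_gas_potential_def pr sum_distrib_left
    using assms(1) unfolding log_gas_domain_def by (intro sum_mono log_scaled_ge r) auto
  also have "r * ((1 - 2 * B / 3) / 2 * B\<^sup>2) = (1 - 2 * B / 3) / 2 * (B * sqrt Q)"
    using assms(3) by (simp add: r_def power2_eq_square)
  finally show ?thesis unfolding Q_def .
qed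

text \<open>Where the pair energy is at most \<open>B\<^sup>2\<close> the weight is dominated by a
  Gaussian, elsewhere by an exponential of a root. Under that root stands the full form with
  \<open>\<eta>\<close>, since the pair energy vanishes on constant vectors and its root alone would
  not be integrable.\<close>

lemma log_gas_weight_exp_le:
  assumes k: "0 < k" and B: "0 < B" "B \<le> 1" and \<eta>: "0 < \<eta>"
  defines "a \<equiv> 1 - 2 * B / 3"
  shows "exp ((1 - \<eta>) * k * (\<Sum>i\<in>{1..N}. (y i)\<^sup>2)) * log_gas_weight k N z y
    \<le> exp (- (k * qform N (energy_form N z \<eta> a) y))
      + exp (- (k * B\<^sup>2 * (a / 2 - a\<^sup>2 / 16)))
        * exp (- (k * a * B / 2 * sqrt (qform N (energy_form N z \<eta> 1) y)))"
proof (cases "log_gas_domain N z y")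
  case False
  then show ?thesis by (auto simp: log_gas_weight_def intro!: add_nonneg_nonneg)
next
  case True
  define s where "s = (\<Sum>i\<in>{1..N}. (y i)\<^sup>2)"
  define Q where "Q = pair_energy N z y"
  define P where "P = log_gas_potential N z y"
  have s0: "s \<ge> 0" unfolding s_def by (intro sum_nonneg) auto
  have Q0: "Q \<ge> 0" unfolding Q_def by (rule pair_energy_nonneg)
  have a: "0 < a" using B by (simp add: a_def)
  have lhs: "exp ((1 - \<eta>) * k * s) * log_gas_weight k N z y = exp (- (\<eta> * k * s + 2 * k * P))"
    using True by (simp add: log_gas_weight_def s_def P_def exp_add[symmetric] algebra_simps)
  show ?thesis
  proof (cases "Q \<le> B\<^sup>2")
    case True': True
    have "a / 2 * Q \<le> P"
      using log_gas_potential_ge_quadratic[OF True] True' B unfolding a_def Q_def P_def by simp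
    then have "2 * k * (a / 2 * Q) \<le> 2 * k * P" using k by (intro mult_left_mono) auto
    then have "exp (- (\<eta> * k * s + 2 * k * P)) \<le> exp (- (k * qform N (energy_form N z \<eta> a) y))"
      by (simp add: qform_energy_form Q_def s_def algebra_simps)
    then show ?thesis unfolding s_def[symmetric] lhs by (simp add: add_increasing2)
  next
    case False
    \<comment> \<open>The potential supplies the decay \<open>c * sqrt Q\<close>. One half of it is
      traded, by \<open>B \<le> sqrt Q\<close>, for the small constant prefactor; the other half
      remains as decay.\<close>
    define c where "c = k * a * B"
    have c: "c > 0" using k a B by (simp add: c_def)
    have "a / 2 * (B * sqrt Q) \<le> P"
      using log_gas_potential_ge_linear[OF True] False B unfolding a_def Q_def P_def by simp
    then have "2 * k * (a / 2 * (B * sqrt Q)) \<le> 2 * k * P" using k by (intro mult_left_mono) auto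
    then have 1: "c * sqrt Q \<le> 2 * k * P" by (simp add: c_def mult_ac)
    have "B \<le> sqrt Q" using False B by (simp add: real_le_rsqrt)
    then have "c * B \<le> c * sqrt Q" using c by simp
    then have 2: "c / 2 * B + c / 2 * sqrt Q \<le> c * sqrt Q" by linarith
    \<comment> \<open>Completing the square gives a decay linear in \<open>sqrt (\<eta> * s)\<close>
      with the same rate \<open>c / 2\<close>, so that both roots merge by subadditivity. The cost
      \<open>c\<^sup>2 / (16 * k)\<close> is the term \<open>a\<^sup>2 / 16\<close> of the
      claim.\<close>
    have "0 \<le> k * (sqrt (\<eta> * s) - c / (4 * k))\<^sup>2" using k by simp
    also have "\<dots> = k * (sqrt (\<eta> * s))\<^sup>2 - c / 2 * sqrt (\<eta> * s) + c\<^sup>2 / (16 * k)"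
      using k by (simp add: power2_diff power_divide field_simps power2_eq_square)
    also have "(sqrt (\<eta> * s))\<^sup>2 = \<eta> * s" using \<eta> s0 by simp
    finally have 3: "c / 2 * sqrt (\<eta> * s) \<le> \<eta> * k * s + c\<^sup>2 / (16 * k)" by (simp add: mult_ac)
    have "c / 2 * sqrt (\<eta> * s + Q) \<le> c / 2 * (sqrt (\<eta> * s) + sqrt Q)"
      using c \<eta> s0 Q0 by (intro mult_left_mono sqrt_add_le_add_sqrt) auto
    also have "\<dots> = c / 2 * sqrt (\<eta> * s) + c / 2 * sqrt Q" by (simp add: distrib_left)
    also have "\<dots> \<le> \<eta> * k * s + c\<^sup>2 / (16 * k) + (2 * k * P - c / 2 * B)"
      using 1 2 3 by linarith
    finally have "c / 2 * sqrt (\<eta> * s + Q) + (c / 2 * B - c\<^sup>2 / (16 * k)) \<le> \<eta> * k * s + 2 * k * P"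
      by linarith
    moreover have "c / 2 * B - c\<^sup>2 / (16 * k) = k * B\<^sup>2 * (a / 2 - a\<^sup>2 / 16)"
      using k by (simp add: c_def field_simps power2_eq_square)
    ultimately have "exp (- (\<eta> * k * s + 2 * k * P)) \<le>
        exp (- (k * B\<^sup>2 * (a / 2 - a\<^sup>2 / 16))) * exp (- (c / 2 * sqrt (\<eta> * s + Q)))"
      unfolding exp_add[symmetric] by simp
    then show ?thesis
      unfolding s_def[symmetric] lhs c_def
      by (simp add: add_increasing qform_energy_form Q_def s_def)
  qed
qed

text \<open>Near the equilibrium the weights at \<open>y\<close> and \<open>- y\<close> are bounded
  below through their geometric mean, in which the odd orders cancel. Elsewhere the Gaussian on the
  left is itself small and is covered by the error term. The restricted lambda keeps the reflected
  vector in the product space.\<close>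

lemma log_gas_weight_symmetrized_ge:
  assumes k: "0 < k" and B: "0 < B" "B < 1"
  defines "b \<equiv> 1 / (1 - B\<^sup>2)"
  shows "2 * exp (- (k * qform N (energy_form N z 1 b) y))
    \<le> log_gas_weight k N z y + log_gas_weight k N z (\<lambda>i\<in>{1..N}. - y i)
      + 2 * (exp (- (k * B\<^sup>2 / 2)) * exp (- (k * qform N (energy_form N z 1 (b - 1 / 2)) y)))"
proof -
  define s where "s = (\<Sum>i\<in>{1..N}. (y i)\<^sup>2)"
  define Q where "Q = pair_energy N z y"
  let ?y = "\<lambda>i\<in>{1..N}. - y i"
  have s': "(\<Sum>i\<in>{1..N}. (?y i)\<^sup>2) = s"
    unfolding s_def by (intro sum.cong) auto
  have pr: "pair_ratio z ?y i j = - pair_ratio z y i j" if "j \<in> {1..N}" "i \<in> {1..<j}" for i j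
    using that by (simp add: pair_ratio_def minus_divide_left)
  show ?thesis
  proof (cases "Q \<le> B\<^sup>2")
    case True
    have u: "\<bar>pair_ratio z y i j\<bar> \<le> B" if "j \<in> {1..N}" "i \<in> {1..<j}" for i j
      using abs_pair_ratio_le[OF that, of z y B] True B unfolding Q_def by simp
    have "-1 < pair_ratio z y i j" if "j \<in> {1..N}" "i \<in> {1..<j}" for i j
      using u[OF that] B by linarith
    then have dom: "log_gas_domain N z y"
      unfolding log_gas_domain_def by blast
    have "-1 < pair_ratio z ?y i j" if "j \<in> {1..N}" "i \<in> {1..<j}" for i j
      using u[OF that] B unfolding pr[OF that] by linarith
    then have dom': "log_gas_domain N z ?y"
      unfolding log_gas_domain_def by blast
    have "log_gas_potential N z y + log_gas_potential N z ?y
       = (\<Sum>j\<in>{1..N}. \<Sum>i\<in>{1..<j}. (pair_ratio z y i j - ln (1 + pair_ratio z y i j)) +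
          (- pair_ratio z y i j - ln (1 + - pair_ratio z y i j)))"
      unfolding log_gas_potential_def sum.distrib[symmetric]
      by (intro sum.cong refl) (simp only: pr)
    also have "\<dots> \<le> (\<Sum>j\<in>{1..N}. \<Sum>i\<in>{1..<j}. (pair_ratio z y i j)\<^sup>2 / (1 - B\<^sup>2))"
      by (intro sum_mono log_symmetrized_upper u B(2))
    also have "\<dots> = b * Q"
      unfolding Q_def pair_energy_def b_def by (simp add: sum_divide_distrib)
    finally have pot: "log_gas_potential N z y + log_gas_potential N z ?y \<le> b * Q" .
    define \<alpha> where "\<alpha> = k * s + 2 * k * log_gas_potential N z y"
    define \<beta> where "\<beta> = k * s + 2 * k * log_gas_potential N z ?y"
    have "2 * k * (log_gas_potential N z y + log_gas_potential N z ?y) \<le> 2 * k * (b * Q)"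
      using pot k by (intro mult_left_mono) auto
    then have "(\<alpha> + \<beta>) / 2 \<le> k * (s + b * Q)"
      by (simp add: \<alpha>_def \<beta>_def algebra_simps)
    then have "2 * exp (- (k * (s + b * Q))) \<le> 2 * exp (- ((\<alpha> + \<beta>) / 2))" by simp
    \<comment> \<open>Arithmetic against geometric mean, as a sum of two squares.\<close>
    also have "\<dots> \<le> exp (- \<alpha>) + exp (- \<beta>)"
    proof -
      have "exp (- ((\<alpha> + \<beta>) / 2)) = exp (- \<alpha> / 2) * exp (- \<beta> / 2)"
        by (simp add: exp_add[symmetric] field_simps)
      moreover have "exp (- \<alpha>) = (exp (- \<alpha> / 2))\<^sup>2" "exp (- \<beta>) = (exp (- \<beta> / 2))\<^sup>2"
        by (simp_all add: power2_eq_square exp_add[symmetric])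
      ultimately show ?thesis
        using sum_squares_bound[of "exp (- \<alpha> / 2)" "exp (- \<beta> / 2)"] by (simp add: mult.assoc)
    qed
    also have "\<dots> = log_gas_weight k N z y + log_gas_weight k N z ?y"
      unfolding log_gas_weight_def using dom dom' by (simp only: s' \<alpha>_def \<beta>_def s_def if_True)
    finally show ?thesis
      by (simp add: qform_energy_form s_def Q_def add_increasing2)
  next
    case False
    \<comment> \<open>A share \<open>1 / 2\<close> of the coefficient \<open>b\<close> is spent on
      the factor \<open>exp (- (k * B\<^sup>2 / 2))\<close>; the rest is still a Gaussian with known
      determinant.\<close>
    have "k * B\<^sup>2 \<le> k * Q" using False k by simp
    then have "k * B\<^sup>2 / 2 + k * (s + (b - 1 / 2) * Q) \<le> k * (s + b * Q)"
      by (simp add: algebra_simps)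
    then have "exp (- (k * (s + b * Q))) \<le> exp (- (k * B\<^sup>2 / 2)) * exp (- (k * (s + (b - 1 / 2) * Q)))"
      unfolding exp_add[symmetric] by simp
    moreover have "log_gas_weight k N z w \<ge> 0" for w by (simp add: log_gas_weight_def)
    ultimately show ?thesis
      by (simp add: qform_energy_form s_def Q_def add_increasing)
  qed
qed

section \<open>Measurability and the two integrated comparisons\<close>

lemma pair_ratio_measurable [measurable]:
  assumes "i \<in> {1..N}" "j \<in> {1..N}"
  shows "(\<lambda>y. pair_ratio z y i j) \<in> borel_measurable (lebesgue_RN N)"
  unfolding pair_ratio_def using assms by measurable

lemma log_gas_weight_measurable [measurable]: "log_gas_weight k N z \<in> borel_measurable (lebesgue_RN N)"
proof -
  have [measurable]: "Measurable.pred (lebesgue_RN N) (log_gas_domain N z)"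
    unfolding log_gas_domain_def
  proof (intro pred_intros_finite)
    fix i j assume "j \<in> {1..N}" "i \<in> {1..<j}"
    then have [measurable]: "(\<lambda>y. pair_ratio z y i j) \<in> borel_measurable (lebesgue_RN N)"
      by (intro pair_ratio_measurable) auto
    show "Measurable.pred (lebesgue_RN N) (\<lambda>y. - 1 < pair_ratio z y i j)" by measurable
  qed auto
  have [measurable]: "log_gas_potential N z \<in> borel_measurable (lebesgue_RN N)"
    unfolding log_gas_potential_def
    by (intro borel_measurable_sum borel_measurable_diff borel_measurable_ln borel_measurable_add
        pair_ratio_measurable borel_measurable_const) auto
  show ?thesis
    unfolding log_gas_weight_def by measurable
qed

lemma qform_measurable [measurable]: "qform N M \<in> borel_measurable (lebesgue_RN N)"
  unfolding qform_def by measurable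

lemma nn_integral_add_cmult:
  assumes "f \<in> borel_measurable M" "h \<in> borel_measurable M"
  shows "(\<integral>\<^sup>+x. f x + e * h x \<partial>M) = (\<integral>\<^sup>+x. f x \<partial>M) + e * (\<integral>\<^sup>+x. h x \<partial>M)"
  using assms by (simp add: nn_integral_add nn_integral_cmult)

lemma nn_integral_add_scaled:
  assumes "f \<in> borel_measurable M" "g \<in> borel_measurable M" "h \<in> borel_measurable M"
  shows "(\<integral>\<^sup>+x. (f x + g x) + c * (e * h x) \<partial>M) = ((\<integral>\<^sup>+x. f x \<partial>M) + (\<integral>\<^sup>+x. g x \<partial>M)) + c * (e * (\<integral>\<^sup>+x. h x \<partial>M))"
  using assms by (simp add: nn_integral_add nn_integral_cmult)

text \<open>The two terms of \<open>log_gas_weight_exp_le\<close> are integrated by the Gaussian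
  formula and by the root bound, with determinants from \<open>det_energy_form\<close>. The decay
  rate \<open>k * a * B / 2\<close> accounts for the factor 4.\<close>

lemma nn_integral_log_gas_weight_le:
  assumes k: "0 < k" and B: "0 < B" "B \<le> 1" and \<eta>: "0 < \<eta>" and N: "0 < N"
    and z: "stieltjes_eq N z" "inj_on z {1..N}"
  defines "a \<equiv> 1 - 2 * B / 3"
  shows "(\<integral>\<^sup>+y. ennreal (exp ((1 - \<eta>) * k * (\<Sum>i\<in>{1..N}. (y i)\<^sup>2)) * log_gas_weight k N z y) \<partial>lebesgue_RN N)
    \<le> ennreal (sqrt (pi / k) ^ N / sqrt (\<Prod>m<N. \<eta> + a * real m)
      + exp (- (k * B\<^sup>2 * (a / 2 - a\<^sup>2 / 16))) * ((4 * sqrt N / (k * a * B)) ^ N / sqrt (\<Prod>m<N. \<eta> + real m)))"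
    (is "?L \<le> ennreal (?G + ?e * ?H)")
proof -
  have a: "0 < a" using B by (simp add: a_def)
  have c: "0 < k * a * B / 2" using a k B by simp
  have pd: "pos_def_form N (energy_form N z \<eta> c)" if "0 \<le> c" for c
    by (rule pos_def_energy_form[OF \<eta> that])
  have nonneg: "?G \<ge> 0" "?H \<ge> 0"
    using \<eta> a k B by (auto intro!: divide_nonneg_nonneg prod_nonneg add_nonneg_nonneg)
  have "?L \<le> (\<integral>\<^sup>+y. ennreal (exp (- (k * qform N (energy_form N z \<eta> a) y)))
      + ennreal ?e * ennreal (exp (- (k * a * B / 2 * sqrt (qform N (energy_form N z \<eta> 1) y)))) \<partial>lebesgue_RN N)"
  proof (intro nn_integral_mono)
    fix y
    show "ennreal (exp ((1 - \<eta>) * k * (\<Sum>i\<in>{1..N}. (y i)\<^sup>2)) * log_gas_weight k N z y)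
      \<le> ennreal (exp (- (k * qform N (energy_form N z \<eta> a) y)))
      + ennreal ?e * ennreal (exp (- (k * a * B / 2 * sqrt (qform N (energy_form N z \<eta> 1) y))))"
      using log_gas_weight_exp_le[OF k B \<eta>, where N=N and y=y and z=z, folded a_def]
      by (simp add: ennreal_leI ennreal_mult[symmetric] ennreal_plus[symmetric] del: ennreal_plus)
  qed
  also have "\<dots> = (\<integral>\<^sup>+y. ennreal (exp (- (k * qform N (energy_form N z \<eta> a) y))) \<partial>lebesgue_RN N)
      + ennreal ?e * (\<integral>\<^sup>+y. ennreal (exp (- (k * a * B / 2 * sqrt (qform N (energy_form N z \<eta> 1) y)))) \<partial>lebesgue_RN N)"
    by (rule nn_integral_add_cmult) measurable
  also have "\<dots> \<le> ennreal ?G + ennreal ?e * ennreal ?H"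
  proof (intro add_mono mult_left_mono)
    show "(\<integral>\<^sup>+y. ennreal (exp (- (k * qform N (energy_form N z \<eta> a) y))) \<partial>lebesgue_RN N) \<le> ennreal ?G"
      using nn_integral_qform_gauss[OF pd[where c=a] k] a by (simp add: det_energy_form[OF z])
    show "(\<integral>\<^sup>+y. ennreal (exp (- (k * a * B / 2 * sqrt (qform N (energy_form N z \<eta> 1) y)))) \<partial>lebesgue_RN N) \<le> ennreal ?H"
      using nn_integral_qform_exp_sqrt_le[OF pd[where c=1] c N] by (simp add: det_energy_form[OF z])
  qed auto
  also have "\<dots> = ennreal (?G + ?e * ?H)"
  proof -
    have "ennreal (?G + ?e * ?H) = ennreal ?G + ennreal (?e * ?H)"
      by (intro ennreal_plus mult_nonneg_nonneg nonneg exp_ge_zero)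
    also have "ennreal (?e * ?H) = ennreal ?e * ennreal ?H"
      by (intro ennreal_mult nonneg exp_ge_zero)
    finally show ?thesis by (rule sym)
  qed
  finally show ?thesis .
qed

text \<open>Reflection preserves Lebesgue measure, so both weights of the symmetrized bound have the
  same integral and the factor 2 cancels. The error stands on the right to avoid subtraction of
  extended reals.\<close>

lemma nn_integral_log_gas_weight_ge:
  assumes k: "0 < k" and B: "0 < B" "B < 1"
    and z: "stieltjes_eq N z" "inj_on z {1..N}"
  defines "b \<equiv> 1 / (1 - B\<^sup>2)"
  shows "ennreal (sqrt (pi / k) ^ N / sqrt (\<Prod>m<N. 1 + b * real m))
    \<le> (\<integral>\<^sup>+y. ennreal (log_gas_weight k N z y) \<partial>lebesgue_RN N)
      + ennreal (exp (- (k * B\<^sup>2 / 2)) * (sqrt (pi / k) ^ N / sqrt (\<Prod>m<N. 1 + (b - 1 / 2) * real m)))"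
    (is "?G \<le> ?W + ennreal (?e * ?H)")
proof -
  let ?r = "\<lambda>y::nat\<Rightarrow>real. \<lambda>i\<in>{1..N}. - y i"
  have B2: "B\<^sup>2 < 1" "0 < B\<^sup>2" using B by (auto simp: power_less_one_iff abs_square_less_1)
  then have b: "b \<ge> 1" by (simp add: b_def)
  have H: "?H \<ge> 0" using b k by (auto intro!: divide_nonneg_nonneg prod_nonneg)
  have refl: "(\<integral>\<^sup>+y. ennreal (log_gas_weight k N z (?r y)) \<partial>lebesgue_RN N) = ?W"
  proof -
    have "(\<lambda>y. ennreal (log_gas_weight k N z y)) \<in> borel_measurable (lebesgue_RN N)" by measurable
    from nn_integral_triangular[OF this, of "-1" "\<lambda>_. 0" "\<lambda>_ _. 0"] show ?thesis by simp
  qed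
  have rm [measurable]: "?r \<in> measurable (lebesgue_RN N) (lebesgue_RN N)"
    by (rule measurable_restrict) measurable
  have m1: "(\<lambda>y. ennreal (log_gas_weight k N z y)) \<in> borel_measurable (lebesgue_RN N)"
    by measurable
  have m2: "(\<lambda>y. ennreal (log_gas_weight k N z (?r y))) \<in> borel_measurable (lebesgue_RN N)"
    by (rule measurable_compose[OF rm m1])
  have m3: "(\<lambda>y. ennreal (exp (- (k * qform N (energy_form N z 1 (b - 1 / 2)) y)))) \<in> borel_measurable (lebesgue_RN N)"
    by measurable
  have gauss: "(\<integral>\<^sup>+y. ennreal (exp (- (k * qform N (energy_form N z 1 c) y))) \<partial>lebesgue_RN N)
     = ennreal (sqrt (pi / k) ^ N / sqrt (\<Prod>m<N. 1 + c * real m))" if "c \<ge> 0" for c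
  proof -
    have "pos_def_form N (energy_form N z 1 c)" using that by (intro pos_def_energy_form) auto
    from nn_integral_qform_gauss[OF this k] show ?thesis by (simp add: det_energy_form[OF z])
  qed
  have "2 * ?G = (\<integral>\<^sup>+y. 2 * ennreal (exp (- (k * qform N (energy_form N z 1 b) y))) \<partial>lebesgue_RN N)"
  proof -
    have "2 * ?G = 2 * (\<integral>\<^sup>+y. ennreal (exp (- (k * qform N (energy_form N z 1 b) y))) \<partial>lebesgue_RN N)"
      using gauss[of b] b by simp
    also have "\<dots> = (\<integral>\<^sup>+y. 2 * ennreal (exp (- (k * qform N (energy_form N z 1 b) y))) \<partial>lebesgue_RN N)"
      by (rule nn_integral_cmult[symmetric]) measurable
    finally show ?thesis .
  qed
  also have "\<dots> \<le> (\<integral>\<^sup>+y. (ennreal (log_gas_weight k N z y) + ennreal (log_gas_weight k N z (?r y)))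
      + 2 * (ennreal ?e * ennreal (exp (- (k * qform N (energy_form N z 1 (b - 1 / 2)) y)))) \<partial>lebesgue_RN N)"
  proof (intro nn_integral_mono)
    fix y
    have "0 \<le> log_gas_weight k N z w" for w by (simp add: log_gas_weight_def)
    moreover have "ennreal 2 = 2" by simp
    ultimately show "2 * ennreal (exp (- (k * qform N (energy_form N z 1 b) y)))
      \<le> (ennreal (log_gas_weight k N z y) + ennreal (log_gas_weight k N z (?r y)))
      + 2 * (ennreal ?e * ennreal (exp (- (k * qform N (energy_form N z 1 (b - 1 / 2)) y))))"
      using ennreal_leI[OF log_gas_weight_symmetrized_ge[OF k B, where N=N and y=y and z=z, folded b_def]]
      by (simp add: ennreal_mult ennreal_plus)
  qed
  also have "\<dots> = (?W + (\<integral>\<^sup>+y. ennreal (log_gas_weight k N z (?r y)) \<partial>lebesgue_RN N))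
      + 2 * (ennreal ?e * (\<integral>\<^sup>+y. ennreal (exp (- (k * qform N (energy_form N z 1 (b - 1 / 2)) y))) \<partial>lebesgue_RN N))"
    by (rule nn_integral_add_scaled[OF m1 m2 m3])
  also have "\<dots> = (?W + ?W) + 2 * (ennreal ?e * ennreal ?H)"
    unfolding refl using gauss[of "b - 1 / 2"] b by simp
  also have "\<dots> = 2 * (?W + ennreal (?e * ?H))"
  proof -
    have "ennreal (?e * ?H) = ennreal ?e * ennreal ?H"
      by (intro ennreal_mult H exp_ge_zero)
    then show ?thesis by (simp only: distrib_left mult_2)
  qed
  finally show ?thesis
    by (subst (asm) ennreal_mult_le_mult_iff) auto
qed

section \<open>From the Hermite weight to the log gas\<close>

definition log_gas_coord :: "real \<Rightarrow> nat \<Rightarrow> (nat \<Rightarrow> real) \<Rightarrow> (nat \<Rightarrow> real) \<Rightarrow> nat \<Rightarrow> real" where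
  "log_gas_coord k N z y = (\<lambda>i\<in>{1..N}. sqrt (2 * k) * z i + sqrt (2 * k) * y i)"

text \<open>Insert the Stieltjes relation for each \<open>z i\<close> and combine the terms of
  \<open>(i, j)\<close> and \<open>(j, i)\<close>. This converts the linear part of the squared norm
  into the linear terms of \<open>u - ln (1 + u)\<close>.\<close>

lemma stieltjes_eq_inner:
  assumes "stieltjes_eq N z"
  shows "(\<Sum>i\<in>{1..N}. z i * y i) = (\<Sum>j\<in>{1..N}. \<Sum>i\<in>{1..<j}. pair_ratio z y i j)"
proof -
  let ?S = "\<Sum>i\<in>{1..N}. \<Sum>j\<in>{1..N}. y i / (z i - z j)"
  have "(\<Sum>i\<in>{1..N}. z i * y i) = ?S"
  proof (intro sum.cong refl)
    fix i assume "i \<in> {1..N}"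
    then have "z i * y i = (\<Sum>j\<in>{1..N}. 1 / (z i - z j)) * y i"
      using assms unfolding stieltjes_eq_def by simp
    then show "z i * y i = (\<Sum>j\<in>{1..N}. y i / (z i - z j))"
      by (simp add: sum_distrib_right)
  qed
  moreover have "?S = (\<Sum>i\<in>{1..N}. \<Sum>j\<in>{1..N}. y j / (z j - z i))"
    by (rule sum.swap)
  moreover have "?S + (\<Sum>i\<in>{1..N}. \<Sum>j\<in>{1..N}. y j / (z j - z i)) = (\<Sum>i\<in>{1..N}. \<Sum>j\<in>{1..N}. pair_ratio z y i j)"
    unfolding sum.distrib[symmetric] pair_ratio_def
  proof (intro sum.cong refl)
    fix i j
    have "y j / (z j - z i) = - (y j / (z i - z j))"
      by (metis minus_diff_eq divide_minus_right)
    then show "y i / (z i - z j) + y j / (z j - z i) = (y i - y j) / (z i - z j)"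
      by (simp add: diff_divide_distrib)
  qed
  moreover have "\<dots> = 2 * (\<Sum>j\<in>{1..N}. \<Sum>i\<in>{1..<j}. pair_ratio z y i j)"
  proof (rule sum_symmetric_off_diag)
    fix i j
    show "pair_ratio z y i j = pair_ratio z y j i"
      unfolding pair_ratio_def by (metis minus_diff_eq minus_divide_divide)
  qed (simp add: pair_ratio_def)
  ultimately show ?thesis by linarith
qed

text \<open>Half the squared norm of \<open>x\<close> is
  \<open>k |z|\<^sup>2 + k |y|\<^sup>2 + 2 k \<langle>z, y\<rangle>\<close>, and each gap is the
  equilibrium gap times \<open>1 + u\<close>. By \<open>stieltjes_eq_inner\<close> the linear and
  logarithmic terms assemble to the potential.\<close>

lemma hermite_weight_log_gas:
  assumes k: "0 < k" and z: "stieltjes_eq N z"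
    and dec: "\<And>i j. 1 \<le> i \<Longrightarrow> i < j \<Longrightarrow> j \<le> N \<Longrightarrow> z j < z i"
  shows "indicator (weyl_chamber_A N) (log_gas_coord k N z y) * hermite_weight k N (log_gas_coord k N z y)
    = exp (- (k * (\<Sum>i\<in>{1..N}. (z i)\<^sup>2))) * (\<Prod>j\<in>{1..N}. \<Prod>i\<in>{1..<j}. (sqrt (2 * k) * (z i - z j)) powr (2 * k))
      * log_gas_weight k N z y"
    (is "indicator _ ?x * _ = _")
proof -
  have diff: "?x i - ?x j = sqrt (2 * k) * (z i - z j) * (1 + pair_ratio z y i j)"
    if "j \<in> {1..N}" "i \<in> {1..<j}" for i j
  proof -
    have "z i - z j \<noteq> 0" using dec[of i j] that by auto
    then have "(z i - z j) * (1 + pair_ratio z y i j) = (z i - z j) + (y i - y j)"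
      by (simp add: pair_ratio_def distrib_left)
    then have "sqrt (2 * k) * ((z i - z j) * (1 + pair_ratio z y i j)) = sqrt (2 * k) * ((z i - z j) + (y i - y j))"
      by (rule arg_cong)
    then show ?thesis using that by (simp add: log_gas_coord_def algebra_simps)
  qed
  have pos: "sqrt (2 * k) * (z i - z j) > 0" if "j \<in> {1..N}" "i \<in> {1..<j}" for i j
    using dec[of i j] that k by auto
  have chamber: "?x \<in> weyl_chamber_A N \<longleftrightarrow> (\<forall>j\<in>{1..N}. \<forall>i\<in>{1..<j}. 0 \<le> 1 + pair_ratio z y i j)"
  proof -
    have "?x \<in> weyl_chamber_A N \<longleftrightarrow> (\<forall>j\<in>{1..N}. \<forall>i\<in>{1..<j}. 0 \<le> ?x i - ?x j)"
    proof
      assume "?x \<in> weyl_chamber_A N"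
      then have "monotone_on {1..N} (\<le>) (\<ge>) ?x" by (simp add: weyl_chamber_A_def)
      then have "?x j \<le> ?x i" if "j \<in> {1..N}" "i \<in> {1..<j}" for i j
        using that by (intro monotone_onD[of "{1..N}" "(\<le>)" "(\<ge>)" ?x i j, simplified]) auto
      then show "\<forall>j\<in>{1..N}. \<forall>i\<in>{1..<j}. 0 \<le> ?x i - ?x j" by simp
    next
      assume *: "\<forall>j\<in>{1..N}. \<forall>i\<in>{1..<j}. 0 \<le> ?x i - ?x j"
      have "?x j \<le> ?x i" if "i \<in> {1..N}" "j \<in> {1..N}" "i \<le> j" for i j
      proof (cases "i = j")
        case False
        then have "i \<in> {1..<j}" using that by auto
        then have "0 \<le> ?x i - ?x j" using * that(2) by blast
        then show ?thesis by simp
      qed simp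
      then have "monotone_on {1..N} (\<le>) (\<ge>) ?x" by (intro monotone_onI) auto
      then show "?x \<in> weyl_chamber_A N"
        by (simp add: weyl_chamber_A_def log_gas_coord_def)
    qed
    also have "\<dots> \<longleftrightarrow> (\<forall>j\<in>{1..N}. \<forall>i\<in>{1..<j}. 0 \<le> 1 + pair_ratio z y i j)"
    proof -
      have gen: "0 \<le> c * t \<longleftrightarrow> 0 \<le> t" if "0 < c" for c t :: real
        using that by (simp add: zero_le_mult_iff)
      show ?thesis
      proof (intro ball_cong refl)
        fix i j assume "j \<in> {1..N}" "i \<in> {1..<j}"
        then show "(0 \<le> ?x i - ?x j) = (0 \<le> 1 + pair_ratio z y i j)"
          using gen[OF pos, of j i] by (simp only: diff)
      qed
    qed
    finally show ?thesis .
  qed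
  show ?thesis
  proof (cases "log_gas_domain N z y")
    case True
    then have u: "0 < 1 + pair_ratio z y i j" if "j \<in> {1..N}" "i \<in> {1..<j}" for i j
      using that unfolding log_gas_domain_def by fastforce
    define Y where "Y = (\<Sum>i\<in>{1..N}. (y i)\<^sup>2)"
    define Z where "Z = (\<Sum>i\<in>{1..N}. (z i)\<^sup>2)"
    define R where "R = (\<Sum>j\<in>{1..N}. \<Sum>i\<in>{1..<j}. pair_ratio z y i j)"
    define T where "T = (\<Sum>j\<in>{1..N}. \<Sum>i\<in>{1..<j}. ln (1 + pair_ratio z y i j))"
    define K where "K = (\<Prod>j\<in>{1..N}. \<Prod>i\<in>{1..<j}. (sqrt (2 * k) * (z i - z j)) powr (2 * k))"
    have x: "?x \<in> weyl_chamber_A N"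
      unfolding chamber using u by (auto intro: less_imp_le)
    have "(\<Prod>j\<in>{1..N}. \<Prod>i\<in>{1..<j}. (?x i - ?x j) powr (2 * k))
      = (\<Prod>j\<in>{1..N}. \<Prod>i\<in>{1..<j}. (sqrt (2 * k) * (z i - z j)) powr (2 * k) * exp (2 * k * ln (1 + pair_ratio z y i j)))"
    proof (intro prod.cong refl)
      fix i j assume ij: "j \<in> {1..N}" "i \<in> {1..<j}"
      show "(?x i - ?x j) powr (2 * k) = (sqrt (2 * k) * (z i - z j)) powr (2 * k) * exp (2 * k * ln (1 + pair_ratio z y i j))"
        unfolding diff[OF ij] using pos[OF ij] u[OF ij]
        by (subst powr_mult) (auto simp: powr_def)
    qed
    also have "\<dots> = K * exp (2 * k * T)"
      by (simp add: K_def T_def prod.distrib exp_sum sum_distrib_left)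
    finally have prod: "(\<Prod>j\<in>{1..N}. \<Prod>i\<in>{1..<j}. (?x i - ?x j) powr (2 * k)) = K * exp (2 * k * T)" .
    have norm: "- (L2_set ?x {1..N})\<^sup>2 / 2 = - (k * Z + k * Y + 2 * k * R)"
    proof -
      have "(L2_set ?x {1..N})\<^sup>2 = (\<Sum>i\<in>{1..N}. (?x i)\<^sup>2)"
        by (simp add: L2_set_def sum_nonneg)
      also have "\<dots> = (\<Sum>i\<in>{1..N}. 2 * k * (z i)\<^sup>2 + 2 * k * (y i)\<^sup>2 + 4 * k * (z i * y i))"
      proof (intro sum.cong refl)
        fix i assume "i \<in> {1..N}"
        then have "(?x i)\<^sup>2 = (sqrt (2 * k))\<^sup>2 * (z i + y i)\<^sup>2"
          unfolding power_mult_distrib[symmetric] by (simp add: log_gas_coord_def distrib_left)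
        also have "(sqrt (2 * k))\<^sup>2 = 2 * k" using k by simp
        finally show "(?x i)\<^sup>2 = 2 * k * (z i)\<^sup>2 + 2 * k * (y i)\<^sup>2 + 4 * k * (z i * y i)"
          by (simp add: power2_sum algebra_simps)
      qed
      also have "\<dots> = 2 * k * Z + 2 * k * Y + 4 * k * (\<Sum>i\<in>{1..N}. z i * y i)"
        by (simp add: sum.distrib sum_distrib_left Y_def Z_def)
      finally show ?thesis unfolding stieltjes_eq_inner[OF z] R_def[symmetric] by simp
    qed
    have "log_gas_weight k N z y = exp (- (k * Y + 2 * k * (R - T)))"
      using True by (simp add: log_gas_weight_def log_gas_potential_def sum_subtractf Y_def R_def T_def)
    moreover have "hermite_weight k N ?x = exp (- (k * Z + k * Y + 2 * k * R)) * (K * exp (2 * k * T))"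
      unfolding hermite_weight_def prod norm ..
    moreover have "exp (- (k * Z + k * Y + 2 * k * R)) * exp (2 * k * T) = exp (- (k * Z)) * exp (- (k * Y + 2 * k * (R - T)))"
      unfolding exp_add[symmetric] by (simp add: algebra_simps)
    ultimately show ?thesis
      unfolding Z_def[symmetric] K_def[symmetric] using x by simp
  next
    case False
    then obtain i j where ij: "j \<in> {1..N}" "i \<in> {1..<j}" "1 + pair_ratio z y i j \<le> 0"
      unfolding log_gas_domain_def by force
    \<comment> \<open>The closed chamber allows \<open>1 + u = 0\<close> while the domain does not.
      A negative value puts \<open>x\<close> outside the chamber; the value zero kills the product
      because \<open>0 powr p = 0\<close>.\<close>
    have "indicator (weyl_chamber_A N) ?x * hermite_weight k N ?x = 0"
    proof (cases "1 + pair_ratio z y i j < 0")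
      case True
      then have "?x \<notin> weyl_chamber_A N" unfolding chamber using ij by force
      then show ?thesis by simp
    next
      case False
      then have "?x i - ?x j = 0" using diff[OF ij(1,2)] ij(3) by simp
      then have "(\<Prod>j\<in>{1..N}. \<Prod>i\<in>{1..<j}. (?x i - ?x j) powr (2 * k)) = 0"
        using ij(1,2) by (intro prod_zero bexI[of _ j] bexI[of _ i]) auto
      then show ?thesis by (simp add: hermite_weight_def)
    qed
    then show ?thesis using False by (simp add: log_gas_weight_def)
  qed
qed

section \<open>Inequalities between products of eigenvalues\<close>

lemma power_mult_prod_le:
  fixes f h :: "nat \<Rightarrow> real"
  assumes "0 < N" "h 0 \<le> f 0" "0 \<le> c" "\<And>m. 0 \<le> h m" "\<And>m. 0 < m \<Longrightarrow> c * h m \<le> f m"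
  shows "c ^ (N - 1) * (\<Prod>m<N. h m) \<le> (\<Prod>m<N. f m)"
proof -
  \<comment> \<open>The factor \<open>m = 0\<close> is compared without loss, since the eigenvalue
    there does not contain the pair coefficient; hence only \<open>N - 1\<close> powers of
    \<open>c\<close>.\<close>
  obtain M where N: "N = Suc M" using assms(1) gr0_implies_Suc by blast
  have "c ^ M * (\<Prod>m<M. h (Suc m)) = (\<Prod>m<M. c * h (Suc m))" by (simp add: prod.distrib)
  also have "\<dots> \<le> (\<Prod>m<M. f (Suc m))"
    using assms by (intro prod_mono) auto
  finally have "h 0 * (c ^ M * (\<Prod>m<M. h (Suc m))) \<le> f 0 * (\<Prod>m<M. f (Suc m))"
    using assms(2,3,4) by (intro mult_mono) (auto intro!: mult_nonneg_nonneg prod_nonneg intro: order_trans[OF assms(4)])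
  then show ?thesis unfolding N prod.lessThan_Suc_shift by (simp add: mult_ac)
qed

text \<open>Equality for two factors; each further factor on the right exceeds its share by
  \<open>\<eta>\<close>. It bounds \<open>N!\<close> over the rising factorial of
  \<open>\<eta>\<close> by \<open>N / (\<eta> * (1 + \<eta>))\<close>.\<close>

lemma rising_factorial_ratio:
  fixes \<eta> :: real
  assumes "0 < \<eta>"
  shows "\<eta> * (1 + \<eta>) * (\<Prod>m<M + 2. 1 + real m) \<le> real (M + 2) * (\<Prod>m<M + 2. \<eta> + real m)"
proof (induction M)
  case 0
  show ?case by (simp add: numeral_2_eq_2 algebra_simps)
next
  case (Suc M)
  have pos: "0 \<le> (\<Prod>m<M + 2. \<eta> + real m)" using assms by (intro prod_nonneg) auto
  have "\<eta> * (1 + \<eta>) * (\<Prod>m<Suc M + 2. 1 + real m) = (\<eta> * (1 + \<eta>) * (\<Prod>m<M + 2. 1 + real m)) * real (Suc M + 2)"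
    by (simp add: mult_ac)
  also have "\<dots> \<le> (real (M + 2) * (\<Prod>m<M + 2. \<eta> + real m)) * real (Suc M + 2)"
    using Suc by (intro mult_right_mono) auto
  also have "\<dots> = ((\<Prod>m<M + 2. \<eta> + real m) * real (M + 2)) * real (Suc M + 2)"
    by (simp only: mult.commute)
  also have "\<dots> \<le> ((\<Prod>m<M + 2. \<eta> + real m) * (\<eta> + real (M + 2))) * real (Suc M + 2)"
    using pos assms by (intro mult_right_mono mult_left_mono) auto
  also have "\<dots> = real (Suc M + 2) * (\<Prod>m<Suc M + 2. \<eta> + real m)"
    by (simp add: mult_ac)
  finally show ?case .
qed

section \<open>The tail bound\<close>

lemma sqrt_prod_lower_ratio:
  fixes f h :: "nat \<Rightarrow> real"
  assumes "c ^ (N - 1) * (\<Prod>m<N. h m) \<le> (\<Prod>m<N. f m)" "0 < (\<Prod>m<N. h m)" "0 < c"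
  shows "1 / sqrt (\<Prod>m<N. f m) \<le> sqrt ((1 / c) ^ (N - 1)) / sqrt (\<Prod>m<N. h m)"
proof -
  have "0 < sqrt (c ^ (N - 1) * (\<Prod>m<N. h m))" using assms by simp
  then have "1 / sqrt (\<Prod>m<N. f m) \<le> 1 / sqrt (c ^ (N - 1) * (\<Prod>m<N. h m))"
    using assms(1) by (intro divide_left_mono real_sqrt_le_mono mult_pos_pos) auto
  also have "\<dots> = sqrt ((1 / c) ^ (N - 1)) / sqrt (\<Prod>m<N. h m)"
    by (simp add: real_sqrt_mult real_sqrt_divide power_one_over)
  finally show ?thesis .
qed

text \<open>The base is \<open>1 + t\<close> with \<open>t = 1 / (3 N - 1)\<close>, so the power is
  at most \<open>exp ((N - 1) t) \<le> exp (1 / 3)\<close>.\<close>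

lemma power_one_over_le:
  assumes "2 \<le> N"
  shows "sqrt ((1 / (1 - 1 / (3 * real N))) ^ (N - 1)) \<le> 1182 / 1000"
proof -
  define t where "t = 1 / (3 * real N - 1)"
  have N: "real N \<ge> 2" using assms by simp
  have t: "0 \<le> t" "1 / (1 - 1 / (3 * real N)) = 1 + t"
    using N by (simp_all add: t_def field_simps)
  have "real (N - 1) * t \<le> 1 / 3"
    using N assms by (simp add: t_def of_nat_diff field_simps)
  have "(1 + t) ^ (N - 1) \<le> exp t ^ (N - 1)"
    using t exp_ge_add_one_self[of t] by (intro power_mono) auto
  also have "\<dots> = exp (real (N - 1) * t)" by (rule exp_of_nat_mult[symmetric])
  also have "\<dots> \<le> exp (1 / 3)" using \<open>real (N - 1) * t \<le> 1 / 3\<close> by simp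
  also have "\<dots> \<le> (1182 / 1000)\<^sup>2"
  \<comment> \<open>Cubing reduces the claim to \<open>e < 2.72\<close>; the sixth power of
    \<open>1.182\<close> is about \<open>2.727\<close>.\<close>
  proof (rule power_le_imp_le_base[of _ 2])
    have "exp (1 / 3) ^ 3 = exp (1::real)"
      by (simp add: exp_of_nat_mult[symmetric])
    also have "\<dots> \<le> ((1182 / 1000)\<^sup>2) ^ 3"
      using e_less_272 by (simp add: power_divide)
    finally show "exp (1 / 3 :: real) ^ Suc 2 \<le> ((1182 / 1000)\<^sup>2) ^ Suc 2" by (simp add: numeral_3_eq_3 numeral_2_eq_2)
  qed simp
  finally show ?thesis
    unfolding t(2) by (intro real_le_lsqrt) (use t in auto)
qed

text \<open>\<open>U\<close> bounds the tilted integral above and \<open>V\<close> the total mass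
  below. Both are compared with the unperturbed Gaussians (\<open>D\<close> with the tilt,
  \<open>D1\<close> without): \<open>U \<le> 1.2445 g / D\<close> and
  \<open>V \<ge> 0.93675 g / D1\<close>, a loss below \<open>4 / 3\<close>. The choice
  \<open>\<eta> = 1 / s\<close> minimizes \<open>exp (\<eta> s / 2) / sqrt \<eta>\<close>, and
  \<open>B\<close> of order \<open>1 / N\<close> keeps the \<open>(N - 1)\<close>-st power of
  \<open>1 / a\<close> bounded.\<close>

lemma log_gas_tail_constant:
  fixes N :: nat and k s :: real
  assumes N: "2 \<le> N" and s: "3 < s" and k: "23 * real N ^ 3 \<le> k"
  defines "\<eta> \<equiv> 1 / s" and "B \<equiv> 1 / (2 * real N)"
  defines "a \<equiv> 1 - 2 * B / 3" and "b \<equiv> 1 / (1 - B\<^sup>2)"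
  defines "U \<equiv> sqrt (pi / k) ^ N / sqrt (\<Prod>m<N. \<eta> + a * real m)
      + exp (- (k * B\<^sup>2 * (a / 2 - a\<^sup>2 / 16))) * ((4 * sqrt N / (k * a * B)) ^ N / sqrt (\<Prod>m<N. \<eta> + real m))"
    and "V \<equiv> sqrt (pi / k) ^ N / sqrt (\<Prod>m<N. 1 + b * real m)
      - exp (- (k * B\<^sup>2 / 2)) * (sqrt (pi / k) ^ N / sqrt (\<Prod>m<N. 1 + (b - 1 / 2) * real m))"
  shows "0 < V" "exp (- ((1 - \<eta>) * (s / 2))) * U \<le> sqrt (exp 1) * sqrt N / 2 * (s + 1) * exp (- (s / 2)) * V"
proof -
  have N2: "real N \<ge> 2" using N by simp
  have k0: "0 < k"
    using k N2 by (intro less_le_trans[OF _ k]) auto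
  have \<eta>: "0 < \<eta>" "\<eta> < 1" using s by (auto simp: \<eta>_def)
  have B: "0 < B" "B \<le> 1 / 4" using N2 by (auto simp: B_def field_simps)
  have B2: "B\<^sup>2 \<le> 1 / 16" using B power_mono[of B "1 / 4" 2] by (simp add: power_divide)
  have a_eq: "a = 1 - 1 / (3 * real N)" by (simp add: a_def B_def)
  have a: "5 / 6 \<le> a" "a \<le> 1" using B by (auto simp: a_def)
  have b: "1 \<le> b" using B2 B by (simp add: b_def)
  \<comment> \<open>The cubic growth of \<open>k\<close> enters here: the exponential penalties
    decay geometrically in \<open>N\<close> and can beat factors of the form
    \<open>c ^ N\<close>.\<close>
  have kB: "23 / 4 * real N \<le> k * B\<^sup>2"
  proof -
    have "23 / 4 * real N = 23 * real N ^ 3 * B\<^sup>2"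
      using N2 by (simp add: B_def power2_eq_square power3_eq_cube field_simps)
    also have "\<dots> \<le> k * B\<^sup>2" using k by (intro mult_right_mono) auto
    finally show ?thesis .
  qed
  define g where "g = sqrt (pi / k) ^ N"
  have g: "0 < g" using k0 by (simp add: g_def)
  define D where "D = sqrt (\<Prod>m<N. \<eta> + real m)"
  define D1 where "D1 = sqrt (\<Prod>m<N. 1 + real m)"
  have Dp: "0 < (\<Prod>m<N. \<eta> + real m)" "0 < (\<Prod>m<N. 1 + real m)"
    using \<eta> by (auto intro!: prod_pos add_pos_nonneg)
  then have D: "0 < D" "0 < D1" by (auto simp: D_def D1_def)

  have "1 / sqrt (\<Prod>m<N. \<eta> + a * real m) \<le> sqrt ((1 / a) ^ (N - 1)) / D"
    unfolding D_def
  proof (rule sqrt_prod_lower_ratio[OF power_mult_prod_le Dp(1)])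
    show "a * (\<eta> + real m) \<le> \<eta> + a * real m" for m
      using a \<eta> by (simp add: algebra_simps)
  qed (use N a \<eta> in auto)
  also have "\<dots> \<le> (1182 / 1000) / D"
    using power_one_over_le[OF N] D unfolding a_eq by (intro divide_right_mono) auto
  finally have U1: "1 / sqrt (\<Prod>m<N. \<eta> + a * real m) \<le> (1182 / 1000) / D" .

  \<comment> \<open>From \<open>a\<^sup>2 \<le> a\<close> and \<open>a \<ge> 5 / 6\<close> the
    coefficient is at least \<open>7 a / 16 \<ge> 35 / 96\<close>, so the penalty is at most
    \<open>exp (- 2 N) \<le> (1 / 5) ^ N\<close>. The other base is at most \<open>1.2\<close> times
    the Gaussian one, and \<open>0.24 ^ N \<le> 1 / 16\<close>.\<close>
  have U2: "exp (- (k * B\<^sup>2 * (a / 2 - a\<^sup>2 / 16))) * (4 * sqrt N / (k * a * B)) ^ N \<le> g * (1 / 16)"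
  proof -
    have "a * a \<le> a * 1" using a by (intro mult_left_mono) auto
    then have "a\<^sup>2 \<le> a" by (simp only: power2_eq_square mult_1_right)
    then have "35 / 96 \<le> a / 2 - a\<^sup>2 / 16" using a by linarith
    then have "(23 / 4 * real N) * (35 / 96) \<le> k * B\<^sup>2 * (a / 2 - a\<^sup>2 / 16)"
      using k0 by (intro mult_mono[OF kB]) auto
    then have "2 * real N \<le> k * B\<^sup>2 * (a / 2 - a\<^sup>2 / 16)" using N2 by simp
    then have "exp (- (k * B\<^sup>2 * (a / 2 - a\<^sup>2 / 16))) \<le> exp (real N * (- 2))" by simp
    also have "\<dots> = exp (- 2) ^ N" by (rule exp_of_nat_mult)
    also have "\<dots> \<le> (1 / 5) ^ N"
    proof (rule power_mono)
      have "5 \<le> exp (2::real)" using exp_lower_Taylor_quadratic[of 2] by simp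
      then show "exp (- 2) \<le> (1 / 5 :: real)" by (simp add: exp_minus field_simps)
    qed simp
    finally have e: "exp (- (k * B\<^sup>2 * (a / 2 - a\<^sup>2 / 16))) \<le> (1 / 5) ^ N" .
    have "4 * sqrt N / (k * a * B) \<le> 12 / 10 * sqrt (pi / k)"
    proof (rule power2_le_imp_le)
      have "real N * 16 * 36 \<le> 36 / 25 * 25 * 3 * (23 / 4 * real N)" by simp
      also have "\<dots> \<le> 36 / 25 * 25 * pi * (k * B\<^sup>2)"
        using pi_gt3 k0 by (intro mult_mono[OF _ kB]) auto
      also have "\<dots> = 36 / 25 * pi * k * B\<^sup>2 * 36 * (25 / 36)" by simp
      also have "\<dots> \<le> 36 / 25 * pi * k * B\<^sup>2 * 36 * a\<^sup>2"
        using a k0 power_mono[of "5 / 6" a 2] by (intro mult_left_mono) (auto simp: power_divide)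
      finally have "real N * 16 \<le> 36 / 25 * pi * k * B\<^sup>2 * a\<^sup>2" by simp
      then have "real N * 16 / (k * a * B)\<^sup>2 \<le> 36 / 25 * pi * k * B\<^sup>2 * a\<^sup>2 / (k * a * B)\<^sup>2"
        by (intro divide_right_mono) auto
      also have "\<dots> = 36 / 25 * (pi / k)"
        using k0 a B by (simp add: power_mult_distrib power2_eq_square field_simps)
      also have "real N * 16 / (k * a * B)\<^sup>2 = (4 * sqrt N / (k * a * B))\<^sup>2"
        by (simp add: power_mult_distrib power_divide)
      also have "36 / 25 * (pi / k) = (12 / 10 * sqrt (pi / k))\<^sup>2"
        using k0 by (simp add: power_mult_distrib power2_eq_square)
      finally show "(4 * sqrt N / (k * a * B))\<^sup>2 \<le> (12 / 10 * sqrt (pi / k))\<^sup>2" .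
    qed (use k0 in simp)
    then have "(4 * sqrt N / (k * a * B)) ^ N \<le> (12 / 10 * sqrt (pi / k)) ^ N"
      using k0 a B by (intro power_mono) auto
    then have "exp (- (k * B\<^sup>2 * (a / 2 - a\<^sup>2 / 16))) * (4 * sqrt N / (k * a * B)) ^ N
        \<le> (1 / 5) ^ N * (12 / 10 * sqrt (pi / k)) ^ N"
      using k0 a B by (intro mult_mono e) auto
    also have "\<dots> = g * (6 / 25) ^ N"
    proof -
      have "(1 / 5) ^ N * (12 / 10 * sqrt (pi / k)) ^ N = (1 / 5 * (12 / 10 * sqrt (pi / k))) ^ N"
        by (rule power_mult_distrib[symmetric])
      also have "1 / 5 * (12 / 10 * sqrt (pi / k)) = sqrt (pi / k) * (6 / 25)" by simp
      finally show ?thesis by (simp only: g_def power_mult_distrib)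
    qed
    also have "\<dots> \<le> g * (1 / 16)"
    proof (rule mult_left_mono)
      have "(6 / 25 :: real) ^ N \<le> (6 / 25) ^ 2"
        using N by (intro power_decreasing) auto
      also have "\<dots> \<le> 1 / 16" by (simp add: power_divide)
      finally show "(6 / 25 :: real) ^ N \<le> 1 / 16" .
    qed (use g in simp)
    finally show ?thesis .
  qed
  have U: "U \<le> g / D * (1182 / 1000 + 1 / 16)"
  proof -
    have "g * (1 / sqrt (\<Prod>m<N. \<eta> + a * real m)) \<le> g * ((1182 / 1000) / D)"
      using U1 g by (intro mult_left_mono) auto
    moreover have "(exp (- (k * B\<^sup>2 * (a / 2 - a\<^sup>2 / 16))) * (4 * sqrt N / (k * a * B)) ^ N) / D \<le> (g * (1 / 16)) / D"
      using U2 D by (intro divide_right_mono) auto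
    ultimately show ?thesis
      unfolding U_def g_def[symmetric] D_def[symmetric] by (simp add: algebra_simps)
  qed

  \<comment> \<open>Since \<open>(1 - B\<^sup>2) * b = 1\<close>, replacing \<open>b\<close> by 1
    costs the power \<open>(1 - B\<^sup>2) ^ (N - 1)\<close>, which Bernoulli bounds below by
    \<open>15 / 16\<close>, just above the square of \<open>0.968\<close>.\<close>
  have V1: "(968 / 1000) / D1 \<le> 1 / sqrt (\<Prod>m<N. 1 + b * real m)"
  proof -
    have "(1 - B\<^sup>2) ^ (N - 1) * (\<Prod>m<N. 1 + b * real m) \<le> (\<Prod>m<N. 1 + real m)"
    proof (rule power_mult_prod_le)
      fix m
      have "(1 - B\<^sup>2) * b = 1" using B2 by (simp add: b_def)
      then have "(1 - B\<^sup>2) * (1 + b * real m) = (1 - B\<^sup>2) + real m"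
        by (simp add: distrib_left mult.assoc[symmetric])
      then show "(1 - B\<^sup>2) * (1 + b * real m) \<le> 1 + real m" by simp
    qed (use N B2 b in \<open>auto intro!: add_nonneg_nonneg\<close>)
    moreover have "(968 / 1000)\<^sup>2 \<le> (1 - B\<^sup>2) ^ (N - 1)"
    proof -
      have "(real N - 1) * B\<^sup>2 \<le> 1 / 16"
      proof -
        have "0 \<le> (real N - 2)\<^sup>2" by simp
        then have "(real N - 1) * 16 \<le> (2 * real N)\<^sup>2" by (simp add: power2_eq_square algebra_simps)
        then show ?thesis using N2 by (simp add: B_def power_divide divide_le_eq)
      qed
      then have "15 / 16 \<le> 1 + real (N - 1) * (- B\<^sup>2)" using N by (simp add: of_nat_diff)
      also have "\<dots> \<le> (1 + - B\<^sup>2) ^ (N - 1)"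
        using B2 by (intro Bernoulli_inequality) auto
      finally show ?thesis by (simp add: power_divide)
    qed
    moreover have pb: "0 < (\<Prod>m<N. 1 + b * real m)"
      using b by (intro prod_pos) (auto intro!: add_pos_nonneg)
    ultimately have "(968 / 1000)\<^sup>2 * (\<Prod>m<N. 1 + b * real m) \<le> (\<Prod>m<N. 1 + real m)"
      by (meson less_imp_le mult_right_mono order_trans)
    then have "sqrt ((968 / 1000)\<^sup>2 * (\<Prod>m<N. 1 + b * real m)) \<le> D1"
      unfolding D1_def by (rule real_sqrt_le_mono)
    then have "(968 / 1000) * sqrt (\<Prod>m<N. 1 + b * real m) \<le> D1"
      by (simp add: real_sqrt_mult)
    then show ?thesis using D pb by (simp add: field_simps)
  qed
  \<comment> \<open>As \<open>b - 1 / 2 \<ge> 1 / 2\<close>, the determinant loses at most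
    \<open>2 ^ (N - 1)\<close>, while the penalty is at most \<open>8 ^ (- N)\<close>; together
    \<open>4 ^ (- N) / 2 \<le> 1 / 32\<close>.\<close>
  have V2: "exp (- (k * B\<^sup>2 / 2)) * (1 / sqrt (\<Prod>m<N. 1 + (b - 1 / 2) * real m)) \<le> (1 / 32) / D1"
  proof -
    have "1 / sqrt (\<Prod>m<N. 1 + (b - 1 / 2) * real m) \<le> sqrt ((1 / (1 / 2)) ^ (N - 1)) / D1"
      unfolding D1_def
    proof (rule sqrt_prod_lower_ratio[OF power_mult_prod_le Dp(2)])
      fix m
      have "1 / 2 * real m \<le> (b - 1 / 2) * real m" using b by (intro mult_right_mono) auto
      then show "1 / 2 * (1 + real m) \<le> 1 + (b - 1 / 2) * real m" by simp
    qed (use N in auto)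
    moreover have "exp (- (k * B\<^sup>2 / 2)) \<le> (1 / 8) ^ N"
    proof -
      have "exp (- (k * B\<^sup>2 / 2)) \<le> exp (real N * (- (23 / 8)))" using kB by simp
      also have "\<dots> = exp (- (23 / 8)) ^ N" by (rule exp_of_nat_mult)
      also have "\<dots> \<le> (1 / 8) ^ N"
      proof (rule power_mono)
        have "8 \<le> exp (23 / 8 :: real)"
          using exp_lower_Taylor_quadratic[of "23 / 8"] by (simp add: power_divide)
        then show "exp (- (23 / 8)) \<le> (1 / 8 :: real)" by (simp add: exp_minus field_simps)
      qed simp
      finally show ?thesis .
    qed
    ultimately have "exp (- (k * B\<^sup>2 / 2)) * (1 / sqrt (\<Prod>m<N. 1 + (b - 1 / 2) * real m))
       \<le> (1 / 8) ^ N * (sqrt ((1 / (1 / 2)) ^ (N - 1)) / D1)"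
      using b by (intro mult_mono) (auto intro!: prod_nonneg add_nonneg_nonneg)
    also have "\<dots> \<le> (1 / 8) ^ N * (2 ^ (N - 1) / D1)"
    proof -
      have "1 \<le> (2::real) ^ (N - 1)" by simp
      then have "sqrt (2 ^ (N - 1)) \<le> (2::real) ^ (N - 1)"
        by (intro real_le_lsqrt) (auto simp: power2_eq_square)
      then show ?thesis using D by (intro mult_left_mono divide_right_mono) auto
    qed
    also have "\<dots> = (1 / 8) ^ N * 2 ^ (N - 1) / D1" by simp
    also have "\<dots> \<le> (1 / 32) / D1"
    proof (rule divide_right_mono)
      have "(1 / 8 :: real) ^ N * 2 ^ (N - 1) = (1 / 4) ^ N / 2"
      proof -
        obtain M where "N = Suc M" using N by (cases N) auto
        then show ?thesis
          using power_mult_distrib[of "1 / 8 :: real" 2 M] by simp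
      qed
      also have "(1 / 4 :: real) ^ N \<le> (1 / 4) ^ 2"
        using N by (intro power_decreasing) auto
      then have "(1 / 4 :: real) ^ N / 2 \<le> 1 / 32" by (simp add: power_divide)
      finally show "(1 / 8 :: real) ^ N * 2 ^ (N - 1) \<le> 1 / 32" .
    qed (use D in simp)
    finally show ?thesis .
  qed
  have V: "g / D1 * (968 / 1000 - 1 / 32) \<le> V"
  proof -
    have "g * ((968 / 1000) / D1) \<le> g * (1 / sqrt (\<Prod>m<N. 1 + b * real m))"
      using V1 g by (intro mult_left_mono) auto
    moreover have "g * (exp (- (k * B\<^sup>2 / 2)) * (1 / sqrt (\<Prod>m<N. 1 + (b - 1 / 2) * real m))) \<le> g * ((1 / 32) / D1)"
      using V2 g by (intro mult_left_mono) auto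
    ultimately show ?thesis
      unfolding V_def g_def[symmetric] by (simp add: algebra_simps)
  qed
  have "0 < g / D1 * (968 / 1000 - 1 / 32)" using g D by simp
  then show V0: "0 < V" using V by linarith

  \<comment> \<open>With \<open>\<eta> = 1 / s\<close> the factor
    \<open>\<eta> * (1 + \<eta>)\<close> is \<open>(s + 1) / s\<^sup>2\<close>.\<close>
  have ratio: "D1 / D \<le> sqrt N * (s / sqrt (s + 1))"
  proof -
    obtain M where M: "N = M + 2" using N by (metis add.commute le_Suc_ex)
    have "\<eta> * (1 + \<eta>) * (\<Prod>m<N. 1 + real m) \<le> real N * (\<Prod>m<N. \<eta> + real m)"
      unfolding M by (rule rising_factorial_ratio[OF \<eta>(1)])
    also have "\<eta> * (1 + \<eta>) = (s + 1) / s\<^sup>2"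
      using s by (simp add: \<eta>_def power2_eq_square field_simps)
    finally have "(\<Prod>m<N. 1 + real m) \<le> real N * (s\<^sup>2 / (s + 1)) * (\<Prod>m<N. \<eta> + real m)"
      using s by (simp add: field_simps)
    then have "D1 \<le> sqrt (real N * (s\<^sup>2 / (s + 1)) * (\<Prod>m<N. \<eta> + real m))"
      unfolding D1_def by (rule real_sqrt_le_mono)
    also have "\<dots> = sqrt N * (s / sqrt (s + 1)) * D"
      using s by (simp add: D_def real_sqrt_mult real_sqrt_divide)
    finally show ?thesis using D by (simp add: divide_le_eq)
  qed
  have "U \<le> 4 / 3 * (D1 / D) * V"
  proof -
    have "U \<le> g / D * (4 / 3 * (968 / 1000 - 1 / 32))"
      using g D by (intro order_trans[OF U] mult_left_mono) auto
    also have "\<dots> = 4 / 3 * (D1 / D) * (g / D1 * (968 / 1000 - 1 / 32))"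
      using D by simp
    also have "\<dots> \<le> 4 / 3 * (D1 / D) * V"
      using V D by (intro mult_left_mono) auto
    finally show ?thesis .
  qed
  also have "\<dots> \<le> 4 / 3 * (sqrt N * (s / sqrt (s + 1))) * V"
    using ratio V0 by (intro mult_right_mono mult_left_mono) auto
  also have "\<dots> \<le> sqrt N / 2 * (s + 1) * V"
  proof -
    \<comment> \<open>Equality at \<open>s = 3\<close>: the constant \<open>4 / 3\<close> is the largest affordable one.\<close>
    have "8 * s \<le> 3 * ((s + 1) * sqrt (s + 1))"
    proof (rule power2_le_imp_le)
      have "0 \<le> (s - 3) * (9 * s\<^sup>2 - 10 * s - 3)"
      proof (rule mult_nonneg_nonneg)
        have "3 * s \<le> s * s" using s by (intro mult_right_mono) auto
        then have "3 * s \<le> s\<^sup>2" by (simp only: power2_eq_square)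
        then show "0 \<le> 9 * s\<^sup>2 - 10 * s - 3" using s by linarith
      qed (use s in simp)
      then have "64 * s\<^sup>2 \<le> 9 * (s + 1)\<^sup>2 * (s + 1)"
        by (simp add: power2_eq_square algebra_simps)
      then show "(8 * s)\<^sup>2 \<le> (3 * ((s + 1) * sqrt (s + 1)))\<^sup>2"
        using s by (simp add: power_mult_distrib)
    qed (use s in simp)
    then have "4 / 3 * (s / sqrt (s + 1)) \<le> 1 / 2 * (s + 1)"
      using s by (simp add: field_simps)
    then have "sqrt N * (4 / 3 * (s / sqrt (s + 1))) * V \<le> sqrt N * (1 / 2 * (s + 1)) * V"
      using V0 by (intro mult_right_mono mult_left_mono) auto
    then show ?thesis by (simp add: mult_ac)
  qed
  finally have UV: "U \<le> sqrt N / 2 * (s + 1) * V" .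
  \<comment> \<open>The factor \<open>sqrt e\<close> of the bound comes from
    \<open>\<eta> * s = 1\<close>.\<close>
  have "exp (- ((1 - \<eta>) * (s / 2))) = sqrt (exp 1) * exp (- (s / 2))"
  proof -
    have "sqrt (exp 1) = exp (1 / 2)"
      by (rule real_sqrt_unique) (simp_all add: exp_double[symmetric])
    moreover have "- ((1 - \<eta>) * (s / 2)) = 1 / 2 + - (s / 2)"
      using s by (simp add: \<eta>_def field_simps)
    ultimately show ?thesis by (simp only: exp_add)
  qed
  then show "exp (- ((1 - \<eta>) * (s / 2))) * U \<le> sqrt (exp 1) * sqrt N / 2 * (s + 1) * exp (- (s / 2)) * V"
    using mult_left_mono[OF UV, of "sqrt (exp 1) * exp (- (s / 2))"] by (simp add: mult_ac)
qed

text \<open>After the substitution the probability is a quotient of two log-gas integrals.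
  Chernoff's inequality and \<open>nn_integral_log_gas_weight_le\<close> bound the numerator,
  \<open>nn_integral_log_gas_weight_ge\<close> the denominator, and
  \<open>log_gas_tail_constant\<close> their quotient.\<close>

lemma hermite_ensemble_tail:
  fixes M :: "'a measure" and X :: "'a \<Rightarrow> nat \<Rightarrow> real" and N :: nat and k \<epsilon> :: real
  assumes "prob_space M" "hermite_ensemble M X k N"
    and N: "2 \<le> N" and k: "23 * real N ^ 3 \<le> k" and \<epsilon>: "0 < \<epsilon>" "3 < 2 * k * \<epsilon>\<^sup>2"
  shows "measure M {\<omega> \<in> space M. L2_set (\<lambda>i. X \<omega> i / sqrt (2 * k) - hermite_zeros N i) {1..N} > \<epsilon>}
    \<le> sqrt (exp 1) * sqrt N / 2 * (2 * k * \<epsilon>\<^sup>2 + 1) * exp (- (k * \<epsilon>\<^sup>2))"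
proof -
  interpret prob_space M by fact
  let ?z = "hermite_zeros N" and ?RN = "lebesgue_RN N"
  define s where "s = 2 * k * \<epsilon>\<^sup>2"
  define \<eta> where "\<eta> = 1 / s"
  define B where "B = 1 / (2 * real N)"
  define T where "T = sqrt (exp 1) * sqrt N / 2 * (s + 1) * exp (- (s / 2))"
  have N2: "real N \<ge> 2" using N by simp
  have k0: "0 < k" using k N2 by (intro less_le_trans[OF _ k]) auto
  have s: "3 < s" using \<epsilon> by (simp add: s_def)
  have \<eta>: "0 < \<eta>" "\<eta> < 1" using s by (auto simp: \<eta>_def)
  have B: "0 < B" "B < 1" using N2 by (auto simp: B_def field_simps)
  have T: "0 \<le> T" using s by (simp add: T_def)
  note z = stieltjes_eq_hermite_zeros[of N] inj_on_hermite_zeros[of N]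
  have N0: "0 < N" using N by simp
  have B1: "B \<le> 1" using B by simp
  have sq: "0 < sqrt (2 * k)" using k0 by simp
  note const = log_gas_tail_constant[OF N s k, folded \<eta>_def B_def T_def]
  note upper = nn_integral_log_gas_weight_le[OF k0 B(1) B1 \<eta>(1) N0 z]
  note lower = nn_integral_log_gas_weight_ge[OF k0 B z]
  define W where "W = (\<integral>\<^sup>+y. ennreal (log_gas_weight k N ?z y) \<partial>?RN)"
  define f where "f = (\<lambda>x. indicator (weyl_chamber_A N) x * hermite_weight k N x)"
  define K where "K = exp (- (k * (\<Sum>i\<in>{1..N}. (?z i)\<^sup>2))) * (\<Prod>j\<in>{1..N}. \<Prod>i\<in>{1..<j}. (sqrt (2 * k) * (?z i - ?z j)) powr (2 * k))"
  have K: "0 \<le> K" unfolding K_def by (intro mult_nonneg_nonneg prod_nonneg) auto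
  have fK: "f (log_gas_coord k N ?z y) = K * log_gas_weight k N ?z y" for y
    unfolding f_def K_def
    by (rule hermite_weight_log_gas[OF k0 z(1)]) (rule hermite_zeros_props(2))
  define A where "A = {x. L2_set (\<lambda>i. x i / sqrt (2 * k) - ?z i) {1..N} > \<epsilon>}"
  have A_coord: "log_gas_coord k N ?z y \<in> A \<longleftrightarrow> L2_set y {1..N} > \<epsilon>" for y
  proof -
    have "L2_set (\<lambda>i. log_gas_coord k N ?z y i / sqrt (2 * k) - ?z i) {1..N} = L2_set y {1..N}"
      using sq by (intro L2_set_cong refl) (simp add: log_gas_coord_def add_divide_distrib)
    then show ?thesis by (simp add: A_def)
  qed
  have dist: "distributed M ?RN X (\<lambda>x. ennreal (hermite_const k N * f x))"
    using assms(2) unfolding hermite_ensemble_def hermite_density_def f_def by (simp add: mult_ac)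
  note dm = distributed_borel_measurable[OF dist]
  define C where "C = hermite_const k N"
  have L2m: "(\<lambda>x. L2_set (\<lambda>i. x i / sqrt (2 * k) - ?z i) {1..N}) \<in> borel_measurable ?RN"
    unfolding L2_set_def by measurable
  have Am: "A \<inter> space ?RN \<in> sets ?RN"
    using borel_measurable_less[OF borel_measurable_const[of \<epsilon>] L2m]
    by (simp add: A_def pred_def Int_def conj_commute)
  \<comment> \<open>Jacobian of \<open>log_gas_coord\<close> times the constants of the density. It
    is eliminated by \<open>\<gamma> * W = 1\<close>, the statement that the total mass is
    one.\<close>
  define \<gamma> where "\<gamma> = ennreal (sqrt (2 * k) ^ N) * ennreal (C * K)"
  have change: "(\<integral>\<^sup>+x. ennreal (C * f x) * indicator S x \<partial>?RN)
      = ennreal (sqrt (2 * k) ^ N) * (\<integral>\<^sup>+y. ennreal (C * (K * log_gas_weight k N ?z y)) * indicator S (log_gas_coord k N ?z y) \<partial>?RN)"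
    if S: "S \<inter> space ?RN \<in> sets ?RN" for S
  proof -
    have ind: "(indicator S :: _ \<Rightarrow> ennreal) \<in> borel_measurable ?RN"
      using S by (subst borel_measurable_indicator_iff) (simp add: Int_commute)
    have m: "(\<lambda>x. ennreal (C * f x) * indicator S x) \<in> borel_measurable ?RN"
      using dm ind unfolding C_def by (rule borel_measurable_times_ennreal)
    from nn_integral_triangular[OF m, of "sqrt (2 * k)" "\<lambda>i. sqrt (2 * k) * ?z i" "\<lambda>_ _. 0"] sq
    have "ennreal (sqrt (2 * k) ^ N) * (\<integral>\<^sup>+y. ennreal (C * f (log_gas_coord k N ?z y)) * indicator S (log_gas_coord k N ?z y) \<partial>?RN)
      = (\<integral>\<^sup>+x. ennreal (C * f x) * indicator S x \<partial>?RN)"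
      by (simp add: log_gas_coord_def)
    then show ?thesis by (simp only: fK)
  qed
  have total: "\<gamma> * W = 1"
    and event: "emeasure M {\<omega> \<in> space M. L2_set (\<lambda>i. X \<omega> i / sqrt (2 * k) - ?z i) {1..N} > \<epsilon>}
      = \<gamma> * (\<integral>\<^sup>+y. ennreal (log_gas_weight k N ?z y) * indicator {y. L2_set y {1..N} > \<epsilon>} y \<partial>?RN)"
  proof -
    have 1: "1 = (\<integral>\<^sup>+x. ennreal (C * f x) * indicator UNIV x \<partial>?RN)"
      using distributed_emeasure[OF dist sets.top] emeasure_space_1 distributed_measurable[OF dist]
      by (simp add: C_def measurable_space Int_absorb1 subset_eq cong: nn_integral_cong_simp)
    \<comment> \<open>\<open>ennreal\<close> sends negative reals to 0, so a negative constant would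
      give total mass 0.\<close>
    have C: "0 \<le> C"
    proof (rule ccontr)
      assume "\<not> 0 \<le> C"
      then have "C * f x \<le> 0" for x
        unfolding f_def hermite_weight_def
        by (intro mult_nonpos_nonneg) (auto intro!: mult_nonneg_nonneg prod_nonneg)
      then show False using 1 by (simp add: ennreal_neg)
    qed
    have split: "ennreal (C * (K * w)) = ennreal (C * K) * ennreal w" for w
      using C K by (simp add: ennreal_mult'[symmetric] mult.assoc)
    have wm: "(\<lambda>y. ennreal (log_gas_weight k N ?z y)) \<in> borel_measurable ?RN" by measurable
    have "(\<integral>\<^sup>+x. ennreal (C * f x) * indicator UNIV x \<partial>?RN)
      = ennreal (sqrt (2 * k) ^ N) * (\<integral>\<^sup>+y. ennreal (C * K) * ennreal (log_gas_weight k N ?z y) \<partial>?RN)"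
      by (subst change) (auto simp: split)
    also have "\<dots> = \<gamma> * W"
      unfolding W_def \<gamma>_def by (subst nn_integral_cmult[OF wm]) (simp add: mult.assoc)
    finally show "\<gamma> * W = 1" using 1 by simp
    have L2y: "(\<lambda>y. L2_set y {1..N}) \<in> borel_measurable ?RN"
      unfolding L2_set_def by measurable
    have "{y. L2_set y {1..N} > \<epsilon>} \<inter> space ?RN \<in> sets ?RN"
      using borel_measurable_less[OF borel_measurable_const[of \<epsilon>] L2y]
      by (simp add: pred_def Int_def conj_commute)
    then have "(indicator {y. L2_set y {1..N} > \<epsilon>} :: _ \<Rightarrow> ennreal) \<in> borel_measurable ?RN"
      by (subst borel_measurable_indicator_iff) (simp add: Int_commute)
    with wm have wm2: "(\<lambda>y. ennreal (log_gas_weight k N ?z y) * indicator {y. L2_set y {1..N} > \<epsilon>} y) \<in> borel_measurable ?RN"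
      by (rule borel_measurable_times_ennreal)
    have "{\<omega> \<in> space M. L2_set (\<lambda>i. X \<omega> i / sqrt (2 * k) - ?z i) {1..N} > \<epsilon>} = X -` (A \<inter> space ?RN) \<inter> space M"
      using measurable_space[OF distributed_measurable[OF dist]] by (auto simp: A_def)
    then have "emeasure M {\<omega> \<in> space M. L2_set (\<lambda>i. X \<omega> i / sqrt (2 * k) - ?z i) {1..N} > \<epsilon>}
       = (\<integral>\<^sup>+x. ennreal (C * f x) * indicator (A \<inter> space ?RN) x \<partial>?RN)"
      using distributed_emeasure[OF dist Am] by (simp add: C_def)
    also have "\<dots> = (\<integral>\<^sup>+x. ennreal (C * f x) * indicator A x \<partial>?RN)"
      by (rule nn_integral_cong) (auto simp: indicator_def)
    also have "\<dots> = ennreal (sqrt (2 * k) ^ N) * (\<integral>\<^sup>+y. ennreal (C * K) * (ennreal (log_gas_weight k N ?z y) * indicator {y. L2_set y {1..N} > \<epsilon>} y) \<partial>?RN)"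
      unfolding change[OF Am[unfolded Int_assoc]] split by (simp add: indicator_def A_coord mult.assoc)
    also have "\<dots> = \<gamma> * (\<integral>\<^sup>+y. ennreal (log_gas_weight k N ?z y) * indicator {y. L2_set y {1..N} > \<epsilon>} y \<partial>?RN)"
      unfolding \<gamma>_def by (subst nn_integral_cmult[OF wm2]) (simp add: mult.assoc)
    finally show "emeasure M {\<omega> \<in> space M. L2_set (\<lambda>i. X \<omega> i / sqrt (2 * k) - ?z i) {1..N} > \<epsilon>}
      = \<gamma> * (\<integral>\<^sup>+y. ennreal (log_gas_weight k N ?z y) * indicator {y. L2_set y {1..N} > \<epsilon>} y \<partial>?RN)" .
  qed
  let ?F = "\<lambda>y. exp ((1 - \<eta>) * k * (\<Sum>i\<in>{1..N}. (y i)\<^sup>2)) * log_gas_weight k N ?z y"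
  \<comment> \<open>On the event the squared norm is at least \<open>\<epsilon>\<^sup>2\<close>, and
    \<open>k * \<epsilon>\<^sup>2 = s / 2\<close>.\<close>
  have chernoff: "ennreal (log_gas_weight k N ?z y) * indicator {y. L2_set y {1..N} > \<epsilon>} y
      \<le> ennreal (exp (- ((1 - \<eta>) * (s / 2)))) * ennreal (?F y)" for y
  proof (cases "L2_set y {1..N} > \<epsilon>")
    case True
    then have "\<epsilon>\<^sup>2 \<le> (L2_set y {1..N})\<^sup>2" using \<epsilon> by (intro power_mono) auto
    then have "\<epsilon>\<^sup>2 \<le> (\<Sum>i\<in>{1..N}. (y i)\<^sup>2)" by (simp add: L2_set_def sum_nonneg)
    then have "(1 - \<eta>) * k * \<epsilon>\<^sup>2 \<le> (1 - \<eta>) * k * (\<Sum>i\<in>{1..N}. (y i)\<^sup>2)"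
      using \<eta> k0 by (intro mult_left_mono) auto
    then have "1 \<le> exp (- ((1 - \<eta>) * (s / 2)) + (1 - \<eta>) * k * (\<Sum>i\<in>{1..N}. (y i)\<^sup>2))"
      by (simp add: s_def mult.assoc)
    then have "1 * log_gas_weight k N ?z y \<le> exp (- ((1 - \<eta>) * (s / 2)) + (1 - \<eta>) * k * (\<Sum>i\<in>{1..N}. (y i)\<^sup>2)) * log_gas_weight k N ?z y"
      by (intro mult_right_mono) (auto simp: log_gas_weight_def)
    then have "log_gas_weight k N ?z y \<le> exp (- ((1 - \<eta>) * (s / 2))) * ?F y"
      by (simp only: mult_1 exp_add mult.assoc)
    then show ?thesis
      using True by (simp add: ennreal_leI flip: ennreal_mult')
  qed simp
  define U where "U = sqrt (pi / k) ^ N / sqrt (\<Prod>m<N. \<eta> + (1 - 2 * B / 3) * real m)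
      + exp (- (k * B\<^sup>2 * ((1 - 2 * B / 3) / 2 - (1 - 2 * B / 3)\<^sup>2 / 16))) * ((4 * sqrt N / (k * (1 - 2 * B / 3) * B)) ^ N / sqrt (\<Prod>m<N. \<eta> + real m))"
  define G where "G = sqrt (pi / k) ^ N / sqrt (\<Prod>m<N. 1 + 1 / (1 - B\<^sup>2) * real m)"
  define H where "H = exp (- (k * B\<^sup>2 / 2)) * (sqrt (pi / k) ^ N / sqrt (\<Prod>m<N. 1 + (1 / (1 - B\<^sup>2) - 1 / 2) * real m))"
  have V: "0 < G - H" and UV: "exp (- ((1 - \<eta>) * (s / 2))) * U \<le> T * (G - H)"
    using const unfolding U_def G_def H_def by simp_all
  have "(\<integral>\<^sup>+y. ennreal (log_gas_weight k N ?z y) * indicator {y. L2_set y {1..N} > \<epsilon>} y \<partial>?RN)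
    \<le> (\<integral>\<^sup>+y. ennreal (exp (- ((1 - \<eta>) * (s / 2)))) * ennreal (?F y) \<partial>?RN)"
    by (intro nn_integral_mono chernoff)
  also have "\<dots> = ennreal (exp (- ((1 - \<eta>) * (s / 2)))) * (\<integral>\<^sup>+y. ennreal (?F y) \<partial>?RN)"
    by (rule nn_integral_cmult) measurable
  also have "\<dots> \<le> ennreal (exp (- ((1 - \<eta>) * (s / 2)))) * ennreal U"
    unfolding U_def by (intro mult_left_mono upper) simp
  also have "\<dots> = ennreal (exp (- ((1 - \<eta>) * (s / 2))) * U)"
    by (simp add: ennreal_mult')
  also have "\<dots> \<le> ennreal (T * (G - H))" by (rule ennreal_leI[OF UV])
  also have "\<dots> = ennreal T * ennreal (G - H)" using T by (simp add: ennreal_mult')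
  \<comment> \<open>The lower bound has the form \<open>G \<le> W + H\<close>; for finite
    \<open>W\<close> the subtraction is carried out in the reals, and infinite \<open>W\<close> is
    trivial.\<close>
  also have "ennreal (G - H) \<le> W"
  proof (cases W)
    case (real w)
    have "ennreal G \<le> ennreal w + ennreal H"
      using lower unfolding G_def H_def W_def[symmetric] real by simp
    moreover have "0 \<le> H"
    proof -
      have "B\<^sup>2 < 1" using B by (simp add: power_less_one_iff abs_square_less_1)
      then have "1 \<le> 1 / (1 - B\<^sup>2)" using B by (simp add: le_divide_eq)
      then show ?thesis unfolding H_def using k0
        by (intro mult_nonneg_nonneg divide_nonneg_nonneg real_sqrt_ge_zero prod_nonneg add_nonneg_nonneg) auto
    qed
    ultimately have "G \<le> w + H" using real by (simp flip: ennreal_plus)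
    then show ?thesis using real by (simp add: ennreal_leI)
  qed simp
  then have "ennreal T * ennreal (G - H) \<le> ennreal T * W" by (intro mult_left_mono) auto
  finally have "emeasure M {\<omega> \<in> space M. L2_set (\<lambda>i. X \<omega> i / sqrt (2 * k) - ?z i) {1..N} > \<epsilon>} \<le> \<gamma> * (ennreal T * W)"
    unfolding event by (intro mult_left_mono) auto
  also have "\<dots> = ennreal T * (\<gamma> * W)" by (simp only: mult.left_commute)
  also have "\<dots> = ennreal T" by (simp add: total)
  finally have "measure M {\<omega> \<in> space M. L2_set (\<lambda>i. X \<omega> i / sqrt (2 * k) - ?z i) {1..N} > \<epsilon>} \<le> T"
    using T by (simp add: emeasure_eq_measure)
  then show ?thesis by (simp add: T_def s_def)
qed

section \<open>Reduction of the stated bound to the tail bound\<close>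

theorem proposition2p5:
  fixes M :: "'a measure" and X :: "'a \<Rightarrow> nat \<Rightarrow> real"
    and N :: nat and k \<epsilon> :: real
  assumes "prob_space M"
    and "2 \<le> N" and "1 \<le> k" and "0 < \<epsilon>"
    and "sqrt ((1 + ln (real N)) / (2 * k)) \<le> \<epsilon>"
    and "\<epsilon> \<le> 1 / (2 * sqrt (real N))"
    and "hermite_ensemble M X k N"
  shows "measure M {\<omega> \<in> space M.
           L2_set (\<lambda>i. X \<omega> i / sqrt (2 * k) - hermite_zeros N i) {1..N} > \<epsilon>}
    \<le> 32 / 3 * \<epsilon> ^ 4 * k * real N ^ 3 - (real N - 1) / (26 * k)
      + exp (1 / k * ((real N - 1) / 26 - 32 / 3 * \<epsilon> ^ 4 * k ^ 2 * real N ^ 3))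
        * (sqrt (exp 1) * sqrt (real N) / 2) * (2 * k * \<epsilon> ^ 2 + 1) * exp (- (k * \<epsilon> ^ 2))"
proof -
  interpret prob_space M by fact
  let ?P = "measure M {\<omega> \<in> space M. L2_set (\<lambda>i. X \<omega> i / sqrt (2 * k) - hermite_zeros N i) {1..N} > \<epsilon>}"
  define s where "s = 2 * k * \<epsilon>\<^sup>2"
  define \<delta> where "\<delta> = 32 / 3 * \<epsilon> ^ 4 * k * real N ^ 3 - (real N - 1) / (26 * k)"
  define T where "T = sqrt (exp 1) * sqrt N / 2 * (s + 1) * exp (- (s / 2))"
  have k: "0 < k" using assms(3) by simp
  have N2: "2 \<le> real N" using assms(2) by simp
  have "0 \<le> s" using k by (simp add: s_def)
  then have T0: "0 \<le> T" by (simp add: T_def)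
  \<comment> \<open>The polynomial part of the bound is \<open>\<delta>\<close>, and the exponent of
    the prefactor is exactly \<open>- \<delta>\<close>.\<close>
  have exponent: "1 / k * ((real N - 1) / 26 - 32 / 3 * \<epsilon> ^ 4 * k ^ 2 * real N ^ 3) = - \<delta>"
    using k by (simp add: \<delta>_def field_simps power2_eq_square)
  have rhs: "32 / 3 * \<epsilon> ^ 4 * k * real N ^ 3 - (real N - 1) / (26 * k)
      + exp (1 / k * ((real N - 1) / 26 - 32 / 3 * \<epsilon> ^ 4 * k ^ 2 * real N ^ 3))
        * (sqrt (exp 1) * sqrt (real N) / 2) * (2 * k * \<epsilon> ^ 2 + 1) * exp (- (k * \<epsilon> ^ 2)) = \<delta> + exp (- \<delta>) * T"
    unfolding exponent \<delta>_def[symmetric] by (simp add: T_def s_def)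
  have s1: "1 \<le> s"
  proof -
    have "(1 + ln (real N)) / (2 * k) \<le> \<epsilon>\<^sup>2"
      using assms(5) by (rule sqrt_le_D)
    then have "1 + ln (real N) \<le> s" using k by (simp add: s_def field_simps)
    moreover have "0 \<le> ln (real N)" using N2 by simp
    ultimately show ?thesis by linarith
  qed
  have \<delta>k: "\<delta> * k = 8 / 3 * s\<^sup>2 * real N ^ 3 - (real N - 1) / 26"
  proof -
    have "\<epsilon> ^ 4 * k * k = s\<^sup>2 / 4"
      by (simp add: s_def power2_eq_square numeral_eq_Suc)
    then have "32 / 3 * \<epsilon> ^ 4 * k * real N ^ 3 * k = 32 / 3 * (s\<^sup>2 / 4) * real N ^ 3"
      by (simp add: mult_ac)
    moreover have "(real N - 1) / (26 * k) * k = (real N - 1) / 26" using k by simp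
    ultimately show ?thesis unfolding \<delta>_def left_diff_distrib by linarith
  qed
  have N3: "real N - 1 \<le> real N ^ 3"
    using self_le_power[of "real N" 3] N2 by linarith
  have "1 \<le> s\<^sup>2" using s1 by simp
  then have "1 * real N ^ 3 \<le> s\<^sup>2 * real N ^ 3"
    by (rule mult_right_mono) simp
  moreover have "0 \<le> 8 / 3 * x - (n - 1) / 26" if "1 * c \<le> x" "n - 1 \<le> c" "2 \<le> n" for x c n :: real
    using that by (simp add: field_simps)
  ultimately have "0 \<le> \<delta> * k" unfolding \<delta>k mult.assoc using N3 N2 by blast
  then have \<delta>0: "0 \<le> \<delta>" using k by (simp add: zero_le_mult_iff)
  have P1: "?P \<le> 1" by simp
  have e: "1 - \<delta> \<le> exp (- \<delta>)" using exp_ge_add_one_self[of "- \<delta>"] by simp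
  show ?thesis
  proof (cases "1 \<le> \<delta> \<or> 1 \<le> T")
    case True
    then have "1 \<le> \<delta> + exp (- \<delta>) * T"
    proof
      assume "1 \<le> T"
      then have "exp (- \<delta>) * 1 \<le> exp (- \<delta>) * T" by (rule mult_left_mono) simp
      then show "1 \<le> \<delta> + exp (- \<delta>) * T" using e unfolding mult_1_right by linarith
    qed (use T0 in \<open>simp add: add_increasing2\<close>)
    then show ?thesis unfolding rhs using P1 by linarith
  next
    case False
    have "3 < s"
    proof (rule ccontr)
      assume "\<not> 3 < s"
      then have s3: "s \<le> 3" by simp
      \<comment> \<open>On \<open>1 \<le> s \<le> 3\<close> this shows that
        \<open>(s + 1) * exp (- (s / 2))\<close> is at least its value at \<open>s = 3\<close>; the
        comparison of denominators uses \<open>s \<ge> 1\<close>. Then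
        \<open>T \<ge> 2 * sqrt N / e\<close>, which exceeds 1 because
        \<open>N \<ge> 2\<close>.\<close>
      have "4 / (s + 1) \<le> exp (4 / (s + 1) - 1)" using exp_ge_add_one_self[of "4 / (s + 1) - 1"] by simp
      also have "\<dots> \<le> exp ((3 - s) / 2)"
      proof -
        have "4 / (s + 1) - 1 = (3 - s) / (s + 1)" using s1 by (simp add: field_simps)
        also have "\<dots> \<le> (3 - s) / 2" using s1 s3 by (intro divide_left_mono) auto
        finally show ?thesis by simp
      qed
      finally have "4 \<le> (s + 1) * exp ((3 - s) / 2)" using s1 by (simp add: field_simps)
      then have "4 * exp (- (3 / 2)) \<le> (s + 1) * exp ((3 - s) / 2) * exp (- (3 / 2))"
        by (intro mult_right_mono) auto
      also have "\<dots> = (s + 1) * exp (- (s / 2))"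
        by (simp add: mult.assoc exp_add[symmetric] field_simps)
      finally have "sqrt (exp 1) * sqrt N / 2 * (4 * exp (- (3 / 2))) \<le> sqrt (exp 1) * sqrt N / 2 * ((s + 1) * exp (- (s / 2)))"
        by (intro mult_left_mono) auto
      then have "sqrt (exp 1) * sqrt N / 2 * (4 * exp (- (3 / 2))) \<le> T"
        by (simp add: T_def mult.assoc)
      moreover have "sqrt (exp 1) * sqrt N / 2 * (4 * exp (- (3 / 2))) = 2 * sqrt N / exp 1"
      proof -
        have "sqrt (exp 1) = exp (1 / 2)"
          by (rule real_sqrt_unique) (simp_all add: exp_double[symmetric])
        moreover have "exp (1 / 2) * exp (- (3 / 2)) = exp (- 1 :: real)"
          by (simp add: exp_add[symmetric])
        ultimately show ?thesis by (simp add: exp_minus field_simps)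
      qed
      moreover have "1 \<le> 2 * sqrt N / exp 1"
      proof -
        have "14 / 10 \<le> sqrt N" using N2 by (intro real_le_rsqrt) (simp add: power_divide)
        then show ?thesis using e_less_272 by (simp add: le_divide_eq)
      qed
      ultimately have "1 \<le> T" by linarith
      then show False using False by simp
    qed
    \<comment> \<open>From \<open>\<delta> < 1\<close> and \<open>s > 3\<close> one gets
      \<open>k \<ge> 24 N^3 - (N - 1) / 26\<close>, and the subtracted term is at most
      \<open>N^3\<close>.\<close>
    have "23 * real N ^ 3 \<le> k"
    proof -
      have "9 \<le> s\<^sup>2" using \<open>3 < s\<close> power_mono[of 3 s 2] by simp
      then have "9 * real N ^ 3 \<le> s\<^sup>2 * real N ^ 3"
        by (rule mult_right_mono) simp
      moreover have "\<delta> * k \<le> 1 * k" using False k by (intro mult_right_mono) auto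
      moreover have "23 * c \<le> k"
        if "9 * c \<le> x" "8 / 3 * x - (n - 1) / 26 \<le> 1 * k" "n - 1 \<le> c" "2 \<le> n" for x c n :: real
        using that by (simp add: field_simps)
      ultimately show ?thesis using N3 N2 unfolding \<delta>k mult.assoc by blast
    qed
    then have "?P \<le> T"
      using hermite_ensemble_tail[OF assms(1,7,2) _ assms(4)] \<open>3 < s\<close>
      by (simp add: T_def s_def)
    \<comment> \<open>Equivalent to \<open>\<delta> * T \<le> \<delta>\<close>, true because
      \<open>T < 1\<close> in this case.\<close>
    also have "T \<le> \<delta> + (1 - \<delta>) * T"
      using mult_left_mono[of T 1 \<delta>] False \<delta>0 by (simp add: algebra_simps)
    also have "\<dots> \<le> \<delta> + exp (- \<delta>) * T"
      using e T0 by (intro add_left_mono mult_right_mono)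
    finally show ?thesis unfolding rhs .
  qed
qed

end
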